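(* Let $\gamma\in(1/2,\infty)$ be non-exceptional. Then there exists a real analytic surface $$M:\ z_2=z_1\bar z_1+\gamma z_1^2+\gamma\bar z_1^2+q(z_1,\bar z_1)$$ in $\mathbb{C}^2$, with $q$ a convergent power series starting with terms of order three, such that $M$ can be mapped by a biholomorphic map defined near $0$ into a real hyperplane of $\mathbb{C}^2$, but there is no biholomorphic map near $0$ transforming $M$ into a surface of the form $$x_2=z_1\bar z_1+(\gamma+\epsilon x_2^s)(z_1^2+\bar z_1^2),\quad y_2=0,$$ where either $\epsilon=0$, or $\epsilon=\pm1$ and $s$ is a positive integer.
   Context: Coordinates on $\mathbb{C}^2$ are $(z_1,z_2)$ with $z_2=x_2+iy_2$. For $\gamma>1/2$ let $\lambda$ be a root of $\gamma\lambda^2-\lambda+\gamma=0$ (so $|\lambda|=1$); $\gamma$ is called exceptional if $\lambda$ is a root of unity. *)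

theory Defs
  imports "HOL-Analysis.Analysis"
begin

definition cmult2 :: "complex \<Rightarrow> complex \<times> complex \<Rightarrow> complex \<times> complex" where
  "cmult2 c p = (c * fst p, c * snd p)"

definition holomorphic2_on ::
  "(complex \<times> complex \<Rightarrow> complex \<times> complex) \<Rightarrow> (complex \<times> complex) set \<Rightarrow> bool" where
  "holomorphic2_on F U \<longleftrightarrow>
     (\<forall>p\<in>U. \<exists>L. (F has_derivative L) (at p) \<and> (\<forall>c v. L (cmult2 c v) = cmult2 c (L v)))"

definition biholomorphic2_on ::
  "(complex \<times> complex \<Rightarrow> complex \<times> complex) \<Rightarrow> (complex \<times> complex) set \<Rightarrow> bool" where
  "biholomorphic2_on F U \<longleftrightarrow>
     open U \<and> holomorphic2_on F U \<and> inj_on F U \<and> open (F ` U) \<and>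
     holomorphic2_on (inv_into U F) (F ` U)"

definition real_hyperplane :: "(complex \<times> complex) set \<Rightarrow> bool" where
  "real_hyperplane H \<longleftrightarrow> (\<exists>w c. w \<noteq> 0 \<and> H = {p. inner w p = c})"

definition exceptional :: "real \<Rightarrow> bool" where
  "exceptional \<gamma> \<longleftrightarrow>
     (\<exists>l::complex. of_real \<gamma> * l^2 - l + of_real \<gamma> = 0 \<and> (\<exists>n::nat. n > 0 \<and> l ^ n = 1))"

definition pseries2 :: "(nat \<Rightarrow> nat \<Rightarrow> complex) \<Rightarrow> complex \<Rightarrow> complex" where
  "pseries2 c z = (\<Sum>\<^sub>\<infinity>(j,k)\<in>UNIV. c j k * z ^ j * cnj z ^ k)"

definition conv_pseries2 :: "(nat \<Rightarrow> nat \<Rightarrow> complex) \<Rightarrow> real \<Rightarrow> bool" where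
  "conv_pseries2 c r \<longleftrightarrow> r > 0 \<and> (\<lambda>(j,k). norm (c j k) * r ^ (j + k)) summable_on UNIV"

definition surfM :: "real \<Rightarrow> (nat \<Rightarrow> nat \<Rightarrow> complex) \<Rightarrow> real \<Rightarrow> (complex \<times> complex) set" where
  "surfM \<gamma> c r = {(z, z * cnj z + of_real \<gamma> * z^2 + of_real \<gamma> * (cnj z)^2 + pseries2 c z) | z. cmod z < r}"

definition normal_surf :: "real \<Rightarrow> real \<Rightarrow> nat \<Rightarrow> (complex \<times> complex) set" where
  "normal_surf \<gamma> \<epsilon> s = {(z1, z2). Im z2 = 0 \<and>
     complex_of_real (Re z2) = z1 * cnj z1 + of_real (\<gamma> + \<epsilon> * (Re z2) ^ s) * (z1^2 + (cnj z1)^2)}"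

end

theory Submission
  imports Defs "HOL-Complex_Analysis.Complex_Analysis"
begin

text \<open>
  The surfaces are sought in the family \<open>t = h\<^sub>s(z, w)\<close>, \<open>w\<close> being the complexified conjugate of \<open>z\<close>,
  where \<open>h\<^sub>s = h\<^sub>0 + s p\<close> is affine in a real parameter \<open>s\<close> and \<open>h\<^sub>0\<close> solves
  \<open>t = z w + (\<gamma> + t) (z\<^sup>2 + w\<^sup>2)\<close>, so that \<open>s = 0\<close> is already in normal form. All of them lie in
  \<open>y\<^sub>2 = 0\<close>, and a biholomorphic map into the normal form restricts to convergent normalizing series.

  Suppose that \<open>h\<^sub>s\<close> is normalizable for every \<open>s\<close>. On the conic \<open>z w + \<gamma> (z\<^sup>2 + w\<^sup>2) = t\<close>, comparison of
  leading Laurent coefficients shows that the normalization is unique, because \<open>\<lambda>\<close> is not a root of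
  unity, and that its coefficients are polynomials in \<open>s\<close> of degree at most their weight. The
  convergence is uniform on an interval by Baire's theorem, so Lagrange interpolation bounds the
  derivatives of these coefficients at \<open>s = 0\<close> geometrically: the linearized equation at \<open>h\<^sub>0\<close> has a
  convergent solution. However, there are arbitrarily small \<open>t\<close> for which the two involutions of the conic
  \<open>z w + (\<gamma> + t) (z\<^sup>2 + w\<^sup>2) = t\<close> generate a finite group. Summing over an orbit cancels every term
  of the linearized equation but the one from \<open>p\<close>, and \<open>p\<close> is chosen so that this orbit sum has a pole.
\<close>

subsection \<open>Holomorphic functions of two variables\<close>

text \<open>Dividing the first component of a normalizing map by its z-derivative at
  \<open>z = 0\<close>, a unit in t, and the equation by the unit \<open>k / t\<close>, puts all
  normal forms into one class: \<open>t = a2(t) u v + a3(t) u^2 + a4(t) v^2\<close>, the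
  z-coefficient of u and the w-coefficient of v being 1. The sign and the exponent disappear into
  a2, a3, a4, and it is this larger class that is shown to be unattainable.

  Since t is quadratic to leading order, z and w get weight 1 and t weight 2; then every weight
  leads to the same linear operator on the conic at level 1.

  The obstacle is that \<open>l^(2n) - 1\<close> may be small or not, depending on arithmetic
  properties of \<open>l\<close> that are not at hand. Divergence is therefore extracted from nearby
  levels. The base surface has \<open>g + t\<close> where a normal form could have the constant
  \<open>g\<close>, so its rotation number moves with t and meets roots of unity arbitrarily close
  to \<open>t = 0\<close>, whatever \<open>l\<close> is; a constant coefficient would give the same
  aperiodic rotation on all levels. The pole must survive the averaging over an orbit of unknown
  length, hence a perturbation built from functions whose real part is bounded below.\<close>

definition hol2 :: "(complex \<times> complex \<Rightarrow> complex) \<Rightarrow> (complex \<times> complex) set \<Rightarrow> bool" where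
  "hol2 f S \<longleftrightarrow>
     (\<forall>p\<in>S. \<exists>L. (f has_derivative L) (at p) \<and> (\<forall>c v. L (cmult2 c v) = c * L v))"

lemma hol2_subset: "hol2 f S \<Longrightarrow> T \<subseteq> S \<Longrightarrow> hol2 f T"
  unfolding hol2_def by blast

lemma hol2_const [intro]: "hol2 (\<lambda>p. c) S"
  unfolding hol2_def by (auto intro!: exI[of _ "\<lambda>_. 0"])

lemma hol2_fst [intro]: "hol2 fst S"
  unfolding hol2_def
  by (intro ballI exI[of _ fst]) (auto simp: cmult2_def intro!: derivative_eq_intros bounded_linear_imp_has_derivative bounded_linear_fst)

lemma hol2_snd [intro]: "hol2 snd S"
  unfolding hol2_def
  by (intro ballI exI[of _ snd]) (auto simp: cmult2_def intro!: bounded_linear_imp_has_derivative bounded_linear_snd)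

lemma hol2_add [intro]: assumes "hol2 f S" "hol2 g S" shows "hol2 (\<lambda>p. f p + g p) S"
  unfolding hol2_def
proof
  fix p assume "p \<in> S"
  then obtain L M where "(f has_derivative L) (at p)" "(g has_derivative M) (at p)"
    "\<forall>c v. L (cmult2 c v) = c * L v" "\<forall>c v. M (cmult2 c v) = c * M v"
    using assms unfolding hol2_def by metis
  then show "\<exists>L. ((\<lambda>p. f p + g p) has_derivative L) (at p) \<and> (\<forall>c v. L (cmult2 c v) = c * L v)"
    by (intro exI[of _ "\<lambda>v. L v + M v"]) (auto intro!: has_derivative_add simp: algebra_simps)
qed

lemma hol2_mult [intro]: assumes "hol2 f S" "hol2 g S" shows "hol2 (\<lambda>p. f p * g p) S"
  unfolding hol2_def
proof
  fix p assume "p \<in> S"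
  then obtain L M where "(f has_derivative L) (at p)" "(g has_derivative M) (at p)"
    "\<forall>c v. L (cmult2 c v) = c * L v" "\<forall>c v. M (cmult2 c v) = c * M v"
    using assms unfolding hol2_def by metis
  then show "\<exists>L. ((\<lambda>p. f p * g p) has_derivative L) (at p) \<and> (\<forall>c v. L (cmult2 c v) = c * L v)"
    by (intro exI[of _ "\<lambda>v. f p * M v + L v * g p"] conjI has_derivative_mult) (simp_all add: algebra_simps)
qed

lemma hol2_diff [intro]: assumes "hol2 f S" "hol2 g S" shows "hol2 (\<lambda>p. f p - g p) S"
proof -
  have "hol2 (\<lambda>p. f p + (-1) * g p) S" using assms by (intro hol2_add hol2_mult hol2_const)
  then show ?thesis by simp
qed

lemma hol2_power [intro]: assumes "hol2 f S" shows "hol2 (\<lambda>p. f p ^ n) S"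
  by (induction n) (auto intro!: hol2_mult assms)

lemma hol2_compose1:
  assumes "hol2 f S" "g holomorphic_on T" "open T" "\<And>p. p \<in> S \<Longrightarrow> f p \<in> T"
  shows "hol2 (\<lambda>p. g (f p)) S"
  unfolding hol2_def
proof
  fix p assume p: "p \<in> S"
  then obtain L where L: "(f has_derivative L) (at p)" "\<forall>c v. L (cmult2 c v) = c * L v"
    using assms unfolding hol2_def by metis
  have "(g has_field_derivative deriv g (f p)) (at (f p))"
    using assms p holomorphic_derivI by blast
  then have "(g has_derivative times (deriv g (f p))) (at (f p))"
    by (simp add: has_field_derivative_def)
  from has_derivative_compose[OF L(1) this] L(2)
  show "\<exists>L. ((\<lambda>p. g (f p)) has_derivative L) (at p) \<and> (\<forall>c v. L (cmult2 c v) = c * L v)"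
    by (intro exI[of _ "\<lambda>v. deriv g (f p) * L v"]) auto
qed

lemma hol2_inverse [intro]:
  assumes "hol2 f S" "\<And>p. p \<in> S \<Longrightarrow> f p \<noteq> 0" shows "hol2 (\<lambda>p. inverse (f p)) S"
  by (rule hol2_compose1[OF assms(1), of inverse "-{0}"])
     (auto intro!: holomorphic_intros simp: assms(2))

lemma hol2_divide [intro]:
  assumes "hol2 f S" "hol2 g S" "\<And>p. p \<in> S \<Longrightarrow> g p \<noteq> 0" shows "hol2 (\<lambda>p. f p / g p) S"
  unfolding divide_inverse using assms by (intro hol2_mult hol2_inverse)

lemma hol2_compose2:
  assumes "hol2 f T" "hol2 g S" "hol2 h S" "\<And>p. p \<in> S \<Longrightarrow> (g p, h p) \<in> T"
  shows "hol2 (\<lambda>p. f (g p, h p)) S"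
  unfolding hol2_def
proof
  fix p assume p: "p \<in> S"
  then obtain L M where *: "(g has_derivative L) (at p)" "(h has_derivative M) (at p)"
    "\<forall>c v. L (cmult2 c v) = c * L v" "\<forall>c v. M (cmult2 c v) = c * M v"
    using assms unfolding hol2_def by metis
  obtain N where N: "(f has_derivative N) (at (g p, h p))" "\<forall>c v. N (cmult2 c v) = c * N v"
    using assms(1,4) p unfolding hol2_def by metis
  have "((\<lambda>p. f (g p, h p)) has_derivative (\<lambda>v. N (L v, M v))) (at p)"
    by (rule has_derivative_compose[OF has_derivative_Pair[OF *(1,2)] N(1)])
  moreover have "N (L (cmult2 c v), M (cmult2 c v)) = c * N (L v, M v)" for c v
    using N(2)[rule_format, of c "(L v, M v)"] * by (simp add: cmult2_def)
  ultimately show "\<exists>L. ((\<lambda>p. f (g p, h p)) has_derivative L) (at p) \<and> (\<forall>c v. L (cmult2 c v) = c * L v)"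
    by blast
qed

lemma hol2_curve:
  assumes "hol2 f T" "g holomorphic_on S" "h holomorphic_on S" "open S"
    "\<And>z. z \<in> S \<Longrightarrow> (g z, h z) \<in> T"
  shows "(\<lambda>z. f (g z, h z)) holomorphic_on S"
  unfolding holomorphic_on_open[OF assms(4)]
proof
  fix z assume z: "z \<in> S"
  have gd: "(g has_derivative times (deriv g z)) (at z)" and hd: "(h has_derivative times (deriv h z)) (at z)"
    using holomorphic_derivI[OF assms(2) assms(4) z] holomorphic_derivI[OF assms(3) assms(4) z]
    by (auto simp: has_field_derivative_def)
  obtain N where N: "(f has_derivative N) (at (g z, h z))" "\<forall>c v. N (cmult2 c v) = c * N v"
    using assms(1,5) z unfolding hol2_def by metis
  have "((\<lambda>p. f (g p, h p)) has_derivative (\<lambda>v. N (deriv g z * v, deriv h z * v))) (at z)"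
    by (rule has_derivative_compose[OF has_derivative_Pair[OF gd hd] N(1)])
  moreover have "N (deriv g z * v, deriv h z * v) = N (deriv g z, deriv h z) * v" for v
    using N(2)[rule_format, of v "(deriv g z, deriv h z)"] by (simp add: cmult2_def mult.commute)
  ultimately have "((\<lambda>p. f (g p, h p)) has_field_derivative N (deriv g z, deriv h z)) (at z)"
    by (simp add: has_field_derivative_def)
  then show "\<exists>f'. ((\<lambda>z. f (g z, h z)) has_field_derivative f') (at z)" by blast
qed

lemma hol2_imp_continuous_on: "hol2 f S \<Longrightarrow> continuous_on S f"
  unfolding hol2_def
  by (metis continuous_at_imp_continuous_on has_derivative_continuous)

lemma has_derivative_cnj: "(cnj has_derivative cnj) F"
  by (rule bounded_linear_imp_has_derivative) (rule bounded_linear_cnj)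

lemma hol2_cnj:
  assumes "hol2 f T" "\<And>p. p \<in> S \<Longrightarrow> (cnj (fst p), cnj (snd p)) \<in> T"
  shows "hol2 (\<lambda>p. cnj (f (cnj (fst p), cnj (snd p)))) S"
  unfolding hol2_def
proof
  fix p assume p: "p \<in> S"
  obtain N where N: "(f has_derivative N) (at (cnj (fst p), cnj (snd p)))" "\<forall>c v. N (cmult2 c v) = c * N v"
    using assms p unfolding hol2_def by metis
  have 1: "((\<lambda>p. cnj (fst p)) has_derivative (\<lambda>p. cnj (fst p))) (at p)"
          "((\<lambda>p. cnj (snd p)) has_derivative (\<lambda>p. cnj (snd p))) (at p)" for p :: "complex \<times> complex"
    by (rule has_derivative_compose[OF _ has_derivative_cnj],
        rule bounded_linear_imp_has_derivative, rule bounded_linear_fst bounded_linear_snd)+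
  have "((\<lambda>p. f (cnj (fst p), cnj (snd p))) has_derivative (\<lambda>v. N (cnj (fst v), cnj (snd v)))) (at p)"
    by (rule has_derivative_compose[OF has_derivative_Pair[OF 1] N(1)])
  then have "((\<lambda>p. cnj (f (cnj (fst p), cnj (snd p)))) has_derivative (\<lambda>v. cnj (N (cnj (fst v), cnj (snd v))))) (at p)"
    by (rule has_derivative_compose[OF _ has_derivative_cnj])
  moreover have "cnj (N (cnj (fst (cmult2 c v)), cnj (snd (cmult2 c v)))) = c * cnj (N (cnj (fst v), cnj (snd v)))" for c v
    using N(2)[rule_format, of "cnj c" "(cnj (fst v), cnj (snd v))"] by (simp add: cmult2_def)
  ultimately show "\<exists>L. ((\<lambda>p. cnj (f (cnj (fst p), cnj (snd p)))) has_derivative L) (at p) \<and> (\<forall>c v. L (cmult2 c v) = c * L v)"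
    by blast
qed

section \<open>Double power series of functions holomorphic on a bidisc\<close>

abbreviation bidisc :: "real \<Rightarrow> (complex \<times> complex) set" where
  "bidisc r \<equiv> ball 0 r \<times> ball 0 r"

lemma hol2_slices:
  assumes "hol2 f (bidisc R)"
  shows "(w::complex) \<in> ball 0 R \<Longrightarrow> (\<lambda>z. f (z, w)) holomorphic_on ball 0 R"
    and "(z::complex) \<in> ball 0 R \<Longrightarrow> (\<lambda>w. f (z, w)) holomorphic_on ball 0 R"
  by (rule hol2_curve[OF assms]; auto intro!: holomorphic_intros)+

lemma hol2_bounded_on_smaller:
  assumes "hol2 f (bidisc R)" "r < R"
  obtains B where "B > 0" "\<And>z w. norm z \<le> r \<Longrightarrow> norm w \<le> r \<Longrightarrow> norm (f (z, w)) \<le> B"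
proof -
  have "continuous_on (cball 0 r \<times> cball 0 r) f"
    by (rule continuous_on_subset[OF hol2_imp_continuous_on[OF assms(1)]]) (use assms(2) in auto)
  moreover have "compact (cball (0::complex) r \<times> cball (0::complex) r)"
    by (intro compact_Times compact_cball)
  ultimately have "bounded (f ` (cball 0 r \<times> cball 0 r))"
    using compact_continuous_image compact_imp_bounded by blast
  then obtain B where "B > 0" "\<forall>x \<in> cball 0 r \<times> cball 0 r. norm (f x) \<le> B"
    by (auto simp: bounded_pos)
  then show ?thesis by (intro that[of B]) auto
qed

lemma Taylor_coeff_bound:
  assumes "f holomorphic_on ball 0 R" "0 < r" "r < R" "\<And>z. norm z \<le> r \<Longrightarrow> norm (f z) \<le> B"
  shows "norm ((deriv ^^ j) f 0 / fact j) \<le> B / r ^ j"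
proof -
  have "norm ((deriv ^^ j) f 0) \<le> fact j * B / r ^ j"
  proof (rule Cauchy_inequality)
    show "f holomorphic_on ball 0 r" by (rule holomorphic_on_subset[OF assms(1)]) (use assms in auto)
    show "continuous_on (cball 0 r) f"
      by (rule continuous_on_subset[OF holomorphic_on_imp_continuous_on[OF assms(1)]]) (use assms in auto)
  qed (use assms in auto)
  then show ?thesis using assms(2) by (simp add: norm_divide divide_simps mult.commute)
qed

text \<open>Induction on j: subtracting the lower Taylor terms and dividing by \<open>z^j\<close>
  gives quotients that are holomorphic in w for fixed z, and along a sequence of z tending to 0 they
  converge locally uniformly in w to the coefficient.\<close>

lemma Taylor_coeff_holomorphic:
  assumes f: "hol2 f (bidisc R)"
  shows "(\<lambda>w. (deriv ^^ j) (\<lambda>z. f (z, w)) 0 / fact j) holomorphic_on ball 0 R"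
proof (induction j rule: less_induct)
  case (less j)
  define a where "a = (\<lambda>i w. (deriv ^^ i) (\<lambda>z. f (z, w)) 0 / fact i)"
  show ?case
    unfolding a_def[symmetric, THEN fun_cong]
  proof (rule holomorphic_uniform_sequence[OF open_ball])
    define z where "z = (\<lambda>n::nat. of_real (R / (real n + 2)) :: complex)"
    show "(\<lambda>w. (f (z n, w) - (\<Sum>i<j. a i w * z n ^ i)) / z n ^ j) holomorphic_on ball 0 R" for n
    proof (cases "R > 0")
      case True
      then have "z n \<in> ball 0 R" "z n \<noteq> 0" unfolding z_def mem_ball_0 norm_of_real of_real_eq_0_iff by (auto simp: field_simps intro!: add_pos_nonneg)
      then show ?thesis using less hol2_slices(2)[OF f]
        by (intro holomorphic_intros) (auto simp: a_def)
    qed (simp add: ball_empty holomorphic_on_def)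
    fix w :: complex assume w: "w \<in> ball 0 R"
    then have R: "R > 0" using norm_ge_zero[of w] unfolding mem_ball_0 by linarith
    define r where "r = (R + norm w) / 2"
    have r: "norm w < r" "r < R" "r > 0" using w R by (auto simp: r_def intro: add_pos_nonneg)
    obtain B where B: "B > 0" "\<And>z w. norm z \<le> r \<Longrightarrow> norm w \<le> r \<Longrightarrow> norm (f (z, w)) \<le> B"
      using hol2_bounded_on_smaller[OF f r(2)] by metis
    define d where "d = r - norm w"
    have d: "d > 0" "\<And>v. v \<in> cball w d \<Longrightarrow> norm v \<le> r"
      using r by (auto simp: d_def) (smt (verit) dist_norm norm_triangle_ineq2 norm_minus_commute)
    have ab: "norm (a i v) \<le> B / r ^ i" if "v \<in> cball w d" for i v
      unfolding a_def
      by (rule Taylor_coeff_bound[where R=R], rule hol2_slices(1)[OF f])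
         (use r d(2)[OF that] B in auto)
    have "uniform_limit (cball w d) (\<lambda>n w. (f (z n, w) - (\<Sum>i<j. a i w * z n ^ i)) / z n ^ j) (a j) sequentially"
    proof (rule uniform_limitI)
      fix e :: real assume e: "e > 0"
      \<comment> \<open>Twice the Cauchy bound of the next Taylor coefficient: the tail is geometric
        with ratio at most 1/2, so the quotient differs from \<open>a j\<close> by at most
        \<open>M * norm (z n)\<close>, uniformly in v.\<close>
      define M where "M = 2 * B / r ^ Suc j"
      have M: "M > 0" using B r by (auto simp: M_def)
      have zlim: "z \<longlonglongrightarrow> 0"
        unfolding z_def by (rule tendsto_of_real[where a=0, simplified]) real_asymp
      have "\<forall>\<^sub>F n in sequentially. norm (z n) < min (r/2) (e / M)"
        using zlim e M r by (intro order_tendstoD[OF tendsto_norm_zero]) auto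
      then show "\<forall>\<^sub>F n in sequentially. \<forall>x\<in>cball w d. dist ((f (z n, x) - (\<Sum>i<j. a i x * z n ^ i)) / z n ^ j) (a j x) < e"
      proof (eventually_elim, intro ballI)
        fix n v assume n: "norm (z n) < min (r/2) (e / M)" and v: "v \<in> cball w d"
        have z0: "z n \<noteq> 0" "z n \<in> ball 0 R" using R unfolding z_def mem_ball_0 norm_of_real of_real_eq_0_iff by (auto simp: field_simps intro!: add_pos_nonneg)
        have "v \<in> ball 0 R" using d(2)[OF v] r by auto
        then have "(\<lambda>i. a i v * z n ^ i) sums f (z n, v)"
          using holomorphic_power_series[OF hol2_slices(1)[OF f], of v "z n"] z0 unfolding a_def by simp
        then have "(\<lambda>i. a (i + Suc j) v * z n ^ (i + Suc j)) sums (f (z n, v) - (\<Sum>i<Suc j. a i v * z n ^ i))"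
          by (rule sums_split_initial_segment)
        then have "(\<lambda>i. a (i + Suc j) v * z n ^ (i + Suc j) / z n ^ j) sums ((f (z n, v) - (\<Sum>i<Suc j. a i v * z n ^ i)) / z n ^ j)"
          by (rule sums_divide)
        moreover have "(f (z n, v) - (\<Sum>i<Suc j. a i v * z n ^ i)) / z n ^ j =
            (f (z n, v) - (\<Sum>i<j. a i v * z n ^ i)) / z n ^ j - a j v" using z0 by (simp add: field_simps)
        moreover have "a (i + Suc j) v * z n ^ (i + Suc j) / z n ^ j = a (i + Suc j) v * z n ^ Suc i" for i
          using z0 by (simp add: power_add field_simps)
        ultimately have s: "(\<lambda>i. a (i + Suc j) v * z n ^ Suc i) sums ((f (z n, v) - (\<Sum>i<j. a i v * z n ^ i)) / z n ^ j - a j v)"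
          by simp
        have le: "norm (a (i + Suc j) v * z n ^ Suc i) \<le> (B / r ^ Suc j * norm (z n)) * (1/2) ^ i" for i
        proof -
          have "norm (a (i + Suc j) v * z n ^ Suc i) \<le> B / r ^ (i + Suc j) * norm (z n) ^ Suc i"
            unfolding norm_mult norm_power by (intro mult_right_mono ab v) auto
          also have "\<dots> = (B / r ^ Suc j * norm (z n)) * (norm (z n) / r) ^ i"
            using r by (simp add: power_add power_divide field_simps)
          also have "\<dots> \<le> (B / r ^ Suc j * norm (z n)) * (1/2) ^ i"
            using n r B by (intro mult_left_mono power_mono) (auto simp: field_simps)
          finally show ?thesis .
        qed
        have g: "(\<lambda>i. (B / r ^ Suc j * norm (z n)) * (1/2) ^ i) sums ((B / r ^ Suc j * norm (z n)) * 2)"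
          using sums_mult[OF geometric_sums[of "1/2::real"], of "B / r ^ Suc j * norm (z n)"] by simp
        have "norm ((f (z n, v) - (\<Sum>i<j. a i v * z n ^ i)) / z n ^ j - a j v) \<le> (B / r ^ Suc j * norm (z n)) * 2"
          using norm_suminf_le[OF le sums_summable[OF g]] unfolding sums_unique[OF s, symmetric] sums_unique[OF g, symmetric] .
        also have "\<dots> = M * norm (z n)" by (simp add: M_def)
        also have "\<dots> < e" using n M by (auto simp: field_simps)
        finally show "dist ((f (z n, v) - (\<Sum>i<j. a i v * z n ^ i)) / z n ^ j) (a j v) < e"
          by (simp add: dist_norm)
      qed
    qed
    moreover have "cball w d \<subseteq> ball 0 R" using d(2) r by force
    ultimately show "\<exists>d>0. cball w d \<subseteq> ball 0 R \<and> uniform_limit (cball w d) (\<lambda>n w. (f (z n, w) - (\<Sum>i<j. a i w * z n ^ i)) / z n ^ j) (\<lambda>w. a j w) sequentially"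
      using d(1) by auto
  qed
qed

lemma summable_geometric2:
  fixes x y :: real
  assumes "0 \<le> x" "x < 1" "0 \<le> y" "y < 1"
  shows "(\<lambda>(j::nat,k::nat). x ^ j * y ^ k) summable_on UNIV"
proof -
  have 1: "(\<lambda>j. x ^ j) summable_on UNIV" "(\<lambda>j. y ^ j) summable_on UNIV"
    using assms by (auto intro!: norm_summable_imp_summable_on)
  have "(\<lambda>(j::nat,k::nat). x ^ j * y ^ k) summable_on (UNIV \<times> UNIV)"
    by (rule summable_on_SigmaI[where g="\<lambda>j. x ^ j * infsum (\<lambda>j. y ^ j) UNIV"])
       (use 1 assms in \<open>auto intro!: has_sum_cmult_right summable_on_cmult_left has_sum_infsum\<close>)
  then show ?thesis by simp
qed

text \<open>Expansion in z, then of each coefficient in w; Cauchy's inequality used twice gives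
  absolute summability, which turns the iterated sum into a double sum. The third conclusion keeps
  the link with the z-derivatives, from which the normalization conditions are read off
  later.\<close>

lemma hol2_power_series:
  assumes f: "hol2 f (bidisc R)" and r: "0 < r" "r < R"
  obtains c B where "B > 0" "\<And>j k. norm (c j k) \<le> B / r ^ (j + k)"
    "\<And>j w. norm w < r \<Longrightarrow> (\<lambda>k. c j k * w ^ k) sums ((deriv ^^ j) (\<lambda>z. f (z, w)) 0 / fact j)"
    "\<And>z w. norm z < r \<Longrightarrow> norm w < r \<Longrightarrow> ((\<lambda>(j,k). c j k * z ^ j * w ^ k) has_sum f (z, w)) UNIV"
proof -
  define a where "a = (\<lambda>i w. (deriv ^^ i) (\<lambda>z. f (z, w)) 0 / fact i)"
  define c where "c = (\<lambda>j k. (deriv ^^ k) (a j) 0 / fact k)"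
  obtain B where B: "B > 0" "\<And>z w. norm z \<le> r \<Longrightarrow> norm w \<le> r \<Longrightarrow> norm (f (z, w)) \<le> B"
    using hol2_bounded_on_smaller[OF f r(2)] by metis
  have ah: "a j holomorphic_on ball 0 R" for j
    using Taylor_coeff_holomorphic[OF f, of j] by (simp add: a_def)
  have ab: "norm (a i v) \<le> B / r ^ i" if "norm v \<le> r" for i v
    unfolding a_def
    by (rule Taylor_coeff_bound[where R=R], rule hol2_slices(1)[OF f]) (use r that B in auto)
  have cb: "norm (c j k) \<le> B / r ^ (j + k)" for j k
  proof -
    have "norm (c j k) \<le> (B / r ^ j) / r ^ k"
      unfolding c_def by (rule Taylor_coeff_bound[OF ah r]) (rule ab)
    then show ?thesis by (simp add: power_add)
  qed
  have s1: "(\<lambda>k. c j k * w ^ k) sums a j w" if "norm w < r" for j w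
    using holomorphic_power_series[OF ah, of w j] that r by (simp add: c_def)
  have s2: "(\<lambda>j. a j w * z ^ j) sums f (z, w)" if "norm w < r" "norm z < r" for z w
    using holomorphic_power_series[OF hol2_slices(1)[OF f], of w z] that r by (simp add: a_def)
  have "((\<lambda>(j,k). c j k * z ^ j * w ^ k) has_sum f (z, w)) UNIV" if "norm z < r" "norm w < r" for z w
  proof -
    have sm: "(\<lambda>(j,k). c j k * z ^ j * w ^ k) summable_on UNIV"
    proof (rule abs_summable_summable, rule Infinite_Sum.abs_summable_on_comparison_test')
      show "(\<lambda>p. B * (case p of (j,k) \<Rightarrow> (norm z / r) ^ j * (norm w / r) ^ k)) summable_on UNIV"
        by (intro summable_on_cmult_right summable_geometric2) (use that r in auto)
      show "norm (case p of (j, k) \<Rightarrow> c j k * z ^ j * w ^ k) \<le> B * (case p of (j,k) \<Rightarrow> (norm z / r) ^ j * (norm w / r) ^ k)" for p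
      proof -
        obtain j k where p: "p = (j, k)" by force
        have "norm (c j k * z ^ j * w ^ k) \<le> B / r ^ (j + k) * norm z ^ j * norm w ^ k"
          unfolding norm_mult norm_power by (intro mult_right_mono cb) auto
        then show ?thesis by (simp add: p power_add power_divide field_simps)
      qed
    qed
    have inner: "((\<lambda>k. c j k * z ^ j * w ^ k) has_sum (a j w * z ^ j)) UNIV" for j
    proof -
      have "(\<lambda>k. c j k * z ^ j * w ^ k) summable_on UNIV"
        using summable_on_SigmaD1[of "\<lambda>j k. c j k * z ^ j * w ^ k" UNIV "\<lambda>_. UNIV" j] sm by simp
      then have "((\<lambda>k. c j k * z ^ j * w ^ k) has_sum infsum (\<lambda>k. c j k * z ^ j * w ^ k) UNIV) UNIV" by simp
      moreover have "(\<lambda>k. c j k * z ^ j * w ^ k) sums (a j w * z ^ j)"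
        using sums_mult2[OF s1[OF that(2), of j], of "z ^ j"] by (simp add: mult_ac)
      ultimately show ?thesis using has_sum_imp_sums sums_unique2 by metis
    qed
    obtain S where S: "((\<lambda>(j,k). c j k * z ^ j * w ^ k) has_sum S) (UNIV \<times> UNIV)"
      using sm by (auto simp: summable_on_def)
    have "((\<lambda>j. a j w * z ^ j) has_sum S) UNIV"
      by (rule has_sum_SigmaD[OF S]) (use inner in auto)
    then have "(\<lambda>j. a j w * z ^ j) sums S" by (rule has_sum_imp_sums)
    then have "S = f (z, w)" using s2[OF that(2,1)] sums_unique2 by blast
    then show ?thesis using S by simp
  qed
  then show ?thesis using that[of B c] B(1) cb s1 unfolding a_def by blast
qed

subsection \<open>Weighted power series\<close>

text \<open>The part of weight m when z has weight 1 and t has weight 2. In every application t is a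
  function of (z, w) vanishing to second order, so that on a line \<open>(x * Z, x * W)\<close> this
  part is divisible by \<open>x ^ m\<close>.\<close>

definition wpoly :: "(nat \<Rightarrow> nat \<Rightarrow> complex) \<Rightarrow> nat \<Rightarrow> complex \<Rightarrow> complex \<Rightarrow> complex" where
  "wpoly C m z t = (\<Sum>k\<le>m div 2. C (m - 2 * k) k * z ^ (m - 2 * k) * t ^ k)"

definition wsum :: "(nat \<Rightarrow> nat \<Rightarrow> complex) \<Rightarrow> complex \<Rightarrow> complex \<Rightarrow> complex" where
  "wsum C z t = (\<Sum>m. wpoly C m z t)"

definition geo_bound :: "(nat \<Rightarrow> nat \<Rightarrow> complex) \<Rightarrow> real \<Rightarrow> real \<Rightarrow> bool" where
  "geo_bound C B K \<longleftrightarrow> B > 0 \<and> K > 0 \<and> (\<forall>j k. norm (C j k) \<le> B * K ^ (j + 2 * k))"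

lemma wpoly_scale: "wpoly C m (x * z) (x\<^sup>2 * t) = x ^ m * wpoly C m z t"
  unfolding wpoly_def sum_distrib_left
proof (rule sum.cong)
  fix k assume "k \<in> {..m div 2}"
  then have "x ^ m = x ^ (m - 2 * k) * (x\<^sup>2) ^ k"
    by (simp flip: power_add power_mult)
  then show "C (m - 2 * k) k * (x * z) ^ (m - 2 * k) * (x\<^sup>2 * t) ^ k = x ^ m * (C (m - 2 * k) k * z ^ (m - 2 * k) * t ^ k)"
    by (simp add: power_mult_distrib)
qed simp

lemma wpoly_bound:
  assumes "geo_bound C B K" "norm z * K \<le> q" "norm t * K\<^sup>2 \<le> q\<^sup>2"
  shows "norm (wpoly C m z t) \<le> B * (m + 1) * q ^ m"
proof -
  have K: "K > 0" "B > 0" using assms by (auto simp: geo_bound_def)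
  have q: "q \<ge> 0" using assms(2) K by (smt (verit) mult_nonneg_nonneg norm_ge_zero)
  have "norm (C (m - 2 * k) k * z ^ (m - 2 * k) * t ^ k) \<le> B * q ^ m" if "k \<le> m div 2" for k
  proof -
    have m: "m = (m - 2 * k) + 2 * k" using that by auto
    have "norm (C (m - 2 * k) k * z ^ (m - 2 * k) * t ^ k) \<le> (B * K ^ m) * norm z ^ (m - 2 * k) * norm t ^ k"
      unfolding norm_mult norm_power using assms(1) m unfolding geo_bound_def
      by (intro mult_right_mono) (metis, auto)
    also have "K ^ m = K ^ (m - 2 * k) * (K\<^sup>2) ^ k" by (subst m) (simp only: power_add power_mult)
    also have "B * (K ^ (m - 2 * k) * (K\<^sup>2) ^ k) * norm z ^ (m - 2 * k) * norm t ^ k = B * ((norm z * K) ^ (m - 2 * k) * (norm t * K\<^sup>2) ^ k)"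
      by (simp add: power_mult_distrib)
    also have "\<dots> \<le> B * (q ^ (m - 2 * k) * (q\<^sup>2) ^ k)"
      using K q assms by (intro mult_left_mono mult_mono power_mono) auto
    also have "q ^ (m - 2 * k) * (q\<^sup>2) ^ k = q ^ m" by (subst (2) m) (simp only: power_add power_mult)
    finally show ?thesis .
  qed
  then have "norm (wpoly C m z t) \<le> (\<Sum>k\<le>m div 2. B * q ^ m)"
    unfolding wpoly_def by (intro sum_norm_le) auto
  also have "\<dots> = real (Suc (m div 2)) * (B * q ^ m)" by simp
  also have "\<dots> \<le> real (m + 1) * (B * q ^ m)"
    using K q by (intro mult_right_mono) auto
  finally show ?thesis by (simp add: mult_ac)
qed

lemma summable_linear_geometric: "0 \<le> q \<Longrightarrow> q < 1 \<Longrightarrow> summable (\<lambda>m. B * real (m + 1) * q ^ m)"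
proof -
  assume "0 \<le> q" "q < 1"
  then have "summable (\<lambda>m. diffs (\<lambda>_. 1) m * q ^ m)"
    by (intro termdiff_converges[where K = 1] summable_geometric) auto
  from summable_mult[OF this, of B] show ?thesis by (simp add: diffs_def mult_ac)
qed

lemma holomorphic_series_Mtest:
  assumes S: "open S" and f: "\<And>m. f m holomorphic_on S"
    and b: "\<And>m x. x \<in> S \<Longrightarrow> norm (f m x) \<le> b m" "summable b"
  shows "(\<lambda>x. \<Sum>m. f m x) holomorphic_on S"
proof (rule holomorphic_uniform_sequence[OF S, where f="\<lambda>n x. \<Sum>m<n. f m x"])
  show "(\<lambda>x. \<Sum>m<n. f m x) holomorphic_on S" for n by (intro holomorphic_intros f)
  fix x assume "x \<in> S"
  then obtain d where d: "d > 0" "cball x d \<subseteq> S" using S open_contains_cball by blast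
  then show "\<exists>d>0. cball x d \<subseteq> S \<and> uniform_limit (cball x d) (\<lambda>n x. \<Sum>m<n. f m x) (\<lambda>x. \<Sum>m. f m x) sequentially"
    by (intro exI[of _ d] conjI Weierstrass_m_test[OF _ b(2)]) (use b(1) in auto)
qed

lemma wsum_holomorphic:
  assumes C: "geo_bound C B K" and S: "open S" "g holomorphic_on S" "h holomorphic_on S"
    and b: "\<And>x. x \<in> S \<Longrightarrow> norm (g x) * K \<le> q" "\<And>x. x \<in> S \<Longrightarrow> norm (h x) * K\<^sup>2 \<le> q\<^sup>2" and q: "0 \<le> q" "q < 1"
  shows "(\<lambda>x. wsum C (g x) (h x)) holomorphic_on S"
  unfolding wsum_def
  by (rule holomorphic_series_Mtest[OF S(1) _ wpoly_bound[OF C] summable_linear_geometric[OF q, of B]])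
     (use S b in \<open>auto simp: wpoly_def intro!: holomorphic_intros\<close>)

text \<open>The terms of index above n carry the factor \<open>x ^ Suc n\<close>, and the rest
  \<open>T (Suc n)\<close> is again holomorphic at 0, so coefficient n is that of a finite partial
  sum.\<close>

lemma graded_series_fps:
  assumes r: "r > 0" and L: "L > 0" "r * L \<le> 1/2"
    and g: "\<And>m. g m holomorphic_on ball 0 r" "\<And>m x. x \<in> ball 0 r \<Longrightarrow> norm (g m x) \<le> D * L ^ m"
    and G: "\<And>m. g m has_fps_expansion G m"
  shows "(\<lambda>x. \<Sum>m. x ^ m * g m x) has_fps_expansion Abs_fps (\<lambda>n. \<Sum>m\<le>n. fps_nth (G m) (n - m))"
proof -
  have b: "norm (x ^ m * g (m + n) x) \<le> D * L ^ n * (1/2) ^ m" if "x \<in> ball 0 r" for x m n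
  proof -
    have D: "D \<ge> 0" using g(2)[OF that, of 0] by (simp add: order_trans[OF norm_ge_zero])
    have "norm (x ^ m * g (m + n) x) \<le> r ^ m * (D * L ^ (m + n))"
      unfolding norm_mult norm_power using that g(2)[OF that, of "m + n"] r
      by (intro mult_mono power_mono) auto
    also have "\<dots> = D * L ^ n * (r * L) ^ m" by (simp add: power_add power_mult_distrib)
    also have "\<dots> \<le> D * L ^ n * (1/2) ^ m"
      using D L r by (intro mult_left_mono power_mono) auto
    finally show ?thesis .
  qed
  have sm: "summable (\<lambda>m. D * L ^ n * (1/2::real) ^ m)" for n by (intro summable_mult summable_geometric) auto
  define T where "T = (\<lambda>n x. \<Sum>m. x ^ m * g (m + n) x)"
  have Th: "T n holomorphic_on ball 0 r" for n
    unfolding T_def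
    by (rule holomorphic_series_Mtest[OF open_ball _ b sm]) (auto intro!: holomorphic_intros g)
  then have Tf: "T n has_fps_expansion fps_expansion (T n) 0" for n
    by (rule has_fps_expansion_fps_expansion[rotated 2]) (use r in auto)
  have "fps_nth (fps_expansion (T 0) 0) n = (\<Sum>m\<le>n. fps_nth (G m) (n - m))" for n
  proof -
    have eq: "T 0 x = (\<Sum>m\<le>n. x ^ m * g m x) + x ^ Suc n * T (Suc n) x" if x: "x \<in> ball 0 r" for x
    proof -
      have "summable (\<lambda>m. x ^ m * g (m + k) x)" for k
        by (rule summable_comparison_test'[OF sm b[OF x]])
      from suminf_split_initial_segment[OF this[of 0], of "Suc n"] suminf_mult[OF this[of "Suc n"], of "x ^ Suc n"]
      show ?thesis unfolding T_def by (simp add: lessThan_Suc_atMost power_add mult_ac add_ac)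
    qed
    have "(\<lambda>x. (\<Sum>m\<le>n. x ^ m * g m x) + x ^ Suc n * T (Suc n) x) has_fps_expansion
        (\<Sum>m\<le>n. fps_X ^ m * G m) + fps_X ^ Suc n * fps_expansion (T (Suc n)) 0"
      by (intro fps_expansion_intros G Tf)
    moreover have "\<forall>\<^sub>F x in nhds 0. T 0 x = (\<Sum>m\<le>n. x ^ m * g m x) + x ^ Suc n * T (Suc n) x"
      by (rule eventually_mono[OF eventually_nhds_in_open[of "ball 0 r" 0]]) (use r eq in auto)
    ultimately have "T 0 has_fps_expansion (\<Sum>m\<le>n. fps_X ^ m * G m) + fps_X ^ Suc n * fps_expansion (T (Suc n)) 0"
      by (subst has_fps_expansion_cong[OF _ refl])
    then have "fps_expansion (T 0) 0 = (\<Sum>m\<le>n. fps_X ^ m * G m) + fps_X ^ Suc n * fps_expansion (T (Suc n)) 0"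
      using Tf[of 0] fps_expansion_unique_complex by blast
    then show ?thesis
      by (simp add: fps_sum_nth fps_X_power_mult_nth del: power_Suc)
  qed
  then have "fps_expansion (T 0) 0 = Abs_fps (\<lambda>n. \<Sum>m\<le>n. fps_nth (G m) (n - m))" by (intro fps_ext) simp
  then show ?thesis using Tf[of 0] by (simp add: T_def)
qed

text \<open>The formal counterpart, as a series in x, of \<open>wsum C (x * Z) (x^2 * h x)\<close>
  with \<open>H\<close> the expansion of \<open>h\<close>: the part of weight m contributes
  \<open>x ^ m\<close>, which leaves the coefficient of index \<open>n - m\<close> of the powers of
  \<open>H\<close>.\<close>

definition wfps :: "(nat \<Rightarrow> nat \<Rightarrow> complex) \<Rightarrow> complex \<Rightarrow> complex fps \<Rightarrow> complex fps" where
  "wfps C Z H = Abs_fps (\<lambda>n. \<Sum>m\<le>n. \<Sum>k\<le>m div 2. C (m - 2 * k) k * Z ^ (m - 2 * k) * fps_nth (H ^ k) (n - m))"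

lemma wsum_fps:
  assumes C: "geo_bound C B K" and h: "h has_fps_expansion H"
  shows "(\<lambda>x. wsum C (x * Z) (x\<^sup>2 * h x)) has_fps_expansion wfps C Z H"
proof -
  have KB: "K > 0" "B > 0" using C by (auto simp: geo_bound_def)
  obtain s where s: "open s" "0 \<in> s" "h holomorphic_on s" using has_fps_expansion_imp_holomorphic[OF h] by metis
  then obtain r1 where r1: "r1 > 0" "cball 0 r1 \<subseteq> s" using open_contains_cball by blast
  have "compact (h ` cball 0 r1)"
    by (intro compact_continuous_image compact_cball)
       (rule continuous_on_subset[OF holomorphic_on_imp_continuous_on[OF s(3)] r1(2)])
  then have "bounded (h ` cball 0 r1)" by (rule compact_imp_bounded)
  then obtain M where M: "M > 0" "\<And>x. x \<in> cball 0 r1 \<Longrightarrow> norm (h x) \<le> M"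
    unfolding bounded_pos by blast
  define q where "q = max (norm Z * K) (sqrt (M * K\<^sup>2)) + 1"
  have q: "norm Z * K \<le> q" "M * K\<^sup>2 \<le> q\<^sup>2" "q > 0"
  proof -
    have *: "0 \<le> norm Z * K" "0 \<le> sqrt (M * K\<^sup>2)" using KB M by auto
    then show "norm Z * K \<le> q" "q > 0" by (auto simp: q_def)
    have "sqrt (M * K\<^sup>2) \<le> q" using * by (auto simp: q_def)
    then show "M * K\<^sup>2 \<le> q\<^sup>2" by (rule sqrt_le_D)
  qed
  \<comment> \<open>The factor 2 absorbs \<open>m + 1 <= 2 ^ m\<close> from
    \<open>wpoly_bound\<close>.\<close>
  define L where "L = 2 * q"
  define r where "r = min r1 (1 / (2 * L))"
  have r: "r > 0" "L > 0" "r * L \<le> 1/2" "ball 0 r \<subseteq> cball 0 r1"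
  proof -
    show "L > 0" using q by (simp add: L_def)
    then show "r > 0" using r1 by (simp add: r_def)
    have "r * L \<le> 1 / (2 * L) * L" using \<open>L > 0\<close> by (intro mult_right_mono) (auto simp: r_def)
    then show "r * L \<le> 1/2" using \<open>L > 0\<close> by simp
    show "ball 0 r \<subseteq> cball 0 r1" by (auto simp: r_def)
  qed
  have bd: "norm (wpoly C m Z (h x)) \<le> B * L ^ m" if "x \<in> ball 0 r" for m x
  proof -
    have "norm (h x) * K\<^sup>2 \<le> q\<^sup>2"
      by (rule order_trans[OF mult_right_mono[OF M(2)] q(2)]) (use that r(4) in \<open>blast, simp\<close>)
    from wpoly_bound[OF C q(1) this] have "norm (wpoly C m Z (h x)) \<le> B * (m + 1) * q ^ m" .
    also have "\<dots> \<le> B * 2 ^ m * q ^ m"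
    proof -
      have "real (m + 1) \<le> 2 ^ m"
        using of_nat_mono[OF Suc_leI[OF less_exp[of m]], where 'a=real] by simp
      then show ?thesis using KB q by (intro mult_left_mono mult_right_mono) auto
    qed
    finally show ?thesis by (simp add: L_def power_mult_distrib)
  qed
  have "(\<lambda>x. \<Sum>m. x ^ m * wpoly C m Z (h x)) has_fps_expansion
     Abs_fps (\<lambda>n. \<Sum>m\<le>n. fps_nth (\<Sum>k\<le>m div 2. fps_const (C (m - 2 * k) k * Z ^ (m - 2 * k)) * H ^ k) (n - m))"
  proof (rule graded_series_fps[OF r(1-3) _ bd])
    show "(\<lambda>x. wpoly C m Z (h x)) holomorphic_on ball 0 r" for m
      unfolding wpoly_def
      by (intro holomorphic_intros holomorphic_on_subset[OF s(3)]) (use r(4) r1(2) in auto)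
    show "(\<lambda>x. wpoly C m Z (h x)) has_fps_expansion (\<Sum>k\<le>m div 2. fps_const (C (m - 2 * k) k * Z ^ (m - 2 * k)) * H ^ k)" for m
      unfolding wpoly_def by (intro fps_expansion_intros h)
  qed
  then show ?thesis
    by (simp add: wsum_def wpoly_scale wfps_def fps_sum_nth)
qed

lemma has_sum_imp_wsum:
  assumes "((\<lambda>(j,k). c j k * z ^ j * w ^ k) has_sum S) UNIV"
  shows "wsum c z w = S"
proof -
  define f where "f = (\<lambda>(m::nat,k::nat). (m - 2 * k, k))"
  have bij: "bij_betw f (Sigma UNIV (\<lambda>m. {..m div 2})) UNIV"
    by (rule bij_betwI[where g="\<lambda>(j,k). (j + 2 * k, k)"]) (auto simp: f_def)
  have "((\<lambda>p. (\<lambda>(j,k). c j k * z ^ j * w ^ k) (f p)) has_sum S) (Sigma UNIV (\<lambda>m. {..m div 2}))"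
    using has_sum_reindex_bij_betw[OF bij] assms by blast
  then have "((\<lambda>(m,k). c (m - 2 * k) k * z ^ (m - 2 * k) * w ^ k) has_sum S) (Sigma UNIV (\<lambda>m. {..m div 2}))"
    by (simp add: f_def case_prod_unfold)
  then have "((\<lambda>m. wpoly c m z w) has_sum S) UNIV"
    by (rule has_sum_SigmaD) (auto simp: wpoly_def has_sum_finite_iff)
  then have "(\<lambda>m. wpoly c m z w) sums S" by (rule has_sum_imp_sums)
  then show ?thesis unfolding wsum_def by (rule sums_unique[symmetric])
qed

subsection \<open>Polynomial dependence on a parameter\<close>

definition pdeg :: "nat \<Rightarrow> (real \<Rightarrow> complex) \<Rightarrow> bool" where
  "pdeg n f \<longleftrightarrow> (\<exists>p. degree p \<le> n \<and> (\<forall>s. f s = poly p (of_real s)))"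

lemma pdeg_const [intro]: "pdeg n (\<lambda>s. c)"
  unfolding pdeg_def by (intro exI[of _ "[:c:]"]) auto

lemma pdeg_of_real [intro]: "n \<ge> 1 \<Longrightarrow> pdeg n of_real"
  unfolding pdeg_def by (intro exI[of _ "[:0, 1:]"]) auto

lemma pdeg_mono: "pdeg m f \<Longrightarrow> m \<le> n \<Longrightarrow> pdeg n f"
  unfolding pdeg_def by (meson order_trans)

lemma pdeg_add [intro]: assumes "pdeg n f" "pdeg n g" shows "pdeg n (\<lambda>s. f s + g s)"
proof -
  obtain p q where "degree p \<le> n" "degree q \<le> n" "\<forall>s. f s = poly p (of_real s)" "\<forall>s. g s = poly q (of_real s)"
    using assms unfolding pdeg_def by blast
  then show ?thesis unfolding pdeg_def by (intro exI[of _ "p + q"]) (auto intro: degree_add_le)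
qed

lemma pdeg_mult: assumes "pdeg n f" "pdeg m g" shows "pdeg (n + m) (\<lambda>s. f s * g s)"
proof -
  obtain p q where "degree p \<le> n" "degree q \<le> m" "\<forall>s. f s = poly p (of_real s)" "\<forall>s. g s = poly q (of_real s)"
    using assms unfolding pdeg_def by blast
  then show ?thesis unfolding pdeg_def
    by (intro exI[of _ "p * q"]) (auto intro: order_trans[OF degree_mult_le] add_mono)
qed

lemma pdeg_cmult [intro]: "pdeg n f \<Longrightarrow> pdeg n (\<lambda>s. c * f s)"
  using pdeg_mult[OF pdeg_const[of 0 c], of n f] by simp

lemma pdeg_cmult_right [intro]: "pdeg n f \<Longrightarrow> pdeg n (\<lambda>s. f s * c)"
  using pdeg_cmult[of n f c] by (simp add: mult.commute)

lemma pdeg_diff [intro]: "pdeg n f \<Longrightarrow> pdeg n g \<Longrightarrow> pdeg n (\<lambda>s. f s - g s)"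
  using pdeg_add[OF _ pdeg_cmult[of n g "-1"], of f] by simp

lemma pdeg_sum [intro]: "(\<And>i. i \<in> I \<Longrightarrow> pdeg n (f i)) \<Longrightarrow> pdeg n (\<lambda>s. \<Sum>i\<in>I. f i s)"
  by (induction I rule: infinite_finite_induct) auto

lemma pdeg_continuous_on: "pdeg n f \<Longrightarrow> continuous_on S f"
proof -
  assume "pdeg n f"
  then obtain p where "\<forall>s. f s = poly p (of_real s)" unfolding pdeg_def by blast
  then have "f = (\<lambda>s. poly p (of_real s))" by blast
  then show ?thesis by (auto intro!: continuous_intros)
qed

section \<open>Lagrange interpolation and bounds for polynomials known on an interval\<close>

definition lagr :: "(nat \<Rightarrow> complex) \<Rightarrow> nat \<Rightarrow> nat \<Rightarrow> complex poly" where
  "lagr x n i = (\<Prod>m\<in>{..n} - {i}. smult (inverse (x i - x m)) [:- x m, 1:])"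

lemma lagr_degree: "i \<le> n \<Longrightarrow> degree (lagr x n i) \<le> n"
proof -
  assume "i \<le> n"
  have "degree (lagr x n i) \<le> (\<Sum>m\<in>{..n} - {i}. 1)"
    unfolding lagr_def by (rule order_trans[OF degree_prod_sum_le]) (simp, unfold o_def, intro sum_mono order_trans[OF degree_smult_le], simp)
  also have "\<dots> = n" using \<open>i \<le> n\<close> by (simp add: card_Diff_singleton)
  finally show ?thesis .
qed

lemma lagr_interpolation:
  assumes x: "inj_on x {..n}" and p: "degree p \<le> n"
  shows "p = (\<Sum>i\<le>n. smult (poly p (x i)) (lagr x n i))"
proof -
  define q where "q = p - (\<Sum>i\<le>n. smult (poly p (x i)) (lagr x n i))"
  have v: "poly (lagr x n i) (x m) = (if i = m then 1 else 0)" if "i \<le> n" "m \<le> n" for i m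
  proof (cases "i = m")
    case True
    have "poly (lagr x n i) (x m) = (\<Prod>j\<in>{..n} - {i}. 1)"
      unfolding lagr_def poly_prod
    proof (rule prod.cong)
      fix j assume "j \<in> {..n} - {i}"
      then have "x i - x j \<noteq> 0" using that x by (auto simp: inj_on_def)
      then have "inverse (x i - x j) * (x i - x j) = 1" by (rule left_inverse)
      then show "poly (smult (inverse (x i - x j)) [:- x j, 1:]) (x m) = 1"
        using True by (simp del: smult_pCons left_inverse)
    qed simp
    then show ?thesis using True by simp
  next
    case False
    then have "m \<in> {..n} - {i}" using that by auto
    then show ?thesis using False unfolding lagr_def poly_prod by (auto intro!: prod_zero bexI[of _ m])
  qed
  have z: "poly q (x m) = 0" if "m \<le> n" for m
  proof -
    have "(\<Sum>i\<le>n. poly p (x i) * poly (lagr x n i) (x m)) = (\<Sum>i\<le>n. if i = m then poly p (x m) else 0)"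
      by (rule sum.cong) (use v that in auto)
    then show ?thesis using that by (simp add: q_def poly_sum)
  qed
  have "degree q \<le> n" unfolding q_def
    by (intro degree_diff_le p degree_sum_le) (auto intro: order_trans[OF degree_smult_le] lagr_degree)
  moreover have "card (x ` {..n}) \<le> card {z. poly q z = 0}" if "q \<noteq> 0"
    by (rule card_mono) (use that z poly_roots_finite in auto)
  moreover have "card (x ` {..n}) = Suc n" using x by (simp add: card_image)
  ultimately have "q = 0"
    using card_poly_roots_bound[of q] by (metis (no_types) Suc_n_not_le_n order_trans)
  then show ?thesis by (simp add: q_def)
qed

text \<open>Polynomial dependence becomes a linear identity between the values at s and at
  \<open>n + 1\<close> integers. Such an identity can be pulled back through an injective linear
  operator, which is how the degrees of the normalizing coefficients are obtained.\<close>

lemma pdeg_iff_lagr: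
  "pdeg n f \<longleftrightarrow> (\<forall>s. f s = (\<Sum>i\<le>n. poly (lagr of_nat n i) (of_real s) * f (real i)))"
proof
  assume "pdeg n f"
  then obtain p where p: "degree p \<le> n" "\<forall>s. f s = poly p (of_real s)" unfolding pdeg_def by blast
  have "inj_on (of_nat :: nat \<Rightarrow> complex) {..n}" by (simp add: inj_on_def)
  note L = lagr_interpolation[OF this p(1)]
  have "poly p z = (\<Sum>i\<le>n. poly (lagr of_nat n i) z * poly p (of_nat i))" for z
    using arg_cong[OF L, of "\<lambda>p. poly p z"] by (simp only: poly_sum poly_smult mult.commute)
  from this[of "of_real _"] show "\<forall>s. f s = (\<Sum>i\<le>n. poly (lagr of_nat n i) (of_real s) * f (real i))"
    unfolding p(2)[rule_format] of_real_of_nat_eq by blast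
next
  assume *: "\<forall>s. f s = (\<Sum>i\<le>n. poly (lagr of_nat n i) (of_real s) * f (real i))"
  have "pdeg n (\<lambda>s. (\<Sum>i\<le>n. poly (lagr of_nat n i) (of_real s) * f (real i)))"
    by (intro pdeg_sum pdeg_cmult_right) (auto simp: pdeg_def intro: lagr_degree)
  moreover have "(\<lambda>s. \<Sum>i\<le>n. poly (lagr of_nat n i) (of_real s) * f (real i)) = f"
    by (rule ext) (rule *[rule_format, symmetric])
  ultimately show "pdeg n f" by (simp only:)
qed

text \<open>Multiplication by a linear factor \<open>c (X - a)\<close> enlarges the greatest
  coefficient at most by \<open>norm c * (1 + norm a)\<close>.\<close>

lemma norm_coeff_prod_linear_le:
  fixes a c :: "nat \<Rightarrow> complex"
  shows "norm (coeff (\<Prod>m\<in>A. smult (c m) [:- a m, 1:]) k) \<le> (\<Prod>m\<in>A. norm (c m) * (1 + norm (a m)))"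
proof (induction A arbitrary: k rule: infinite_finite_induct)
  case (insert y A)
  define P where "P = (\<Prod>m\<in>A. smult (c m) [:- a m, 1:])"
  define b where "b = (\<Prod>m\<in>A. norm (c m) * (1 + norm (a m)))"
  have P: "norm (coeff P j) \<le> b" for j using insert.IH by (simp add: P_def b_def)
  have "coeff (\<Prod>m\<in>insert y A. smult (c m) [:- a m, 1:]) k = c y * (- a y * coeff P k + coeff (pCons 0 P) k)"
  proof -
    have "(\<Prod>m\<in>insert y A. smult (c m) [:- a m, 1:]) = smult (c y) [:- a y, 1:] * P"
      using insert.hyps by (simp add: P_def del: smult_pCons)
    also have "\<dots> = smult (c y) (smult (- a y) P + pCons 0 P)"
      by (simp only: mult_smult_left mult_pCons_left smult_1_left mult_zero_left pCons_0_0 add_0_right)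
    finally show ?thesis by (simp only: coeff_smult coeff_add)
  qed
  also have "norm \<dots> \<le> norm (c y) * (norm (a y) * b + b)"
  proof -
    have "norm (coeff (pCons 0 P) k) \<le> b"
      using P P[of 0] by (cases k) (auto intro: order_trans[OF norm_ge_zero])
    then show ?thesis unfolding norm_mult
      by (intro mult_left_mono norm_triangle_le add_mono) (auto simp: norm_mult intro!: mult_left_mono P)
  qed
  finally show ?case using insert.hyps by (simp add: b_def algebra_simps)
qed (auto simp: coeff_1)

lemma prod_abs_diff:
  "i \<le> n \<Longrightarrow> (\<Prod>m\<in>{..n} - {i}. \<bar>real i - real m\<bar>) = fact i * fact (n - i)"
proof (induction n rule: dec_induct)
  case base
  have "(\<Prod>m\<in>{..i} - {i}. \<bar>real i - real m\<bar>) = (\<Prod>m<i. real (i - m))"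
    by (rule prod.cong) auto
  also have "\<dots> = real (\<Prod>m<i. i - m)" by simp
  also have "(\<Prod>m<i. i - m) = fact i"
    by (metis atLeast0LessThan fact_prod_rev of_nat_id)
  finally show ?case by simp
next
  case (step n)
  have "{..Suc n} - {i} = insert (Suc n) ({..n} - {i})" using step by auto
  then show ?case using step by (simp add: Suc_diff_le algebra_simps)
qed

text \<open>A single term of the exponential series of n is at most \<open>exp n\<close>, and
  \<open>exp 1 <= 3\<close>.\<close>

lemma power_le_fact: "real n ^ n \<le> 3 ^ n * fact n"
proof -
  have s: "summable (\<lambda>k. real n ^ k / fact k)" using summable_exp_generic[of "real n"] by (simp add: field_simps)
  have "(\<Sum>k\<in>{n}. real n ^ k / fact k) \<le> (\<Sum>k. real n ^ k / fact k)"
    by (rule sum_le_suminf[OF s]) auto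
  also have "\<dots> = exp (real n)" by (simp add: exp_def field_simps)
  also have "\<dots> = exp 1 ^ n" by (simp flip: exp_of_nat_mult)
  also have "\<dots> \<le> 3 ^ n" using exp_le by (intro power_mono) auto
  finally show ?thesis by (simp add: divide_simps mult.commute)
qed

text \<open>Interpolation at \<open>n + 1\<close> equidistant nodes of the interval: the products of
  node distances are at least \<open>((\<beta> - \<alpha>) / 6) ^ n\<close>, so the coefficients of
  the basis polynomials grow only geometrically. The constant is independent of n, f and B, and the
  interval may lie away from 0, as the one supplied by Baire's theorem does in general.\<close>

lemma pdeg_derivative_bound:
  fixes \<alpha> \<beta> :: real
  assumes "\<alpha> < \<beta>"
  obtains C where "C > 0" "\<And>n f B. pdeg n f \<Longrightarrow> (\<And>s. \<alpha> \<le> s \<Longrightarrow> s \<le> \<beta> \<Longrightarrow> norm (f s) \<le> B) \<Longrightarrow>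
     \<exists>D. (f has_vector_derivative D) (at 0) \<and> norm D \<le> B * C ^ n"
proof -
  define R where "R = \<bar>\<alpha>\<bar> + \<bar>\<beta>\<bar>"
  \<comment> \<open>The 6 comes from \<open>n^n <= 3^n n!\<close> and
    \<open>n! <= 2^n i! (n-i)!\<close>, the other factor 2 from \<open>n + 1 <= 2^n\<close> nodes,
    and \<open>1 + R\<close> bounds the contribution of one linear factor.\<close>
  define C where "C = 12 * (1 + R) / (\<beta> - \<alpha>)"
  have C: "C > 0" using assms by (auto simp: C_def R_def)
  have "\<exists>D. (f has_vector_derivative D) (at 0) \<and> norm D \<le> B * C ^ n"
    if f: "pdeg n f" and B: "\<And>s. \<alpha> \<le> s \<Longrightarrow> s \<le> \<beta> \<Longrightarrow> norm (f s) \<le> B" for n f B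
  proof -
    obtain p where p: "degree p \<le> n" "\<forall>s. f s = poly p (of_real s)" using f unfolding pdeg_def by blast
    have B0: "B \<ge> 0" using B[of \<alpha>] assms by (auto intro: order_trans[OF norm_ge_zero])
    have d: "(f has_vector_derivative coeff p 1) (at 0)"
    proof -
      have "((\<lambda>s. poly p (of_real s)) has_vector_derivative poly (pderiv p) (of_real 0)) (at 0)"
        by (rule has_vector_derivative_real_field) (rule poly_DERIV)
      moreover have "f = (\<lambda>s. poly p (of_real s))" using p(2) by blast
      ultimately show ?thesis by (simp add: poly_0_coeff_0 coeff_pderiv)
    qed
    have "norm (coeff p 1) \<le> B * C ^ n"
    proof (cases "n = 0")
      case True then show ?thesis using p(1) B0 by (simp add: coeff_eq_0)
    next
      case False
      define x where "x = (\<lambda>i::nat. \<alpha> + (\<beta> - \<alpha>) * real i / real n)"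
      have xr: "\<alpha> \<le> x i" "x i \<le> \<beta>" if "i \<le> n" for i
      proof -
        have "0 \<le> (\<beta> - \<alpha>) * (real i / real n)" "(\<beta> - \<alpha>) * (real i / real n) \<le> (\<beta> - \<alpha>) * 1"
          using that assms False by (intro mult_nonneg_nonneg mult_left_mono; simp)+
        then show "\<alpha> \<le> x i" "x i \<le> \<beta>" by (auto simp: x_def)
      qed
      have xa: "\<bar>x i\<bar> \<le> R" if "i \<le> n" for i using xr[OF that] by (auto simp: R_def)
      have xd: "x i - x m = (\<beta> - \<alpha>) / real n * (real i - real m)" for i m
        by (simp add: x_def algebra_simps diff_divide_distrib)
      have "inj_on (\<lambda>i. complex_of_real (x i)) {..n}" using assms False by (auto simp: inj_on_def x_def)
      note L = lagr_interpolation[OF this p(1)]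
      have "coeff p 1 = (\<Sum>i\<le>n. f (x i) * coeff (lagr (\<lambda>i. of_real (x i)) n i) 1)"
        using arg_cong[OF L, of "\<lambda>p. coeff p 1"] p(2) by (simp only: coeff_sum coeff_smult)
      also have "norm \<dots> \<le> (\<Sum>i\<le>n. B * (6 * (1 + R) / (\<beta> - \<alpha>)) ^ n)"
      proof (rule sum_norm_le)
        fix i assume "i \<in> {..n}"
        then have i: "i \<le> n" by simp
        have card: "card ({..n} - {i}) = n" using i by (simp add: card_Diff_singleton)
        have "norm (coeff (lagr (\<lambda>i. of_real (x i)) n i) 1)
            \<le> (\<Prod>m\<in>{..n} - {i}. norm (inverse (complex_of_real (x i) - of_real (x m))) * (1 + norm (complex_of_real (x m))))"
          unfolding lagr_def by (rule norm_coeff_prod_linear_le)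
        also have "\<dots> \<le> (\<Prod>m\<in>{..n} - {i}. inverse \<bar>x i - x m\<bar> * (1 + R))"
          by (intro prod_mono conjI mult_mono)
             (auto simp: norm_inverse xa simp flip: of_real_diff)
        also have "\<dots> = inverse (\<Prod>m\<in>{..n} - {i}. \<bar>x i - x m\<bar>) * (1 + R) ^ n"
          unfolding prod.distrib prod_inversef[symmetric] o_def by (simp add: card)
        also have "(\<Prod>m\<in>{..n} - {i}. \<bar>x i - x m\<bar>) = ((\<beta> - \<alpha>) / n) ^ n * (fact i * fact (n - i))"
          unfolding xd abs_mult prod.distrib prod_abs_diff[OF i] using assms by (simp add: card)
        also have "inverse \<dots> * (1 + R) ^ n \<le> inverse (((\<beta> - \<alpha>) / 6) ^ n) * (1 + R) ^ n"
        proof (intro mult_right_mono le_imp_inverse_le)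
          have "real n ^ n \<le> 3 ^ n * fact n" by (rule power_le_fact)
          also have "fact n = (fact i * fact (n - i) * real (n choose i) :: real)"
            using binomial_fact[OF i, where 'a=real] by simp
          also have "\<dots> \<le> fact i * fact (n - i) * 2 ^ n"
            by (intro mult_left_mono) (use binomial_le_pow2[of n i] of_nat_mono[of "n choose i" "2 ^ n", where 'a=real] in auto)
          finally have "real n ^ n \<le> 6 ^ n * (fact i * fact (n - i))"
            using power_mult_distrib[of "2::real" 3 n] by (simp add: mult_ac)
          then have "1 / 6 ^ n \<le> (fact i * fact (n - i)) / real n ^ n"
            using False by (simp add: field_simps)
          from mult_left_mono[OF this, of "(\<beta> - \<alpha>) ^ n"] show "((\<beta> - \<alpha>) / 6) ^ n \<le> ((\<beta> - \<alpha>) / n) ^ n * (fact i * fact (n - i))"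
            using assms by (simp add: power_divide)
        qed (use assms in \<open>auto simp: R_def\<close>)
        also have "\<dots> = (6 * (1 + R) / (\<beta> - \<alpha>)) ^ n"
        proof -
          have "inverse ((\<beta> - \<alpha>) / 6) * (1 + R) = 6 * (1 + R) / (\<beta> - \<alpha>)" by simp
          then show ?thesis by (simp only: power_inverse[symmetric] power_mult_distrib[symmetric])
        qed
        finally show "norm (f (x i) * coeff (lagr (\<lambda>i. of_real (x i)) n i) 1) \<le> B * (6 * (1 + R) / (\<beta> - \<alpha>)) ^ n"
          unfolding norm_mult using B[OF xr[OF i]] B0 by (intro mult_mono) auto
      qed
      also have "\<dots> = real (Suc n) * (B * (6 * (1 + R) / (\<beta> - \<alpha>)) ^ n)" by simp
      also have "\<dots> \<le> 2 ^ n * (B * (6 * (1 + R) / (\<beta> - \<alpha>)) ^ n)"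
      proof (rule mult_right_mono)
        show "real (Suc n) \<le> 2 ^ n"
          using of_nat_mono[OF Suc_leI[OF less_exp[of n]], where 'a=real] by simp
      qed (use B0 assms in \<open>auto simp: R_def\<close>)
      also have "\<dots> = B * C ^ n"
      proof -
        have "C = 2 * (6 * (1 + R) / (\<beta> - \<alpha>))" by (simp add: C_def)
        then show ?thesis by (simp only: power_mult_distrib mult_ac)
      qed
      finally show ?thesis .
    qed
    with d show ?thesis by blast
  qed
  with C show ?thesis using that by blast
qed

lemma Baire_real_interval:
  fixes E :: "nat \<Rightarrow> real set"
  assumes "\<And>n. closed (E n)" "\<And>s. \<exists>n. s \<in> E n"
  obtains n a b where "a < b" "{a..b} \<subseteq> E n"
proof -
  have "\<exists>n. interior (E n) \<noteq> {}"
  proof (rule ccontr)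
    assume "\<not> ?thesis"
    then have "closure (- E n) = UNIV" for n by (simp add: closure_interior)
    then have "UNIV \<subseteq> closure (\<Inter> (range (\<lambda>n. - E n)))"
      by (intro Baire) (use assms(1) in \<open>auto simp: open_closed\<close>)
    moreover have "\<Inter> (range (\<lambda>n. - E n)) = {}" using assms(2) by auto
    ultimately show False by simp
  qed
  then obtain n x where "x \<in> interior (E n)" by blast
  then obtain e where "e > 0" "cball x e \<subseteq> E n" unfolding mem_interior_cball by blast
  then show ?thesis by (intro that[of "x - e" "x + e" n]) (auto simp: cball_eq_atLeastAtMost)
qed

section \<open>Power series whose coefficients are polynomials in the parameter\<close>

definition pfam :: "nat \<Rightarrow> (real \<Rightarrow> complex fps) \<Rightarrow> bool" where
  "pfam r F \<longleftrightarrow> (\<forall>n. pdeg (n - r) (\<lambda>s. fps_nth (F s) n) \<and> (n < r \<longrightarrow> (\<forall>s. fps_nth (F s) n = 0)))"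

lemma pfam_add: "pfam r F \<Longrightarrow> pfam r G \<Longrightarrow> pfam r (\<lambda>s. F s + G s)"
  unfolding pfam_def by auto

text \<open>Orders of vanishing add, and degrees are counted from these orders. As
  \<open>n - r\<close> is truncated, the clause on vanishing below r is what makes the degrees add
  correctly.\<close>

lemma pfam_mult: assumes "pfam r F" "pfam q G" shows "pfam (r + q) (\<lambda>s. F s * G s)"
  unfolding pfam_def
proof (intro allI conjI impI)
  fix n
  have z: "fps_nth (F s) i * fps_nth (G s) (n - i) = 0" if "i < r \<or> n - i < q" for i s
    using that assms unfolding pfam_def by auto
  have "pdeg (n - (r + q)) (\<lambda>s. fps_nth (F s) i * fps_nth (G s) (n - i))" if "i \<le> n" for i
  proof (cases "i < r \<or> n - i < q")
    case True
    then have "(\<lambda>s. fps_nth (F s) i * fps_nth (G s) (n - i)) = (\<lambda>s. 0)" using z by blast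
    then show ?thesis by (simp only: pdeg_const)
  next
    case False
    have "pdeg ((i - r) + (n - i - q)) (\<lambda>s. fps_nth (F s) i * fps_nth (G s) (n - i))"
      by (rule pdeg_mult) (use assms in \<open>unfold pfam_def, blast+\<close>)
    moreover have "(i - r) + (n - i - q) = n - (r + q)" using False that by linarith
    ultimately show ?thesis by simp
  qed
  then show "pdeg (n - (r + q)) (\<lambda>s. fps_nth (F s * G s) n)"
    unfolding fps_mult_nth by (intro pdeg_sum) auto
  show "fps_nth (F s * G s) n = 0" if "n < r + q" for s
    unfolding fps_mult_nth
  proof (rule sum.neutral, rule ballI)
    fix i assume "i \<in> {0..n}"
    then have "i < r \<or> n - i < q" using that by auto
    then show "fps_nth (F s) i * fps_nth (G s) (n - i) = 0" by (rule z)
  qed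
qed

lemma pfam_power: "pfam 0 F \<Longrightarrow> pfam 0 (\<lambda>s. F s ^ k)"
proof (induction k)
  case 0 show ?case unfolding pfam_def by (auto simp: pdeg_const)
next
  case (Suc k) then show ?case using pfam_mult[of 0 F 0 "\<lambda>s. F s ^ k"] by simp
qed

lemma pfam_wfps:
  assumes "pfam 0 H" and "\<And>j k. r \<le> j + 2 * k \<Longrightarrow> pdeg (j + 2 * k - r) (\<lambda>s. C s j k)"
    and z: "\<And>j k s. j + 2 * k < r \<Longrightarrow> C s j k = 0"
  shows "pfam r (\<lambda>s. wfps (C s) Z (H s))"
proof -
  have z': "C s (m - 2 * k) k = 0" if "m < r" "k \<le> m div 2" for s m k
    using z[of "m - 2 * k" k s] that by auto
  have "pdeg (n - r) (\<lambda>s. C s (m - 2 * k) k * Z ^ (m - 2 * k) * fps_nth (H s ^ k) (n - m))" if "m \<le> n" "k \<le> m div 2" for m k n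
  proof (cases "m < r")
    case True then show ?thesis using z' that by (simp add: pdeg_const)
  next
    case False
    have "(m - 2 * k) + 2 * k = m" using that by auto
    then have "pdeg (m - r) (\<lambda>s. C s (m - 2 * k) k)" using assms(2)[of "m - 2 * k" k] False by simp
    then have "pdeg ((m - r) + (n - m)) (\<lambda>s. C s (m - 2 * k) k * Z ^ (m - 2 * k) * fps_nth (H s ^ k) (n - m))"
      using pfam_power[OF assms(1), of k] by (intro pdeg_mult pdeg_cmult_right) (auto simp: pfam_def)
    moreover have "(m - r) + (n - m) = n - r" using False that by simp
    ultimately show ?thesis by simp
  qed
  then show ?thesis unfolding pfam_def wfps_def
    by (auto intro!: pdeg_sum sum.neutral simp: z')
qed

definition fps_vderiv :: "(real \<Rightarrow> complex fps) \<Rightarrow> complex fps \<Rightarrow> bool" where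
  "fps_vderiv F F' \<longleftrightarrow> (\<forall>n. ((\<lambda>s. fps_nth (F s) n) has_vector_derivative fps_nth F' n) (at 0))"

lemma fps_vderiv_const: "fps_vderiv (\<lambda>s. c) 0"
  unfolding fps_vderiv_def by simp

lemma fps_vderiv_add: "fps_vderiv F F' \<Longrightarrow> fps_vderiv G G' \<Longrightarrow> fps_vderiv (\<lambda>s. F s + G s) (F' + G')"
  unfolding fps_vderiv_def by (auto intro!: derivative_intros)

lemma fps_vderiv_mult: "fps_vderiv F F' \<Longrightarrow> fps_vderiv G G' \<Longrightarrow> fps_vderiv (\<lambda>s. F s * G s) (F 0 * G' + F' * G 0)"
  unfolding fps_vderiv_def fps_mult_nth fps_add_nth sum.distrib[symmetric]
  by (intro allI has_vector_derivative_sum has_vector_derivative_mult) auto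

lemma fps_vderiv_unique: "fps_vderiv F F' \<Longrightarrow> fps_vderiv F G' \<Longrightarrow> F' = G'"
  unfolding fps_vderiv_def fps_eq_iff using vector_derivative_unique_at by blast

subsection \<open>The conic\<close>

text \<open>Rational parametrization of the conic of level t. The involution \<open>x -> 1/x\<close>
  fixes Z and \<open>x -> 1/(l^2 x)\<close> fixes W; each partial derivative of the quadratic form
  vanishes at the fixed points of one of them and changes sign under it: \<open>Z + 2 g W\<close>
  under the first, \<open>W + 2 g Z\<close> under the second.\<close>

lemma conic_point:
  fixes g l c x t :: complex
  assumes l: "g * (l\<^sup>2 + 1) = l" "l \<noteq> 0" and x: "x \<noteq> 0" and c: "c\<^sup>2 * (4 * g\<^sup>2 - 1) = t * g"
  defines "Z \<equiv> c * (x + 1 / x)" and "W \<equiv> - c * (l * x + 1 / (l * x))"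
  shows "Z * W + g * (Z\<^sup>2 + W\<^sup>2) = t"
    and "W + 2 * g * Z = - c * ((l\<^sup>2 - 1) / (l\<^sup>2 + 1)) * (l * x - 1 / (l * x))"
    and "Z + 2 * g * W = - c * ((l\<^sup>2 - 1) / (l\<^sup>2 + 1)) * (x - 1 / x)"
proof -
  define y m k where "y = 1 / x" and "m = 1 / l" and "k = g * (l - m)"
  have g0: "g \<noteq> 0" and n: "l\<^sup>2 + 1 \<noteq> 0" using l by auto
  have xy: "x * y = 1" and lm: "l * m = 1" using x l by (simp_all add: y_def m_def)
  have "g * (l + m) = m * (g * (l\<^sup>2 + 1))" using lm by algebra
  then have glm: "g * (l + m) = 1" using l(1) lm by (simp add: mult.commute)
  have gl: "g * l\<^sup>2 = l - g" and gm: "g * m\<^sup>2 = m - g" using glm lm by algebra+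
  have k: "(l\<^sup>2 - 1) / (l\<^sup>2 + 1) = k"
  proof -
    have "k * (l\<^sup>2 + 1) = (l - m) * (g * (l\<^sup>2 + 1))" by (simp add: k_def mult_ac)
    then have "k * (l\<^sup>2 + 1) = l\<^sup>2 - 1"
      unfolding l(1) using lm by (simp add: left_diff_distrib right_diff_distrib power2_eq_square mult.commute)
    then show ?thesis using n by (simp add: divide_eq_eq)
  qed
  have Z: "Z = c * (x + y)" and W: "W = - c * (l * x + m * y)"
    by (simp_all add: Z_def W_def y_def m_def)
  have ZW: "Z * W = - c\<^sup>2 * (l * x\<^sup>2 + (m + l) * (x * y) + m * y\<^sup>2)"
    "Z\<^sup>2 = c\<^sup>2 * (x\<^sup>2 + y\<^sup>2 + 2 * (x * y))"
    "W\<^sup>2 = c\<^sup>2 * (l\<^sup>2 * x\<^sup>2 + m\<^sup>2 * y\<^sup>2 + 2 * (l * m) * (x * y))"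
    by (simp_all add: Z W power2_eq_square algebra_simps)
  have "Z * W + g * (Z\<^sup>2 + W\<^sup>2) =
      c\<^sup>2 * ((g + g * l\<^sup>2 - l) * x\<^sup>2 + (g + g * m\<^sup>2 - m) * y\<^sup>2 + 4 * g - (l + m))"
    unfolding ZW xy lm by (simp add: algebra_simps)
  also have "\<dots> = c\<^sup>2 * (4 * g - (l + m))" unfolding gl gm by simp
  finally have S: "Z * W + g * (Z\<^sup>2 + W\<^sup>2) = c\<^sup>2 * (4 * g - (l + m))" .
  have "g * (Z * W + g * (Z\<^sup>2 + W\<^sup>2)) = c\<^sup>2 * (4 * g\<^sup>2 - g * (l + m))"
    unfolding S by (simp add: algebra_simps power2_eq_square)
  also have "\<dots> = g * t" unfolding glm c by simp
  finally show "Z * W + g * (Z\<^sup>2 + W\<^sup>2) = t" using g0 by simp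
  have "k * l = g * l\<^sup>2 - g * (l * m)" "k * m = g * (l * m) - g * m\<^sup>2"
    by (simp_all add: k_def algebra_simps power2_eq_square)
  then have kl: "k * l = l - 2 * g" and km: "k * m = 2 * g - m" unfolding gl gm lm by simp_all
  have "W + 2 * g * Z = - c * ((l - 2 * g) * x - (2 * g - m) * y)" by (simp add: Z W algebra_simps)
  then have "W + 2 * g * Z = - c * k * (l * x - m * y)" unfolding kl[symmetric] km[symmetric] by (simp add: algebra_simps)
  then show "W + 2 * g * Z = - c * ((l\<^sup>2 - 1) / (l\<^sup>2 + 1)) * (l * x - 1 / (l * x))"
    unfolding k by (simp add: y_def m_def)
  have "g * m = 1 - g * l" using glm by (simp add: algebra_simps)
  then have kk: "k = 2 * g * l - 1" "g * m = 1 - g * l" by (simp_all add: k_def algebra_simps)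
  have "Z + 2 * g * W = c * ((1 - 2 * g * l) * x + (1 - 2 * (g * m)) * y)" by (simp add: Z W algebra_simps)
  then have "Z + 2 * g * W = - c * k * (x - y)" unfolding kk by (simp add: algebra_simps)
  then show "Z + 2 * g * W = - c * ((l\<^sup>2 - 1) / (l\<^sup>2 + 1)) * (x - 1 / x)"
    unfolding k by (simp add: y_def)
qed

lemma poly_leading_limit:
  fixes X e :: "nat \<Rightarrow> complex"
  assumes "(\<lambda>n. X n * e n) \<longlonglongrightarrow> a" "e \<longlonglongrightarrow> 0" "degree p \<le> J"
  shows "(\<lambda>n. poly p (X n) * e n ^ J) \<longlonglongrightarrow> coeff p J * a ^ J"
proof -
  have "poly p (X n) = (\<Sum>i\<le>J. coeff p i * X n ^ i)" for n
    using arg_cong[OF poly_as_sum_of_monoms'[OF assms(3)], of "\<lambda>p. poly p (X n)"]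
    by (simp add: poly_sum poly_monom)
  moreover have "coeff p i * X n ^ i * e n ^ J = coeff p i * (X n * e n) ^ i * e n ^ (J - i)" if "i \<in> {..J}" for n i
  proof -
    have "e n ^ J = e n ^ i * e n ^ (J - i)" using that by (simp flip: power_add)
    then show ?thesis by (simp add: power_mult_distrib)
  qed
  ultimately have "poly p (X n) * e n ^ J = (\<Sum>i\<le>J. coeff p i * (X n * e n) ^ i * e n ^ (J - i))" for n
    by (simp only: sum_distrib_right cong: sum.cong)
  moreover have "(\<lambda>n. \<Sum>i\<le>J. coeff p i * (X n * e n) ^ i * e n ^ (J - i)) \<longlonglongrightarrow> (\<Sum>i\<le>J. coeff p i * a ^ i * 0 ^ (J - i))"
    by (intro tendsto_intros assms)
  moreover have "(\<Sum>i\<le>J. coeff p i * a ^ i * 0 ^ (J - i)) = (\<Sum>i\<le>J. if i = J then coeff p J * a ^ J else 0)"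
    by (rule sum.cong) auto
  ultimately show ?thesis by simp
qed

lemma coeff_max_degree_nz:
  assumes "J = max (degree P) (degree R)" "J > 0"
  shows "coeff P J \<noteq> 0 \<or> coeff R J \<noteq> 0"
proof (cases "degree R \<le> degree P")
  case True
  then have "J = degree P" "P \<noteq> 0" using assms by auto
  then show ?thesis by simp
next
  case False
  then have "J = degree R" "R \<noteq> 0" using assms by auto
  then show ?thesis by simp
qed

lemma degree_le_1_no_linear_coeff:
  assumes "degree P \<le> 1" "coeff P 1 = 0"
  obtains p where "P = [:p:]"
proof -
  have "degree P \<noteq> 1" using assms(2) by (metis degree_0 leading_coeff_0_iff zero_neq_one)
  then show ?thesis using assms(1) degree_eq_zeroE[of P] that by (metis le_eq_less_or_eq less_one)
qed

text \<open>The equation for \<open>l\<close> says that the quadratic form vanishes at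
  \<open>(1, -l)\<close>; it is invariant under \<open>l -> 1/l\<close>, so the two asymptotic
  directions are \<open>(1, -l)\<close> and \<open>(1, -1/l)\<close>.\<close>

locale conic =
  fixes g l :: complex
  assumes root: "g * (l\<^sup>2 + 1) = l" "l \<noteq> 0" and not_unity: "\<And>n. n > 0 \<Longrightarrow> l ^ n \<noteq> 1"
begin

lemma g_nz: "g \<noteq> 0" using root by auto

lemma l2: "l\<^sup>2 \<noteq> 1" "l\<^sup>2 + 1 \<noteq> 0" using not_unity[of 2] root by auto

lemma disc_nz: "4 * g\<^sup>2 - 1 \<noteq> 0"
proof
  assume "4 * g\<^sup>2 - 1 = 0"
  then have "4 * (g * (l\<^sup>2 + 1))\<^sup>2 = (l\<^sup>2 + 1)\<^sup>2" by (simp add: power_mult_distrib)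
  then have "(l\<^sup>2 - 1)\<^sup>2 = 0" unfolding root by (simp add: power2_eq_square algebra_simps)
  then show False using l2 by simp
qed

lemma kappa: "(l\<^sup>2 - 1) / (l\<^sup>2 + 1) = 2 * g * l - 1" "(2 * g * l - 1) * l = l - 2 * g"
proof -
  have "(2 * g * l - 1) * (l\<^sup>2 + 1) = 2 * l * (g * (l\<^sup>2 + 1)) - (l\<^sup>2 + 1)" by (simp add: algebra_simps)
  also have "\<dots> = l\<^sup>2 - 1" unfolding root(1) by (simp add: power2_eq_square)
  finally show "(l\<^sup>2 - 1) / (l\<^sup>2 + 1) = 2 * g * l - 1" using l2 by (simp add: divide_eq_eq)
  have "g * l\<^sup>2 = l - g" using root(1) by (simp add: algebra_simps)
  moreover have "(2 * g * l - 1) * l = 2 * (g * l\<^sup>2) - l" by (simp add: algebra_simps power2_eq_square)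
  ultimately show "(2 * g * l - 1) * l = l - 2 * g" by simp
qed

lemma neg_power_products: "(- l) ^ J * (- l) ^ J = l ^ (2 * J)" "(- (1 / l)) ^ J * (- l) ^ J = 1"
proof -
  show "(- l) ^ J * (- l) ^ J = l ^ (2 * J)" by (simp add: power_mult power2_eq_square flip: power_mult_distrib)
  have "- (1 / l) * (- l) = 1" using root(2) by simp
  then show "(- (1 / l)) ^ J * (- l) ^ J = 1" unfolding power_mult_distrib[symmetric] by (simp only: power_one)
qed

text \<open>Exchanges the two asymptotic directions: every relation proved at one point at infinity
  holds at the other by interpretation.\<close>

lemma conic_inverse: "conic g (1 / l)"
proof
  show "g * ((1 / l)\<^sup>2 + 1) = 1 / l" using root by (simp add: field_simps power2_eq_square)
  show "1 / l \<noteq> 0" using root by simp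
  show "(1 / l) ^ n \<noteq> 1" if "n > 0" for n using not_unity[OF that] by (simp add: power_one_over)
qed

text \<open>Points of the conic escaping to infinity in the asymptotic direction \<open>(1, -l)\<close>.\<close>

lemma conic_at_infinity:
  obtains Z W e :: "nat \<Rightarrow> complex" and c where "c \<noteq> 0" "\<And>n. Z n * W n + g * ((Z n)\<^sup>2 + (W n)\<^sup>2) = 1"
    "e \<longlonglongrightarrow> 0" "(\<lambda>n. Z n * e n) \<longlonglongrightarrow> c" "(\<lambda>n. W n * e n) \<longlonglongrightarrow> - c * l"
proof -
  define c where "c = csqrt (g / (4 * g\<^sup>2 - 1))"
  have c: "c\<^sup>2 * (4 * g\<^sup>2 - 1) = 1 * g" using disc_nz by (simp add: c_def)
  have c0: "c \<noteq> 0" using g_nz disc_nz by (simp add: c_def)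
  define e where "e = (\<lambda>n::nat. inverse (of_nat (Suc n)) :: complex)"
  have e: "e \<longlonglongrightarrow> 0" "\<And>n. e n \<noteq> 0"
    unfolding e_def by (rule LIMSEQ_Suc[OF lim_inverse_n]) (simp del: of_nat_Suc)
  define Z where "Z = (\<lambda>n. c * (1 / e n + 1 / (1 / e n)))"
  define W where "W = (\<lambda>n. - c * (l * (1 / e n) + 1 / (l * (1 / e n))))"
  have 1: "Z n * W n + g * ((Z n)\<^sup>2 + (W n)\<^sup>2) = 1" for n
    unfolding Z_def W_def by (rule conic_point(1)[OF root _ c]) (simp add: e)
  have ZW: "Z n * e n = c * (1 + (e n)\<^sup>2)" "W n * e n = - c * (l + (e n)\<^sup>2 / l)" for n
    using e(2)[of n] root(2) unfolding Z_def W_def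
    by (simp_all add: power2_eq_square field_simps)
  have "(\<lambda>n. c * (1 + (e n)\<^sup>2)) \<longlonglongrightarrow> c * (1 + 0\<^sup>2)" by (intro tendsto_intros e)
  then have 2: "(\<lambda>n. Z n * e n) \<longlonglongrightarrow> c" unfolding ZW by simp
  have "(\<lambda>n. - c * (l + (e n)\<^sup>2 / l)) \<longlonglongrightarrow> - c * (l + 0\<^sup>2 / l)" by (intro tendsto_intros e root)
  then have 3: "(\<lambda>n. W n * e n) \<longlonglongrightarrow> - c * l" unfolding ZW by simp
  show ?thesis by (rule that[OF c0 1 e(1) 2 3])
qed

lemma leading_coeff_relation0:
  assumes "\<And>Z W. Z * W + g * (Z\<^sup>2 + W\<^sup>2) = 1 \<Longrightarrow> poly P Z = poly R W" "degree P \<le> J" "degree R \<le> J" "J > 0"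
  shows "coeff P J = coeff R J * (- l) ^ J"
proof -
  obtain Z W e c where *: "c \<noteq> 0" "\<And>n. Z n * W n + g * ((Z n)\<^sup>2 + (W n)\<^sup>2) = 1"
    "e \<longlonglongrightarrow> 0" "(\<lambda>n. Z n * e n) \<longlonglongrightarrow> c" "(\<lambda>n. W n * e n) \<longlonglongrightarrow> - c * l"
    by (rule conic_at_infinity) (rule that)
  have "(\<lambda>n. poly P (Z n) * e n ^ J) \<longlonglongrightarrow> coeff P J * c ^ J"
    "(\<lambda>n. poly R (W n) * e n ^ J) \<longlonglongrightarrow> coeff R J * (- c * l) ^ J"
    by (rule poly_leading_limit[OF *(4,3) assms(2)] poly_leading_limit[OF *(5,3) assms(3)])+
  moreover have "poly P (Z n) = poly R (W n)" for n using assms(1)[OF *(2)] .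
  ultimately have "coeff P J * c ^ J = coeff R J * (- c * l) ^ J"
    by (simp only:) (rule LIMSEQ_unique)
  also have "(- c * l) ^ J = c ^ J * (- l) ^ J" by (simp flip: power_mult_distrib)
  finally show ?thesis using *(1) by simp
qed

text \<open>The top coefficients satisfy \<open>p = r (-l)^J\<close> at one point at infinity and
  \<open>p = r (-1/l)^J\<close> at the other, hence \<open>r (l^(2J) - 1) = 0\<close>.\<close>

lemma poly_eq_on_conic:
  assumes "\<And>Z W. Z * W + g * (Z\<^sup>2 + W\<^sup>2) = 1 \<Longrightarrow> poly P Z = poly R W"
  shows "degree P = 0 \<and> degree R = 0"
proof (rule ccontr)
  assume neg: "\<not> ?thesis"
  define J where "J = max (degree P) (degree R)"
  have J: "degree P \<le> J" "degree R \<le> J" "J > 0" using neg by (auto simp: J_def)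
  have 1: "coeff P J = coeff R J * (- l) ^ J" by (rule leading_coeff_relation0[OF assms J])
  interpret i: conic g "1 / l" by (rule conic_inverse)
  have 2: "coeff P J = coeff R J * (- (1 / l)) ^ J" by (rule i.leading_coeff_relation0[OF assms J])
  have "coeff R J * ((- l) ^ J * (- l) ^ J) = coeff P J * (- l) ^ J" using 1 by simp
  also have "\<dots> = coeff R J * ((- (1 / l)) ^ J * (- l) ^ J)" using 2 by simp
  finally have "coeff R J * l ^ (2 * J) = coeff R J" using neg_power_products by simp
  then have "coeff R J = 0" using not_unity[of "2 * J"] J by auto
  moreover then have "coeff P J = 0" using 1 by simp
  ultimately show False using coeff_max_degree_nz[OF J_def] J by simp
qed

text \<open>The factors multiplying P and R are linear, so the top order is \<open>J + 1\<close>;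
  the quadratic terms reach it only for \<open>J = 1\<close>, which is recorded by
  \<open>0 ^ (J - 1)\<close>.\<close>

lemma leading_coeff_relation1:
  assumes "\<And>Z W. Z * W + g * (Z\<^sup>2 + W\<^sup>2) = 1 \<Longrightarrow>
      (W + 2 * g * Z) * poly P Z + (Z + 2 * g * W) * poly R W + x * (Z * W) + y * Z\<^sup>2 + y' * W\<^sup>2 = 0"
    and "degree P \<le> J" "degree R \<le> J" "J > 0"
  shows "(l\<^sup>2 - 1) / (l\<^sup>2 + 1) * (l * coeff P J + (- l) ^ J * coeff R J) = 0 ^ (J - 1) * (- x * l + y + y' * l\<^sup>2)"
proof -
  obtain Z W e c where *: "c \<noteq> 0" "\<And>n. Z n * W n + g * ((Z n)\<^sup>2 + (W n)\<^sup>2) = 1"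
    "e \<longlonglongrightarrow> 0" "(\<lambda>n. Z n * e n) \<longlonglongrightarrow> c" "(\<lambda>n. W n * e n) \<longlonglongrightarrow> - c * l"
    by (rule conic_at_infinity) (rule that)
  have pl: "(\<lambda>n. poly P (Z n) * e n ^ J) \<longlonglongrightarrow> coeff P J * c ^ J"
    "(\<lambda>n. poly R (W n) * e n ^ J) \<longlonglongrightarrow> coeff R J * (- c * l) ^ J"
    by (rule poly_leading_limit[OF *(4,3) assms(2)] poly_leading_limit[OF *(5,3) assms(3)])+
  have "(\<lambda>n. (W n * e n + 2 * g * (Z n * e n)) * (poly P (Z n) * e n ^ J)
     + (Z n * e n + 2 * g * (W n * e n)) * (poly R (W n) * e n ^ J)
     + (x * ((Z n * e n) * (W n * e n)) + y * (Z n * e n)\<^sup>2 + y' * (W n * e n)\<^sup>2) * e n ^ (J - 1))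
    \<longlonglongrightarrow> (- c * l + 2 * g * c) * (coeff P J * c ^ J) + (c + 2 * g * (- c * l)) * (coeff R J * (- c * l) ^ J)
     + (x * (c * (- c * l)) + y * c\<^sup>2 + y' * (- c * l)\<^sup>2) * 0 ^ (J - 1)" (is "?f \<longlonglongrightarrow> ?L")
    by (intro tendsto_intros * pl)
  moreover have "?f n = ((W n + 2 * g * Z n) * poly P (Z n) + (Z n + 2 * g * W n) * poly R (W n)
     + x * (Z n * W n) + y * (Z n)\<^sup>2 + y' * (W n)\<^sup>2) * e n ^ (J + 1)" for n
  proof -
    obtain K where "J = Suc K" using assms(4) gr0_implies_Suc by blast
    then have "e n ^ (J - 1) = e n ^ K" "e n ^ J = e n * e n ^ K" "e n ^ (J + 1) = e n * (e n * e n ^ K)" by simp_all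
    then show ?thesis by (simp only:) (simp add: algebra_simps power2_eq_square)
  qed
  ultimately have "(\<lambda>n. 0) \<longlonglongrightarrow> ?L" using assms(1)[OF *(2)] by simp
  then have L: "?L = 0" by (simp add: LIMSEQ_const_iff)
  have m: "(- c * l) ^ J = c ^ J * (- l) ^ J" by (simp flip: power_mult_distrib)
  have gl: "- c * l + 2 * g * c = - (c * ((l\<^sup>2 - 1) / (l\<^sup>2 + 1))) * l" "c + 2 * g * (- c * l) = - (c * ((l\<^sup>2 - 1) / (l\<^sup>2 + 1)))"
    unfolding kappa(1) using arg_cong[OF kappa(2), of "times c"] by (simp_all add: algebra_simps)
  have "c ^ Suc J * ((l\<^sup>2 - 1) / (l\<^sup>2 + 1) * (l * coeff P J + (- l) ^ J * coeff R J)) =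
     c\<^sup>2 * 0 ^ (J - 1) * (- x * l + y + y' * l\<^sup>2)"
    using L unfolding gl m by (simp add: algebra_simps power2_eq_square)
  also have "c\<^sup>2 * 0 ^ (J - 1) = c ^ Suc J * 0 ^ (J - 1)"
    using assms(4) by (cases "J = 1") (auto simp: power2_eq_square)
  finally have "c ^ Suc J * ((l\<^sup>2 - 1) / (l\<^sup>2 + 1) * (l * coeff P J + (- l) ^ J * coeff R J)) =
     c ^ Suc J * (0 ^ (J - 1) * (- x * l + y + y' * l\<^sup>2))" by (simp only: mult.assoc)
  then show ?thesis by (rule mult_left_cancel[THEN iffD1, rotated]) (use *(1) in simp)
qed

text \<open>In degree \<open>J > 1\<close> the relations at the two points at infinity give
  \<open>l^(2(J-1)) = 1\<close> unless the top coefficients vanish. The linear coefficients have to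
  be excluded: \<open>P = p Z\<close>, \<open>R = r W\<close> produces only quadratic terms, which
  x, y, y' can cancel.\<close>

lemma conic_operator_injective:
  assumes eq: "\<And>Z W. Z * W + g * (Z\<^sup>2 + W\<^sup>2) = 1 \<Longrightarrow>
      (W + 2 * g * Z) * poly P Z + (Z + 2 * g * W) * poly R W + x * (Z * W) + y * Z\<^sup>2 + y' * W\<^sup>2 = 0"
    and "coeff P 1 = 0" "coeff R 1 = 0"
  shows "P = 0 \<and> R = 0 \<and> x = 0 \<and> y = 0 \<and> y' = 0"
proof -
  interpret i: conic g "1 / l" by (rule conic_inverse)
  have il2: "((1 / l)\<^sup>2 - 1) / ((1 / l)\<^sup>2 + 1) \<noteq> 0" "(l\<^sup>2 - 1) / (l\<^sup>2 + 1) \<noteq> 0" using i.l2 l2 by auto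
  define J where "J = max (degree P) (degree R)"
  have J1: "J \<le> 1"
  proof (rule ccontr)
    assume "\<not> J \<le> 1"
    then have J: "degree P \<le> J" "degree R \<le> J" "J > 0" "J > 1" by (auto simp: J_def)
    have 1: "l * coeff P J + (- l) ^ J * coeff R J = 0"
      using leading_coeff_relation1[OF eq J(1-3)] J il2 by (simp add: power_0_left)
    have 2: "1 / l * coeff P J + (- (1 / l)) ^ J * coeff R J = 0"
      using i.leading_coeff_relation1[OF eq J(1-3)] J il2 by (simp add: power_0_left)
    have "(- l) ^ J * coeff R J = l\<^sup>2 * ((- (1 / l)) ^ J * coeff R J)"
    proof -
      have "coeff P J = - l * ((- (1 / l)) ^ J * coeff R J)"
        using 2 root(2) by (simp add: field_simps eq_neg_iff_add_eq_0)
      moreover have "(- l) ^ J * coeff R J = - (l * coeff P J)" using 1 by (simp add: add_eq_0_iff)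
      ultimately show ?thesis by (simp add: power2_eq_square)
    qed
    then have "(- l) ^ J * ((- l) ^ J * coeff R J) = (- l) ^ J * (l\<^sup>2 * ((- (1 / l)) ^ J * coeff R J))"
      by (simp only:)
    also have "\<dots> = l\<^sup>2 * ((- (1 / l)) ^ J * (- l) ^ J) * coeff R J" by (simp only: mult_ac)
    finally have "l ^ (2 * J) * coeff R J = l\<^sup>2 * coeff R J"
      using neg_power_products by (simp add: mult.assoc[symmetric])
    moreover have "l ^ (2 * J) = l\<^sup>2 * l ^ (2 * (J - 1))"
    proof -
      have e: "2 * J = 2 + 2 * (J - 1)" using J by simp
      show ?thesis by (subst e) (simp only: power_add)
    qed
    ultimately have "coeff R J = 0" using not_unity[of "2 * (J - 1)"] J root(2) by auto
    moreover then have "coeff P J = 0" using 1 root(2) by simp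
    ultimately show False using coeff_max_degree_nz[OF J_def] J by simp
  qed
  then have d: "degree P \<le> 1" "degree R \<le> 1" by (auto simp: J_def)
  obtain p where P: "P = [:p:]" using degree_le_1_no_linear_coeff[OF d(1) assms(2)] .
  obtain r where R: "R = [:r:]" using degree_le_1_no_linear_coeff[OF d(2) assms(3)] .
  \<comment> \<open>The relation for \<open>J = 1\<close>, although P and R are constant: its left
    side vanishes, so the quadratic form is zero in the direction \<open>(1, -l)\<close>. With the
    other direction, it is a multiple of the form defining the conic.\<close>
  have 1: "- x * l + y + y' * l\<^sup>2 = 0" using leading_coeff_relation1[OF eq d] assms(2,3) by simp
  have "- x * (1 / l) + y + y' * (1 / l)\<^sup>2 = 0" using i.leading_coeff_relation1[OF eq d] assms(2,3) by simp
  then have 2: "- x * l + y * l\<^sup>2 + y' = 0" using root(2) by (simp add: field_simps power2_eq_square)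
  have "(y - y') * (l\<^sup>2 - 1) = 0" using 1 2 by (simp add: algebra_simps)
  then have yy: "y' = y" using l2 by simp
  have "y * (l\<^sup>2 + 1) = x * l" using 1 yy by (simp add: algebra_simps)
  also have "\<dots> = g * x * (l\<^sup>2 + 1)" by (subst root(1)[symmetric]) simp
  finally have "y * (l\<^sup>2 + 1) = g * x * (l\<^sup>2 + 1)" .
  then have y: "y = g * x" using l2 by simp
  have eq': "(W + 2 * g * Z) * p + (Z + 2 * g * W) * r + x = 0" if "Z * W + g * (Z\<^sup>2 + W\<^sup>2) = 1" for Z W
  proof -
    have "x * (Z * W) + y * Z\<^sup>2 + y' * W\<^sup>2 = x * (Z * W + g * (Z\<^sup>2 + W\<^sup>2))" by (simp add: yy y algebra_simps)
    then show ?thesis using eq[OF that] that by (simp add: P R add.assoc)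
  qed
  \<comment> \<open>The quadratic form is now the constant x on the conic, so the terms with p and r
    dominate at infinity, and the two directions give two independent equations for them.\<close>
  have rel: "l' * p + r = 0" if "conic g l'" for l'
  proof -
    interpret i: conic g l' by fact
    obtain Z W e c where *: "c \<noteq> 0" "\<And>n. Z n * W n + g * ((Z n)\<^sup>2 + (W n)\<^sup>2) = 1"
      "e \<longlonglongrightarrow> 0" "(\<lambda>n. Z n * e n) \<longlonglongrightarrow> c" "(\<lambda>n. W n * e n) \<longlonglongrightarrow> - c * l'"
      by (rule i.conic_at_infinity) (rule that)
    have "(\<lambda>n. (W n * e n + 2 * g * (Z n * e n)) * p + (Z n * e n + 2 * g * (W n * e n)) * r + x * e n)
      \<longlonglongrightarrow> (- c * l' + 2 * g * c) * p + (c + 2 * g * (- c * l')) * r + x * 0" (is "?f \<longlonglongrightarrow> ?L")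
      by (intro tendsto_intros *)
    moreover have "?f n = ((W n + 2 * g * Z n) * p + (Z n + 2 * g * W n) * r + x) * e n" for n
      by (simp add: algebra_simps)
    ultimately have "(\<lambda>n. 0) \<longlonglongrightarrow> ?L" using eq'[OF *(2)] by simp
    then have L: "?L = 0" by (simp add: LIMSEQ_const_iff)
    have gl: "- c * l' + 2 * g * c = - (c * ((l'\<^sup>2 - 1) / (l'\<^sup>2 + 1))) * l'" "c + 2 * g * (- c * l') = - (c * ((l'\<^sup>2 - 1) / (l'\<^sup>2 + 1)))"
      unfolding i.kappa(1) using arg_cong[OF i.kappa(2), of "times c"] by (simp_all add: algebra_simps)
    have "c * ((l'\<^sup>2 - 1) / (l'\<^sup>2 + 1)) * (l' * p + r) = 0"
      using L unfolding gl unfolding i.kappa(1) by (simp add: algebra_simps)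
    then show ?thesis using *(1) i.l2 by simp
  qed
  have lp: "l * p + r = 0" "1 / l * p + r = 0" using rel conic_axioms conic_inverse by blast+
  have "p + l * r = 0" using lp(2) root(2) by (simp add: field_simps)
  with lp(1) have "(l\<^sup>2 - 1) * p = 0" by algebra
  then have p: "p = 0" using l2 by simp
  then have r: "r = 0" using lp by simp
  obtain Z W where "Z * W + g * (Z\<^sup>2 + W\<^sup>2) = 1" by (rule conic_at_infinity) (rule that)
  then have "x = 0" using eq'[of Z W] p r by simp
  then show ?thesis using P R p r y yy by simp
qed

end

subsection \<open>Uniqueness and linearization of the normalization\<close>

definition vanish :: "nat \<Rightarrow> complex fps \<Rightarrow> bool" where
  "vanish p F \<longleftrightarrow> (\<forall>n<p. fps_nth F n = 0)"

lemma vanish_0 [simp]: "vanish 0 F" by (simp add: vanish_def)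

lemma vanish_mult_nth:
  assumes "vanish p F" "vanish q G"
  shows "fps_nth (F * G) (p + q) = fps_nth F p * fps_nth G q" "vanish (p + q) (F * G)"
proof -
  have z: "fps_nth F i * fps_nth G j = 0" if "i < p \<or> j < q" for i j
    using that assms by (auto simp: vanish_def)
  have "fps_nth (F * G) (p + q) = (\<Sum>i=0..p + q. if i = p then fps_nth F p * fps_nth G q else 0)"
    unfolding fps_mult_nth
  proof (rule sum.cong[OF refl])
    fix i assume "i \<in> {0..p + q}"
    then show "fps_nth F i * fps_nth G (p + q - i) = (if i = p then fps_nth F p * fps_nth G q else 0)"
      using z[of i "p + q - i"] by (cases "i < p"; cases "i = p") auto
  qed
  then show "fps_nth (F * G) (p + q) = fps_nth F p * fps_nth G q" by simp
  have "fps_nth (F * G) n = 0" if "n < p + q" for n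
    unfolding fps_mult_nth
  proof (rule sum.neutral, rule ballI)
    fix i assume "i \<in> {0..n}"
    then have "i < p \<or> n - i < q" using that by auto
    then show "fps_nth F i * fps_nth G (n - i) = 0" by (rule z)
  qed
  then show "vanish (p + q) (F * G)" by (simp add: vanish_def)
qed

lemma wfps_nth: "fps_nth (wfps C Z H) n = (\<Sum>m\<le>n. \<Sum>k\<le>m div 2. C (m - 2 * k) k * Z ^ (m - 2 * k) * fps_nth (H ^ k) (n - m))"
  by (simp add: wfps_def)

text \<open>\<open>C'\<close> is \<open>C\<close> cut off below weight p. In the leading term of the
  difference the substituted series enters only through its constant term, which will be the value
  of the quadratic form at (Z, W).\<close>

lemma wfps_diff_vanish:
  assumes "\<And>j k. j + 2 * k < p \<Longrightarrow> C' j k = C j k" "\<And>j k. p \<le> j + 2 * k \<Longrightarrow> C' j k = 0"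
  shows "vanish p (wfps C Z H - wfps C' Z H)"
    and "fps_nth (wfps C Z H - wfps C' Z H) p = wpoly C p Z (fps_nth H 0)"
proof -
  have d: "fps_nth (wfps C Z H - wfps C' Z H) n = (\<Sum>m\<le>n. if m < p then 0 else
     (\<Sum>k\<le>m div 2. C (m - 2 * k) k * Z ^ (m - 2 * k) * fps_nth (H ^ k) (n - m)))" for n
    unfolding fps_sub_nth wfps_nth sum_subtractf[symmetric]
  proof (rule sum.cong[OF refl])
    fix m :: nat
    have e: "k \<le> m div 2 \<Longrightarrow> (m - 2 * k) + 2 * k = m" for k by auto
    show "(\<Sum>k\<le>m div 2. C (m - 2 * k) k * Z ^ (m - 2 * k) * fps_nth (H ^ k) (n - m) -
             C' (m - 2 * k) k * Z ^ (m - 2 * k) * fps_nth (H ^ k) (n - m)) =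
      (if m < p then 0 else (\<Sum>k\<le>m div 2. C (m - 2 * k) k * Z ^ (m - 2 * k) * fps_nth (H ^ k) (n - m)))"
    proof (cases "m < p")
      case True
      have "C' (m - 2 * k) k = C (m - 2 * k) k" if "k \<in> {..m div 2}" for k
        using assms(1)[of "m - 2 * k" k] e[of k] that True by simp
      then show ?thesis using True by (auto intro!: sum.neutral)
    next
      case False
      have "C' (m - 2 * k) k = 0" if "k \<in> {..m div 2}" for k
        using assms(2)[of "m - 2 * k" k] e[of k] that False by simp
      then show ?thesis using False by (auto intro!: sum.cong)
    qed
  qed
  show "vanish p (wfps C Z H - wfps C' Z H)"
    unfolding vanish_def d by (auto intro!: sum.neutral)
  have "fps_nth (wfps C Z H - wfps C' Z H) p = (\<Sum>m\<le>p. if m = p then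
     (\<Sum>k\<le>p div 2. C (p - 2 * k) k * Z ^ (p - 2 * k) * fps_nth (H ^ k) 0) else 0)"
    unfolding d by (rule sum.cong) auto
  then show "fps_nth (wfps C Z H - wfps C' Z H) p = wpoly C p Z (fps_nth H 0)"
    by (simp add: wpoly_def fps_power_zeroth)
qed

lemma wpoly_diff_sum:
  "wpoly (\<lambda>j k. F j k - (\<Sum>i\<in>I. c i * G i j k)) m z t = wpoly F m z t - (\<Sum>i\<in>I. c i * wpoly (G i) m z t)"
proof -
  have "(\<Sum>i\<in>I. c i * wpoly (G i) m z t) = (\<Sum>k\<le>m div 2. \<Sum>i\<in>I. c i * (G i (m - 2 * k) k * z ^ (m - 2 * k) * t ^ k))"
    unfolding wpoly_def sum_distrib_left by (rule sum.swap)
  then show ?thesis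
    unfolding wpoly_def by (simp add: sum_subtractf[symmetric] left_diff_distrib sum_distrib_right mult.assoc)
qed

lemma sum_linear_combination5:
  fixes \<alpha> \<beta> x y u v r p q e :: complex
  shows "\<alpha> * (x - (\<Sum>m\<in>I. c m * x' m)) + \<beta> * (y - (\<Sum>m\<in>I. c m * y' m)) + (u - (\<Sum>m\<in>I. c m * u' m)) * p
     + (v - (\<Sum>m\<in>I. c m * v' m)) * q + (r - (\<Sum>m\<in>I. c m * r' m)) * e
   = (\<alpha> * x + \<beta> * y + u * p + v * q + r * e) - (\<Sum>m\<in>I. c m * (\<alpha> * x' m + \<beta> * y' m + u' m * p + v' m * q + r' m * e))"
  by (simp add: algebra_simps sum.distrib sum_distrib_left)

text \<open>Restriction to the level \<open>t = 1\<close>. No information is lost, since within one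
  weight different k belong to different powers of z.\<close>

definition wpoly_poly :: "(nat \<Rightarrow> nat \<Rightarrow> complex) \<Rightarrow> nat \<Rightarrow> complex poly" where
  "wpoly_poly C d = (\<Sum>k\<le>d div 2. monom (C (d - 2 * k) k) (d - 2 * k))"

lemma poly_wpoly_poly: "poly (wpoly_poly C d) z = wpoly C d z 1"
  by (simp add: wpoly_poly_def wpoly_def poly_sum poly_monom)

lemma coeff_wpoly_poly: "k \<le> d div 2 \<Longrightarrow> coeff (wpoly_poly C d) (d - 2 * k) = C (d - 2 * k) k"
proof -
  assume k: "k \<le> d div 2"
  have "coeff (wpoly_poly C d) (d - 2 * k) = (\<Sum>i\<le>d div 2. if i = k then C (d - 2 * k) k else 0)"
    unfolding wpoly_poly_def coeff_sum
    by (rule sum.cong) (use k in auto)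
  then show ?thesis using k by simp
qed

lemma coeff_wpoly_poly_1: "(\<And>k. k > 0 \<Longrightarrow> C 1 k = 0) \<Longrightarrow> d \<ge> 2 \<Longrightarrow> coeff (wpoly_poly C d) 1 = 0"
  unfolding wpoly_poly_def coeff_sum
proof (rule sum.neutral, rule ballI)
  fix k assume C: "\<And>k. k > 0 \<Longrightarrow> C 1 k = 0" "d \<ge> 2"
  show "coeff (monom (C (d - 2 * k) k) (d - 2 * k)) 1 = 0"
  proof (cases "d - 2 * k = 1")
    case True
    then have "k > 0" using C(2) by auto
    then show ?thesis using True C(1) by simp
  qed simp
qed

lemma wpoly_at_zero: "wpoly C (2 * k) 0 1 = C 0 k"
proof -
  have "wpoly C (2 * k) 0 1 = (\<Sum>i\<le>k. if i = k then C 0 k else 0)"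
    unfolding wpoly_def by (rule sum.cong) auto
  then show ?thesis by simp
qed

text \<open>\<open>X 0\<close>, \<open>X 1\<close> are the coefficients of the normalizing map and its conjugate, and
  \<open>X 2\<close>, \<open>X 3\<close>, \<open>X 4\<close> those of the quadratic form in the normal form.\<close>

definition normalized :: "complex \<Rightarrow> (nat \<Rightarrow> nat \<Rightarrow> nat \<Rightarrow> complex) \<Rightarrow> bool" where
  "normalized g X \<longleftrightarrow>
     (\<forall>i<2. X i 0 0 = 0 \<and> X i 1 0 = 1 \<and> (\<forall>k>0. X i 1 k = 0)) \<and>
     (\<forall>i\<in>{2,3,4}. \<forall>j>0. \<forall>k. X i j k = 0) \<and> X 2 0 0 = 1 \<and> X 3 0 0 = g \<and> X 4 0 0 = g"

text \<open>The right side \<open>a2 u v + a3 u^2 + a4 v^2\<close> of the general normal form along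
  the line \<open>(x * Z, x * W)\<close>. The argument 0 in \<open>wfps (X 2) 0 H\<close> reflects
  that a2, a3, a4 depend on t alone.\<close>

definition nf_fps :: "(nat \<Rightarrow> nat \<Rightarrow> nat \<Rightarrow> complex) \<Rightarrow> complex \<Rightarrow> complex \<Rightarrow> complex fps \<Rightarrow> complex fps" where
  "nf_fps X Z W H = wfps (X 2) 0 H * (wfps (X 0) Z H * wfps (X 1) W H)
     + wfps (X 3) 0 H * (wfps (X 0) Z H * wfps (X 0) Z H) + wfps (X 4) 0 H * (wfps (X 1) W H * wfps (X 1) W H)"

lemma vanish_triple_diff:
  assumes "vanish p (a - a')" "vanish 1 u" "vanish 1 v" "vanish 1 u'" "vanish (Suc p) (u - u')" "vanish (Suc p) (v - v')"
  shows "fps_nth (a * (u * v) - a' * (u' * v')) (p + 2) =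
    fps_nth (a - a') p * (fps_nth u 1 * fps_nth v 1) + fps_nth a' 0 * (fps_nth (u - u') (Suc p) * fps_nth v 1)
      + fps_nth a' 0 * (fps_nth u' 1 * fps_nth (v - v') (Suc p))"
proof -
  have "a * (u * v) - a' * (u' * v') = (a - a') * (u * v) + a' * ((u - u') * v) + a' * (u' * (v - v'))"
    by (simp add: algebra_simps)
  moreover have "fps_nth ((a - a') * (u * v)) (p + (1 + 1)) = fps_nth (a - a') p * (fps_nth u 1 * fps_nth v 1)"
    by (subst vanish_mult_nth(1)[OF assms(1) vanish_mult_nth(2)[OF assms(2,3)]])
       (simp only: vanish_mult_nth(1)[OF assms(2,3)])
  moreover have "fps_nth (a' * ((u - u') * v)) (0 + (Suc p + 1)) = fps_nth a' 0 * (fps_nth (u - u') (Suc p) * fps_nth v 1)"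
    by (subst vanish_mult_nth(1)[OF vanish_0 vanish_mult_nth(2)[OF assms(5,3)]])
       (simp only: vanish_mult_nth(1)[OF assms(5,3)])
  moreover have "fps_nth (a' * (u' * (v - v'))) (0 + (1 + Suc p)) = fps_nth a' 0 * (fps_nth u' 1 * fps_nth (v - v') (Suc p))"
    by (subst vanish_mult_nth(1)[OF vanish_0 vanish_mult_nth(2)[OF assms(4,6)]])
       (simp only: vanish_mult_nth(1)[OF assms(4,6)])
  ultimately show ?thesis by simp
qed

lemma wfps_low: "fps_nth (wfps C Z H) 0 = C 0 0" "C 0 0 = 0 \<Longrightarrow> fps_nth (wfps C Z H) 1 = C 1 0 * Z"
  by (simp_all add: wfps_nth lessThan_Suc_atMost[symmetric] numeral_2_eq_2)

context conic
begin

text \<open>The part of weight d of the map and the part of weight \<open>d - 1\<close> of the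
  quadratic form first enter the equation at order \<open>d + 1\<close>, and there linearly, through
  the operator that is injective on the conic. The remaining terms of this order involve only lower
  weights and have degree at most \<open>d - 1\<close> in s; injectivity carries this degree over to
  the new coefficients.\<close>

lemma normalization_polynomial:
  fixes X :: "real \<Rightarrow> nat \<Rightarrow> nat \<Rightarrow> nat \<Rightarrow> complex" and H :: "real \<Rightarrow> complex \<Rightarrow> complex \<Rightarrow> complex fps"
  assumes norm: "\<And>s. normalized g (X s)"
    and H: "\<And>Z W. pfam 0 (\<lambda>s. H s Z W)" "\<And>s Z W. fps_nth (H s Z W) 0 = Z * W + g * (Z\<^sup>2 + W\<^sup>2)"
    and eq: "\<And>s Z W. fps_X\<^sup>2 * H s Z W = nf_fps (X s) Z W (H s Z W)"
  shows "(\<forall>i<2. \<forall>j k. j + 2 * k = d \<longrightarrow> pdeg (d - 1) (\<lambda>s. X s i j k)) \<and>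
     (\<forall>i\<in>{2,3,4}. \<forall>j k. j + 2 * k + 1 = d \<longrightarrow> pdeg (d - 1) (\<lambda>s. X s i j k))"
proof (induction d rule: less_induct)
  case (less d)
  have X01: "X s i 0 0 = 0" "X s i 1 0 = 1" "\<And>k. k > 0 \<Longrightarrow> X s i 1 k = 0" if "i < 2" for s i
    using norm[of s] that unfolding normalized_def by blast+
  have X24: "X s 2 0 0 = 1" "X s 3 0 0 = g" "X s 4 0 0 = g" for s using norm[of s] unfolding normalized_def by blast+
  have X24': "X s i j k = 0" if "i \<in> {2,3,4}" "j > 0" for s i j k using norm[of s] that unfolding normalized_def by blast
  consider "d = 0" | "d = 1" | "d \<ge> 2" by linarith
  then show ?case
  proof cases
    case 1 then show ?thesis using X01 by (simp add: pdeg_const)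
  next
    case 2
    show ?thesis
    proof (intro conjI allI impI ballI)
      fix i j k :: nat
      assume i: "i < 2" and "j + 2 * k = d"
      then have "j = 1" "k = 0" using 2 by presburger+
      then show "pdeg (d - 1) (\<lambda>s. X s i j k)" using X01(2)[OF i] by (simp add: pdeg_const)
    next
      fix i j k :: nat
      assume i: "i \<in> {2,3,4}" and "j + 2 * k + 1 = d"
      then have "j = 0" "k = 0" using 2 by presburger+
      then show "pdeg (d - 1) (\<lambda>s. X s i j k)" using i X24 by (auto simp: pdeg_const)
    qed
  next
    case 3
    define n where "n = d - 1"
    have dn: "d = Suc n" "n \<ge> 1" using 3 by (auto simp: n_def)
    \<comment> \<open>The part known by induction. The shift by one for \<open>i >= 2\<close> aligns
      the weights: a term of the quadratic form is multiplied by two factors of order 1, a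
      correction of the map by only one.\<close>
    define L where "L = (\<lambda>s i j k. if j + 2 * k + (if i < 2 then 0 else 1) < d then X s i j k else 0)"
    have IH: "pdeg (j + 2 * k - 1) (\<lambda>s. L s i j k)" if "i < 2" for i j k
    proof (cases "j + 2 * k < d")
      case True then show ?thesis using less[OF True] that by (auto simp: L_def)
    qed (auto simp: L_def that)
    have IH': "pdeg (j + 2 * k) (\<lambda>s. L s i j k)" if "i \<in> {2,3,4}" for i j k
    proof (cases "j + 2 * k + 1 < d")
      case True
      have "pdeg (j + 2 * k + 1 - 1) (\<lambda>s. X s i j k)" using less[OF True] that by blast
      then show ?thesis using True that by (auto simp: L_def)
    qed (use that in \<open>auto simp: L_def\<close>)
    have pL: "pfam 1 (\<lambda>s. wfps (L s i) Z (H s Z' W'))" if "i < 2" for i Z Z' W'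
      by (rule pfam_wfps[OF H(1)]) (use IH[OF that] X01[OF that] in \<open>auto simp: L_def\<close>)
    have pL': "pfam 0 (\<lambda>s. wfps (L s i) Z (H s Z' W'))" if "i \<in> {2,3,4}" for i Z Z' W'
      by (rule pfam_wfps[OF H(1)]) (use IH'[OF that] in auto)
    \<comment> \<open>The orders of a quadratic coefficient and of two components of the map add up
      to 2, so that coefficient \<open>n + 2\<close> has degree at most n.\<close>
    have "pfam (0 + (1 + 1)) (\<lambda>s. wfps (L s 2) 0 (H s Z W) * (wfps (L s 0) Z (H s Z W) * wfps (L s 1) W (H s Z W)))" for Z W
      by (intro pfam_mult pL pL') auto
    moreover have "pfam (0 + (1 + 1)) (\<lambda>s. wfps (L s 3) 0 (H s Z W) * (wfps (L s 0) Z (H s Z W) * wfps (L s 0) Z (H s Z W)))" for Z W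
      by (intro pfam_mult pL pL') auto
    moreover have "pfam (0 + (1 + 1)) (\<lambda>s. wfps (L s 4) 0 (H s Z W) * (wfps (L s 1) W (H s Z W) * wfps (L s 1) W (H s Z W)))" for Z W
      by (intro pfam_mult pL pL') auto
    ultimately have "pfam 2 (\<lambda>s. nf_fps (L s) Z W (H s Z W))" for Z W
      unfolding nf_fps_def by (intro pfam_add) (simp_all add: numeral_2_eq_2)
    then have plow: "pdeg n (\<lambda>s. fps_nth (nf_fps (L s) Z W (H s Z W)) (n + 2))" for Z W
      unfolding pfam_def by (metis add_diff_cancel_right')
    \<comment> \<open>The first variation of \<open>a2 u v + a3 u^2 + a4 v^2\<close> at
      \<open>u = Z\<close>, \<open>v = W\<close>, \<open>a2 = 1\<close>, \<open>a3 = a4 = g\<close>,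
      in the weights at stake.\<close>
    define \<Lambda> where "\<Lambda> = (\<lambda>(Y :: nat \<Rightarrow> nat \<Rightarrow> nat \<Rightarrow> complex) Z W. (W + 2 * g * Z) * wpoly (Y 0) d Z (Z * W + g * (Z\<^sup>2 + W\<^sup>2))
       + (Z + 2 * g * W) * wpoly (Y 1) d W (Z * W + g * (Z\<^sup>2 + W\<^sup>2))
       + wpoly (Y 2) n 0 (Z * W + g * (Z\<^sup>2 + W\<^sup>2)) * (Z * W) + wpoly (Y 3) n 0 (Z * W + g * (Z\<^sup>2 + W\<^sup>2)) * Z\<^sup>2
       + wpoly (Y 4) n 0 (Z * W + g * (Z\<^sup>2 + W\<^sup>2)) * W\<^sup>2 :: complex)"
    have step: "fps_nth (H s Z W) n - fps_nth (nf_fps (L s) Z W (H s Z W)) (n + 2) = \<Lambda> (X s) Z W" for s Z W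
    proof -
      let ?H = "H s Z W"
      define Q where "Q = Z * W + g * (Z\<^sup>2 + W\<^sup>2)"
      have v: "vanish d (wfps (X s i) Y ?H - wfps (L s i) Y ?H)"
        "fps_nth (wfps (X s i) Y ?H - wfps (L s i) Y ?H) d = wpoly (X s i) d Y Q" if "i < 2" for i Y
        using wfps_diff_vanish[of d "L s i" "X s i" Y ?H] that by (auto simp: L_def H(2) Q_def)
      have v': "vanish n (wfps (X s i) Y ?H - wfps (L s i) Y ?H)"
        "fps_nth (wfps (X s i) Y ?H - wfps (L s i) Y ?H) n = wpoly (X s i) n Y Q" if "i \<in> {2,3,4}" for i Y
        using wfps_diff_vanish[of n "L s i" "X s i" Y ?H] that by (auto simp: L_def H(2) dn Q_def)
      have L0: "L s i 0 0 = 0" "L s i 1 0 = 1" if "i < 2" for i using X01[OF that] that 3 by (auto simp: L_def)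
      have L2: "L s 2 0 0 = 1" "L s 3 0 0 = g" "L s 4 0 0 = g" using X24 3 by (auto simp: L_def)
      have o: "vanish 1 (wfps (X s i) Y ?H)" "vanish 1 (wfps (L s i) Y ?H)"
        "fps_nth (wfps (X s i) Y ?H) 1 = Y" "fps_nth (wfps (L s i) Y ?H) 1 = Y" if "i < 2" for i Y
        using X01[OF that] L0[OF that] by (simp_all add: vanish_def wfps_low del: One_nat_def)
      note vd = v(1)[unfolded dn] and vn = v(2)[unfolded dn]
      have "fps_nth (nf_fps (X s) Z W ?H - nf_fps (L s) Z W ?H) (n + 2) = \<Lambda> (X s) Z W"
      proof -
        have 1: "fps_nth (wfps (X s 2) 0 ?H * (wfps (X s 0) Z ?H * wfps (X s 1) W ?H) - wfps (L s 2) 0 ?H * (wfps (L s 0) Z ?H * wfps (L s 1) W ?H)) (n + 2)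
          = wpoly (X s 2) n 0 Q * (Z * W) + 1 * (wpoly (X s 0) (Suc n) Z Q * W) + 1 * (Z * wpoly (X s 1) (Suc n) W Q)"
          by (subst vanish_triple_diff) (simp_all add: v' vd vn o wfps_low L2 del: One_nat_def fps_sub_nth)
        have 2: "fps_nth (wfps (X s 3) 0 ?H * (wfps (X s 0) Z ?H * wfps (X s 0) Z ?H) - wfps (L s 3) 0 ?H * (wfps (L s 0) Z ?H * wfps (L s 0) Z ?H)) (n + 2)
          = wpoly (X s 3) n 0 Q * (Z * Z) + g * (wpoly (X s 0) (Suc n) Z Q * Z) + g * (Z * wpoly (X s 0) (Suc n) Z Q)"
          by (subst vanish_triple_diff) (simp_all add: v' vd vn o wfps_low L2 del: One_nat_def fps_sub_nth)
        have 3: "fps_nth (wfps (X s 4) 0 ?H * (wfps (X s 1) W ?H * wfps (X s 1) W ?H) - wfps (L s 4) 0 ?H * (wfps (L s 1) W ?H * wfps (L s 1) W ?H)) (n + 2)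
          = wpoly (X s 4) n 0 Q * (W * W) + g * (wpoly (X s 1) (Suc n) W Q * W) + g * (W * wpoly (X s 1) (Suc n) W Q)"
          by (subst vanish_triple_diff) (simp_all add: v' vd vn o wfps_low L2 del: One_nat_def fps_sub_nth)
        have split: "nf_fps (X s) Z W ?H - nf_fps (L s) Z W ?H =
          (wfps (X s 2) 0 ?H * (wfps (X s 0) Z ?H * wfps (X s 1) W ?H) - wfps (L s 2) 0 ?H * (wfps (L s 0) Z ?H * wfps (L s 1) W ?H))
          + (wfps (X s 3) 0 ?H * (wfps (X s 0) Z ?H * wfps (X s 0) Z ?H) - wfps (L s 3) 0 ?H * (wfps (L s 0) Z ?H * wfps (L s 0) Z ?H))
          + (wfps (X s 4) 0 ?H * (wfps (X s 1) W ?H * wfps (X s 1) W ?H) - wfps (L s 4) 0 ?H * (wfps (L s 1) W ?H * wfps (L s 1) W ?H))"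
          unfolding nf_fps_def by (simp only: add_diff_add)
        show ?thesis unfolding split fps_add_nth 1 2 3
          unfolding \<Lambda>_def Q_def[symmetric] dn(1) by (simp add: algebra_simps power2_eq_square)
      qed
      moreover have "fps_nth (nf_fps (X s) Z W ?H) (n + 2) = fps_nth ?H n"
        unfolding eq[symmetric] by (simp add: fps_X_power_mult_nth)
      ultimately show ?thesis by simp
    qed
    have p\<Lambda>: "pdeg n (\<lambda>s. \<Lambda> (X s) Z W)" for Z W
      unfolding step[symmetric] using H(1)[of Z W] plow by (intro pdeg_diff) (auto simp: pfam_def)
    have zero: "X s i j k = (\<Sum>m\<le>n. poly (lagr of_nat n m) (of_real s) * X (real m) i j k)"
      if "(i < 2 \<and> j + 2 * k = d) \<or> (i \<in> {2,3,4} \<and> j + 2 * k = n)" for s i j k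
    proof -
      \<comment> \<open>The defect D in the interpolation identity at s is a linear combination of
        solutions at single parameters; \<open>\<Lambda>\<close> annihilates it because the right
        sides have degree n.\<close>
      define c where "c = (\<lambda>m. poly (lagr of_nat n m) (of_real s))"
      define D where "D = (\<lambda>i j k. X s i j k - (\<Sum>m\<le>n. c m * X (real m) i j k))"
      have lin: "\<Lambda> D Z W = \<Lambda> (X s) Z W - (\<Sum>m\<le>n. c m * \<Lambda> (X (real m)) Z W)" for Z W
        unfolding \<Lambda>_def D_def wpoly_diff_sum by (rule sum_linear_combination5)
      have L0: "\<Lambda> D Z W = 0" for Z W
        unfolding lin c_def
        by (subst eq_iff_diff_eq_0[symmetric]) (rule p\<Lambda>[unfolded pdeg_iff_lagr, rule_format])
      have inj: "wpoly_poly (D 0) d = 0 \<and> wpoly_poly (D 1) d = 0 \<and> wpoly (D 2) n 0 1 = 0 \<and> wpoly (D 3) n 0 1 = 0 \<and> wpoly (D 4) n 0 1 = 0"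
      proof (rule conic_operator_injective)
        fix Z W :: complex assume Q: "Z * W + g * (Z\<^sup>2 + W\<^sup>2) = 1"
        show "(W + 2 * g * Z) * poly (wpoly_poly (D 0) d) Z + (Z + 2 * g * W) * poly (wpoly_poly (D 1) d) W
          + wpoly (D 2) n 0 1 * (Z * W) + wpoly (D 3) n 0 1 * Z\<^sup>2 + wpoly (D 4) n 0 1 * W\<^sup>2 = 0"
          using L0[of Z W] unfolding \<Lambda>_def Q poly_wpoly_poly .
      next
        show "coeff (wpoly_poly (D 0) d) 1 = 0" "coeff (wpoly_poly (D 1) d) 1 = 0"
          by (rule coeff_wpoly_poly_1[OF _ 3]; simp add: D_def X01 del: One_nat_def)+
      qed
      have "D i j k = 0"
      proof (cases "i < 2")
        case True
        then have jk: "k \<le> d div 2" "j = d - 2 * k" using that by auto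
        have "coeff (wpoly_poly (D i) d) j = 0" using inj True by (auto simp: less_2_cases_iff)
        then show ?thesis using coeff_wpoly_poly[OF jk(1), of "D i"] jk by simp
      next
        case False
        then have i: "i \<in> {2,3,4}" and jk: "j + 2 * k = n" using that by auto
        show ?thesis
        proof (cases "j = 0")
          case True
          then have "wpoly (D i) (2 * k) 0 1 = 0" using inj i jk by auto
          then show ?thesis unfolding wpoly_at_zero using True by simp
        next
          case False
          then show ?thesis using X24'[OF i] by (simp add: D_def)
        qed
      qed
      then show ?thesis by (simp add: D_def c_def)
    qed
    have "d - 1 = n" by (simp add: n_def)
    then show ?thesis
      unfolding pdeg_iff_lagr
      by (simp only:) (intro conjI allI impI ballI zero; use dn in simp)
  qed
qed

end

section \<open>Differentiation of the normalized equation in the parameter\<close>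

lemma fps_vderiv_power:
  assumes "fps_vderiv F F'"
  shows "\<exists>P. fps_vderiv (\<lambda>s. F s ^ k) P"
proof (induction k)
  case 0 show ?case using fps_vderiv_const[of 1] by auto
next
  case (Suc k)
  then obtain P where "fps_vderiv (\<lambda>s. F s ^ k) P" by blast
  from fps_vderiv_mult[OF assms this] show ?case by auto
qed

text \<open>At \<open>s = 0\<close> the series depends on t only through the linear term
  \<open>C 0 0 1 * t\<close>, so the chain rule adds just this constant times the derivative
  \<open>fps_X^2 * H1\<close> of t.\<close>

lemma fps_vderiv_wfps:
  assumes H: "fps_vderiv H H1"
    and C: "\<And>j k. ((\<lambda>s. C s j k) has_vector_derivative D j k) (at 0)"
    and C0: "\<And>j k. k > 0 \<Longrightarrow> (j, k) \<noteq> (0, 1) \<Longrightarrow> C 0 j k = 0"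
  shows "fps_vderiv (\<lambda>s. wfps (C s) Z (H s)) (wfps D Z (H 0) + fps_const (C 0 0 1) * (fps_X\<^sup>2 * H1))"
proof -
  obtain P where P': "\<And>k. fps_vderiv (\<lambda>s. H s ^ k) (P k)" using fps_vderiv_power[OF H] by metis
  have P01: "P 0 = 0" "P 1 = H1"
    using fps_vderiv_unique[OF P'[of 0], of 0] fps_vderiv_const[of 1] fps_vderiv_unique[OF P'[of 1], of H1] H by simp_all
  have tm: "((\<lambda>s. C s (m - 2 * k) k * Z ^ (m - 2 * k) * fps_nth (H s ^ k) (n - m)) has_vector_derivative
      C 0 (m - 2 * k) k * Z ^ (m - 2 * k) * fps_nth (P k) (n - m) + D (m - 2 * k) k * Z ^ (m - 2 * k) * fps_nth (H 0 ^ k) (n - m)) (at 0)" for m k n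
    using P'[of k] unfolding fps_vderiv_def
    by (intro has_vector_derivative_mult has_vector_derivative_mult_left C) auto
  have z: "(\<Sum>k\<le>m div 2. C 0 (m - 2 * k) k * Z ^ (m - 2 * k) * fps_nth (P k) (n - m)) =
      (if m = 2 then C 0 0 1 * fps_nth H1 (n - 2) else 0)" for m n
  proof (cases "m = 2")
    case True
    have "{..m div 2} = {0, 1}" using True by auto
    then show ?thesis using True P01 by simp
  next
    case False
    have "C 0 (m - 2 * k) k * Z ^ (m - 2 * k) * fps_nth (P k) (n - m) = 0" if "k \<le> m div 2" for k
    proof (cases "k = 0")
      case True then show ?thesis using P01 by simp
    next
      case k: False
      have "(m - 2 * k, k) \<noteq> (0, 1)" using that False by auto
      then show ?thesis using C0[of k "m - 2 * k"] k by simp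
    qed
    then show ?thesis using False by (auto intro!: sum.neutral)
  qed
  have "((\<lambda>s. fps_nth (wfps (C s) Z (H s)) n) has_vector_derivative fps_nth (wfps D Z (H 0) + fps_const (C 0 0 1) * (fps_X\<^sup>2 * H1)) n) (at 0)" for n
  proof -
    have "((\<lambda>s. fps_nth (wfps (C s) Z (H s)) n) has_vector_derivative (\<Sum>m\<le>n. \<Sum>k\<le>m div 2.
       C 0 (m - 2 * k) k * Z ^ (m - 2 * k) * fps_nth (P k) (n - m) + D (m - 2 * k) k * Z ^ (m - 2 * k) * fps_nth (H 0 ^ k) (n - m))) (at 0)"
      unfolding wfps_nth by (intro has_vector_derivative_sum tm)
    moreover have "(\<Sum>m\<le>n. \<Sum>k\<le>m div 2.
       C 0 (m - 2 * k) k * Z ^ (m - 2 * k) * fps_nth (P k) (n - m) + D (m - 2 * k) k * Z ^ (m - 2 * k) * fps_nth (H 0 ^ k) (n - m))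
      = fps_nth (wfps D Z (H 0) + fps_const (C 0 0 1) * (fps_X\<^sup>2 * H1)) n"
      unfolding sum.distrib z by (simp add: wfps_nth fps_X_power_mult_nth)
    ultimately show ?thesis by simp
  qed
  then show ?thesis by (simp add: fps_vderiv_def)
qed

lemma wfps_low_entries:
  assumes "\<And>j k. (j, k) \<notin> {(0, 0), (1, 0), (0, 1)} \<Longrightarrow> C j k = 0"
  shows "wfps C Z H = fps_const (C 0 0) + fps_const (C 1 0 * Z) * fps_X + fps_const (C 0 1) * (fps_X\<^sup>2 * H)"
proof (rule fps_ext)
  fix n
  have inner: "(\<Sum>k\<le>m div 2. C (m - 2 * k) k * Z ^ (m - 2 * k) * fps_nth (H ^ k) (n - m)) =
     (if m = 0 then C 0 0 * fps_nth 1 n else 0) + (if m = 1 then C 1 0 * Z * fps_nth 1 (n - 1) else 0)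
     + (if m = 2 then C 0 1 * fps_nth H (n - 2) else 0)" for m
  proof -
    consider "m = 0" | "m = 1" | "m = 2" | "m \<ge> 3" by linarith
    then show ?thesis
    proof cases
      case 3
      then have "{..m div 2} = {0, 1}" by auto
      then show ?thesis using 3 assms[of 2 0] by simp
    next
      case 4
      have "C (m - 2 * k) k = 0" if "k \<le> m div 2" for k
      proof (rule assms)
        have "(m - 2 * k) + 2 * k = m" using that by auto
        then show "(m - 2 * k, k) \<notin> {(0, 0), (1, 0), (0, 1)}" using 4 by auto
      qed
      then show ?thesis using 4 by (auto intro!: sum.neutral)
    qed simp_all
  qed
  show "fps_nth (wfps C Z H) n = fps_nth (fps_const (C 0 0) + fps_const (C 1 0 * Z) * fps_X + fps_const (C 0 1) * (fps_X\<^sup>2 * H)) n"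
    unfolding wfps_nth inner sum.distrib by (auto simp: fps_X_power_mult_nth fps_X_nth)
qed

text \<open>The base point \<open>X 0\<close> of the family is the surface \<open>t = z w + (g + t) (z\<^sup>2 + w\<^sup>2)\<close>, already in normal form.\<close>

definition base_nf :: "complex \<Rightarrow> nat \<Rightarrow> nat \<Rightarrow> nat \<Rightarrow> complex" where
  "base_nf g i j k = (if i < 2 then (if (j, k) = (1, 0) then 1 else 0)
     else if i = 2 then (if (j, k) = (0, 0) then 1 else 0)
     else if (j, k) = (0, 0) then g else if (j, k) = (0, 1) then 1 else 0)"

text \<open>Product rule at \<open>u = z\<close>, \<open>v = w\<close>, \<open>a2 = 1\<close>,
  \<open>a3 = a4 = g + t\<close>. The summand \<open>fps_X^2 * H1\<close> next to the terms of
  \<open>D 3\<close> and \<open>D 4\<close> is the derivative of \<open>g + t\<close> through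
  t.\<close>

lemma linearized_normalization:
  fixes X :: "real \<Rightarrow> nat \<Rightarrow> nat \<Rightarrow> nat \<Rightarrow> complex" and H :: "real \<Rightarrow> complex fps"
  assumes H: "fps_vderiv H H1"
    and eq: "\<And>s. fps_X\<^sup>2 * H s = nf_fps (X s) Z W (H s)"
    and X0: "X 0 = base_nf g"
    and D: "\<And>i j k. i < 5 \<Longrightarrow> ((\<lambda>s. X s i j k) has_vector_derivative D i j k) (at 0)"
  defines "G \<equiv> fps_const g + fps_X\<^sup>2 * H 0"
  shows "fps_X\<^sup>2 * H1 = wfps (D 2) 0 (H 0) * (fps_const Z * fps_X * (fps_const W * fps_X))
     + (wfps (D 0) Z (H 0) * (fps_const W * fps_X) + fps_const Z * fps_X * wfps (D 1) W (H 0))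
     + (wfps (D 3) 0 (H 0) + fps_X\<^sup>2 * H1) * (fps_const Z * fps_X)\<^sup>2 + 2 * G * (fps_const Z * fps_X) * wfps (D 0) Z (H 0)
     + (wfps (D 4) 0 (H 0) + fps_X\<^sup>2 * H1) * (fps_const W * fps_X)\<^sup>2 + 2 * G * (fps_const W * fps_X) * wfps (D 1) W (H 0)"
proof -
  have b: "wfps (X 0 i) Y (H 0) = fps_const Y * fps_X" if "i < 2" for i Y
    by (subst wfps_low_entries) (use that in \<open>auto simp: X0 base_nf_def\<close>)
  have b2: "wfps (X 0 2) 0 (H 0) = 1"
    by (subst wfps_low_entries) (auto simp: X0 base_nf_def)
  have b3: "wfps (X 0 3) 0 (H 0) = G" "wfps (X 0 4) 0 (H 0) = G"
    by (subst wfps_low_entries; auto simp: X0 base_nf_def G_def)+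
  have d: "fps_vderiv (\<lambda>s. wfps (X s i) Y (H s)) (wfps (D i) Y (H 0) + fps_const (X 0 i 0 1) * (fps_X\<^sup>2 * H1))" if "i < 5" for i Y
    by (rule fps_vderiv_wfps[OF H D[OF that]]) (auto simp: X0 base_nf_def)
  have d0: "fps_vderiv (\<lambda>s. wfps (X s i) Y (H s)) (wfps (D i) Y (H 0))" if "i < 3" for i Y
    using d[of i Y] that by (auto simp: X0 base_nf_def split: if_splits)
  have d3: "fps_vderiv (\<lambda>s. wfps (X s i) Y (H s)) (wfps (D i) Y (H 0) + fps_X\<^sup>2 * H1)" if "i = 3 \<or> i = 4" for i Y
    using d[of i Y] that by (auto simp: X0 base_nf_def)
  note dd = fps_vderiv_add[OF fps_vderiv_add[OF
     fps_vderiv_mult[OF d0[of 2 0] fps_vderiv_mult[OF d0[of 0 Z] d0[of 1 W]]]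
     fps_vderiv_mult[OF d3[of 3 0] fps_vderiv_mult[OF d0[of 0 Z] d0[of 0 Z]]]]
     fps_vderiv_mult[OF d3[of 4 0] fps_vderiv_mult[OF d0[of 1 W] d0[of 1 W]]]]
  have rhs: "fps_vderiv (\<lambda>s. nf_fps (X s) Z W (H s))
     (1 * (fps_const Z * fps_X * wfps (D 1) W (H 0) + wfps (D 0) Z (H 0) * (fps_const W * fps_X)) + wfps (D 2) 0 (H 0) * (fps_const Z * fps_X * (fps_const W * fps_X)) +
     (G * (fps_const Z * fps_X * wfps (D 0) Z (H 0) + wfps (D 0) Z (H 0) * (fps_const Z * fps_X)) + (wfps (D 3) 0 (H 0) + fps_X\<^sup>2 * H1) * (fps_const Z * fps_X * (fps_const Z * fps_X))) +
     (G * (fps_const W * fps_X * wfps (D 1) W (H 0) + wfps (D 1) W (H 0) * (fps_const W * fps_X)) + (wfps (D 4) 0 (H 0) + fps_X\<^sup>2 * H1) * (fps_const W * fps_X * (fps_const W * fps_X))))"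
    using dd unfolding nf_fps_def by (simp add: b b2 b3)
  have lhs: "fps_vderiv (\<lambda>s. fps_X\<^sup>2 * H s) (fps_X\<^sup>2 * H1)"
    using fps_vderiv_mult[OF fps_vderiv_const[of "fps_X\<^sup>2"] H] by simp
  have E: "fps_X\<^sup>2 * H1 = 1 * (fps_const Z * fps_X * wfps (D 1) W (H 0) + wfps (D 0) Z (H 0) * (fps_const W * fps_X)) + wfps (D 2) 0 (H 0) * (fps_const Z * fps_X * (fps_const W * fps_X)) +
     (G * (fps_const Z * fps_X * wfps (D 0) Z (H 0) + wfps (D 0) Z (H 0) * (fps_const Z * fps_X)) + (wfps (D 3) 0 (H 0) + fps_X\<^sup>2 * H1) * (fps_const Z * fps_X * (fps_const Z * fps_X))) +
     (G * (fps_const W * fps_X * wfps (D 1) W (H 0) + wfps (D 1) W (H 0) * (fps_const W * fps_X)) + (wfps (D 4) 0 (H 0) + fps_X\<^sup>2 * H1) * (fps_const W * fps_X * (fps_const W * fps_X)))"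
    by (rule fps_vderiv_unique[OF lhs]) (simp only: eq rhs)
  show ?thesis by (rule trans[OF E]) (simp add: algebra_simps power2_eq_square)
qed

subsection \<open>The family of surfaces\<close>

definition h0 :: "complex \<Rightarrow> complex \<Rightarrow> complex \<Rightarrow> complex" where
  "h0 g z w = (z * w + g * (z\<^sup>2 + w\<^sup>2)) / (1 - (z\<^sup>2 + w\<^sup>2))"

text \<open>What remains of the perturbation on a level conic. Both summands have a pole where a
  coordinate is 1 or -1 and real part at least -1/2 while the coordinates lie in the open unit disc,
  so the pole cannot be cancelled by other points of an orbit.\<close>

definition res :: "complex \<Rightarrow> complex \<Rightarrow> complex" where
  "res z w = z\<^sup>2 / (1 - z\<^sup>2) + w\<^sup>2 / (1 - w\<^sup>2)"

text \<open>The first two factors are the partial derivatives of the conic of level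
  \<open>t = h0 g z w\<close>. Collecting the terms with \<open>pert\<close> in the linearized
  equation gives \<open>pert * (1 - (z^2 + w^2))\<close>, and division by the two derivatives then
  leaves exactly \<open>res\<close>.\<close>

definition pert :: "complex \<Rightarrow> complex \<Rightarrow> complex \<Rightarrow> complex" where
  "pert g z w = (w + 2 * (g + h0 g z w) * z) * (z + 2 * (g + h0 g z w) * w) * res z w / (1 - (z\<^sup>2 + w\<^sup>2))"

definition hs :: "complex \<Rightarrow> real \<Rightarrow> complex \<Rightarrow> complex \<Rightarrow> complex" where
  "hs g s z w = h0 g z w + of_real s * pert g z w"

definition nf_val :: "(nat \<Rightarrow> nat \<Rightarrow> nat \<Rightarrow> complex) \<Rightarrow> complex \<Rightarrow> complex \<Rightarrow> complex \<Rightarrow> complex" where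
  "nf_val X z w t = wsum (X 2) 0 t * (wsum (X 0) z t * wsum (X 1) w t)
     + wsum (X 3) 0 t * (wsum (X 0) z t * wsum (X 0) z t) + wsum (X 4) 0 t * (wsum (X 1) w t * wsum (X 1) w t)"

definition is_nf :: "complex \<Rightarrow> (complex \<Rightarrow> complex \<Rightarrow> complex) \<Rightarrow> (nat \<Rightarrow> nat \<Rightarrow> nat \<Rightarrow> complex) \<Rightarrow> bool" where
  "is_nf g h X \<longleftrightarrow> normalized g X \<and> (\<exists>M K. \<forall>i<5. geo_bound (X i) M K) \<and>
     (\<exists>\<rho>>0. \<forall>z w. norm z < \<rho> \<longrightarrow> norm w < \<rho> \<longrightarrow> h z w = nf_val X z w (h z w))"

lemma nf_val_fps:
  assumes "\<And>i. i < 5 \<Longrightarrow> geo_bound (X i) M K" "h has_fps_expansion H"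
  shows "(\<lambda>x. nf_val X (x * Z) (x * W) (x\<^sup>2 * h x)) has_fps_expansion nf_fps X Z W H"
proof -
  have *: "(\<lambda>x. wsum (X i) (x * Y) (x\<^sup>2 * h x)) has_fps_expansion wfps (X i) Y H" if "i < 5" for i Y
    by (rule wsum_fps[OF assms(1)[OF that] assms(2)])
  have **: "(\<lambda>x. wsum (X i) 0 (x\<^sup>2 * h x)) has_fps_expansion wfps (X i) 0 H" if "i < 5" for i
    using *[OF that, of 0] by simp
  show ?thesis unfolding nf_val_def nf_fps_def by (intro fps_expansion_intros * **) auto
qed

lemma eventually_norm_scaled_less:
  fixes Z :: complex
  assumes "\<rho> > 0"
  shows "\<forall>\<^sub>F x in nhds 0. norm (x * Z) < \<rho>"
proof -
  have "((\<lambda>x. norm (x * Z)) \<longlongrightarrow> norm (0 * Z)) (nhds 0)" by (intro tendsto_intros filterlim_ident)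
  then show ?thesis by (rule order_tendstoD(2)) (use assms in simp)
qed

lemma nf_val_imp_fps:
  assumes MK: "\<And>i. i < 5 \<Longrightarrow> geo_bound (X i) M K"
    and \<rho>: "\<rho> > 0" "\<And>z w. norm z < \<rho> \<Longrightarrow> norm w < \<rho> \<Longrightarrow> h z w = nf_val X z w (h z w)"
    and h: "\<And>x. h (x * Z) (x * W) = x\<^sup>2 * hh x" and H: "hh has_fps_expansion H"
  shows "fps_X\<^sup>2 * H = nf_fps X Z W H"
proof -
  have "\<forall>\<^sub>F x in nhds 0. norm (x * Z) < \<rho>" "\<forall>\<^sub>F x in nhds 0. norm (x * W) < \<rho>"
    by (rule eventually_norm_scaled_less[OF \<rho>(1)])+
  then have ev: "\<forall>\<^sub>F x in nhds 0. x\<^sup>2 * hh x = nf_val X (x * Z) (x * W) (x\<^sup>2 * hh x)"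
    by eventually_elim (use \<rho>(2) h in metis)
  have 1: "(\<lambda>x. x\<^sup>2 * hh x) has_fps_expansion fps_X\<^sup>2 * H" by (intro fps_expansion_intros H)
  have 2: "(\<lambda>x. nf_val X (x * Z) (x * W) (x\<^sup>2 * hh x)) has_fps_expansion nf_fps X Z W H"
    by (rule nf_val_fps[OF MK H])
  have "(\<lambda>x. x\<^sup>2 * hh x) has_fps_expansion nf_fps X Z W H"
    by (subst has_fps_expansion_cong[OF ev refl]) (rule 2)
  then show ?thesis using 1 fps_expansion_unique_complex by blast
qed

lemma is_nf_fps:
  assumes nf: "is_nf g h X" and h: "\<And>x. h (x * Z) (x * W) = x\<^sup>2 * hh x" and H: "hh has_fps_expansion H"
  shows "fps_X\<^sup>2 * H = nf_fps X Z W H"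
proof -
  obtain M K where MK: "\<And>i. i < 5 \<Longrightarrow> geo_bound (X i) M K" using nf unfolding is_nf_def by blast
  obtain \<rho> where \<rho>: "\<rho> > 0" "\<And>z w. norm z < \<rho> \<Longrightarrow> norm w < \<rho> \<Longrightarrow> h z w = nf_val X z w (h z w)"
    using nf unfolding is_nf_def by blast
  show ?thesis by (rule nf_val_imp_fps[OF MK \<rho> h H])
qed

lemma wsum_low_entries:
  assumes "\<And>j k. (j, k) \<notin> {(0, 0), (1, 0), (0, 1)} \<Longrightarrow> C j k = 0"
  shows "wsum C z t = C 0 0 + C 1 0 * z + C 0 1 * t"
proof -
  have "wpoly C m z t = 0" if "m \<ge> 3" for m
    unfolding wpoly_def
  proof (rule sum.neutral, rule ballI)
    fix k assume "k \<in> {..m div 2}"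
    then have "(m - 2 * k) + 2 * k = m" by auto
    then have "(m - 2 * k, k) \<notin> {(0, 0), (1, 0), (0, 1)}" using that by auto
    then have "C (m - 2 * k) k = 0" by (rule assms)
    then show "C (m - 2 * k) k * z ^ (m - 2 * k) * t ^ k = 0" by simp
  qed
  then have "(\<lambda>m. wpoly C m z t) sums (\<Sum>m\<in>{0,1,2}. wpoly C m z t)"
    by (intro sums_finite) (auto simp: numeral_3_eq_3 numeral_2_eq_2 not_less_eq_eq le_Suc_eq)
  moreover have "wpoly C 2 z t = C 0 1 * t"
  proof -
    have "{..2 div 2 :: nat} = {0, 1}" by auto
    then show ?thesis using assms[of 2 0] by (simp add: wpoly_def)
  qed
  ultimately show ?thesis unfolding wsum_def by (simp add: sums_iff wpoly_def[of C 0] wpoly_def[of C "Suc 0"])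
qed

lemma base_is_nf: "is_nf g (h0 g) (base_nf g)"
  unfolding is_nf_def
proof (intro conjI)
  show "normalized g (base_nf g)" by (auto simp: normalized_def base_nf_def)
  have "geo_bound (base_nf g i) (1 + norm g) 1" for i
    by (auto simp: geo_bound_def base_nf_def add_pos_nonneg)
  then show "\<exists>M K. \<forall>i<5. geo_bound (base_nf g i) M K" by blast
  have "h0 g z w = nf_val (base_nf g) z w (h0 g z w)" if "norm z < 1/2" "norm w < 1/2" for z w
  proof -
    have b: "wsum (base_nf g 0) Y t = Y" "wsum (base_nf g 1) Y t = Y" "wsum (base_nf g 2) 0 t = 1"
      "wsum (base_nf g 3) 0 t = g + t" "wsum (base_nf g 4) 0 t = g + t" for Y t
      by (subst wsum_low_entries; auto simp: base_nf_def)+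
    have "norm (z\<^sup>2 + w\<^sup>2) \<le> (norm z)\<^sup>2 + (norm w)\<^sup>2" by (metis norm_power norm_triangle_ineq)
    also have "\<dots> < (1/2)\<^sup>2 + (1/2)\<^sup>2" using that by (intro add_strict_mono power_strict_mono) auto
    finally have "1 - (z\<^sup>2 + w\<^sup>2) \<noteq> 0" by (auto simp: power2_eq_square)
    then have "h0 g z w * (1 - (z\<^sup>2 + w\<^sup>2)) = z * w + g * (z\<^sup>2 + w\<^sup>2)" by (simp add: h0_def)
    then show ?thesis unfolding nf_val_def b by (simp add: algebra_simps power2_eq_square)
  qed
  then show "\<exists>\<rho>>0. \<forall>z w. norm z < \<rho> \<longrightarrow> norm w < \<rho> \<longrightarrow> h0 g z w = nf_val (base_nf g) z w (h0 g z w)"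
    by (intro exI[of _ "1/2"]) auto
qed

section \<open>Restriction to complex lines through the origin, with the factor \<open>x^2\<close>
  removed\<close>

definition h0r :: "complex \<Rightarrow> complex \<Rightarrow> complex \<Rightarrow> complex \<Rightarrow> complex" where
  "h0r g Z W x = (Z * W + g * (Z\<^sup>2 + W\<^sup>2)) / (1 - x\<^sup>2 * (Z\<^sup>2 + W\<^sup>2))"

text \<open>A further factor \<open>x^2\<close> remains because \<open>pert\<close> vanishes to
  order four. The constant term of the reduced series of \<open>hs\<close> is therefore independent
  of s, as polynomial dependence of degree 0 at index 0 requires.\<close>

definition pertr :: "complex \<Rightarrow> complex \<Rightarrow> complex \<Rightarrow> complex \<Rightarrow> complex" where
  "pertr g Z W x = x\<^sup>2 * ((W + 2 * (g + x\<^sup>2 * h0r g Z W x) * Z) * (Z + 2 * (g + x\<^sup>2 * h0r g Z W x) * W)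
     * (Z\<^sup>2 / (1 - x\<^sup>2 * Z\<^sup>2) + W\<^sup>2 / (1 - x\<^sup>2 * W\<^sup>2)) / (1 - x\<^sup>2 * (Z\<^sup>2 + W\<^sup>2)))"

lemma h0_scale: "h0 g (x * Z) (x * W) = x\<^sup>2 * h0r g Z W x"
proof -
  have "(x * Z) * (x * W) + g * ((x * Z)\<^sup>2 + (x * W)\<^sup>2) = x\<^sup>2 * (Z * W + g * (Z\<^sup>2 + W\<^sup>2))"
    "(x * Z)\<^sup>2 + (x * W)\<^sup>2 = x\<^sup>2 * (Z\<^sup>2 + W\<^sup>2)"
    by (simp_all add: algebra_simps power2_eq_square)
  then show ?thesis unfolding h0_def h0r_def by simp
qed

lemma pert_scale: "pert g (x * Z) (x * W) = x\<^sup>2 * pertr g Z W x"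
proof -
  define a where "a = g + x\<^sup>2 * h0r g Z W x"
  have 1: "x * W + 2 * a * (x * Z) = x * (W + 2 * a * Z)" "x * Z + 2 * a * (x * W) = x * (Z + 2 * a * W)"
    by (simp_all add: algebra_simps)
  have 2: "res (x * Z) (x * W) = x\<^sup>2 * (Z\<^sup>2 / (1 - x\<^sup>2 * Z\<^sup>2) + W\<^sup>2 / (1 - x\<^sup>2 * W\<^sup>2))"
    by (simp add: res_def power_mult_distrib distrib_left)
  have 3: "(x * Z)\<^sup>2 + (x * W)\<^sup>2 = x\<^sup>2 * (Z\<^sup>2 + W\<^sup>2)" by (simp add: algebra_simps power2_eq_square)
  show ?thesis unfolding pert_def h0_scale pertr_def a_def[symmetric] 1 2 3
    by (simp add: power2_eq_square)
qed

lemma reduced_fps: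
  obtains H0 H1 where "h0r g Z W has_fps_expansion H0" "pertr g Z W has_fps_expansion H1"
    "fps_nth H0 0 = Z * W + g * (Z\<^sup>2 + W\<^sup>2)" "fps_nth H1 0 = 0"
proof -
  have d: "\<exists>F. (\<lambda>x. 1 - x\<^sup>2 * a) has_fps_expansion F \<and> fps_nth F 0 = 1" for a :: complex
    by (rule exI[of _ "1 - fps_X\<^sup>2 * fps_const a"]) (auto intro!: fps_expansion_intros)
  have q: "\<exists>G. (\<lambda>x. f x / (1 - x\<^sup>2 * a)) has_fps_expansion G" if "f has_fps_expansion F" for f F and a :: complex
    using d[of a] that by (metis has_fps_expansion_divide' zero_neq_one)
  obtain H0 where H0: "h0r g Z W has_fps_expansion H0"
    using q[OF has_fps_expansion_const, of "Z * W + g * (Z\<^sup>2 + W\<^sup>2)" "Z\<^sup>2 + W\<^sup>2"] unfolding h0r_def[abs_def] by blast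
  obtain A B where AB: "(\<lambda>x. Z\<^sup>2 / (1 - x\<^sup>2 * Z\<^sup>2)) has_fps_expansion A" "(\<lambda>x. W\<^sup>2 / (1 - x\<^sup>2 * W\<^sup>2)) has_fps_expansion B"
    using q[OF has_fps_expansion_const] by metis
  have "(\<lambda>x. (W + 2 * (g + x\<^sup>2 * h0r g Z W x) * Z) * (Z + 2 * (g + x\<^sup>2 * h0r g Z W x) * W)
     * (Z\<^sup>2 / (1 - x\<^sup>2 * Z\<^sup>2) + W\<^sup>2 / (1 - x\<^sup>2 * W\<^sup>2))) has_fps_expansion
     (fps_const W + 2 * (fps_const g + fps_X\<^sup>2 * H0) * fps_const Z) * (fps_const Z + 2 * (fps_const g + fps_X\<^sup>2 * H0) * fps_const W) * (A + B)"
    by (intro fps_expansion_intros H0 AB)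
  from q[OF this, of "Z\<^sup>2 + W\<^sup>2"] have "\<exists>F. (\<lambda>x. (W + 2 * (g + x\<^sup>2 * h0r g Z W x) * Z) * (Z + 2 * (g + x\<^sup>2 * h0r g Z W x) * W)
     * (Z\<^sup>2 / (1 - x\<^sup>2 * Z\<^sup>2) + W\<^sup>2 / (1 - x\<^sup>2 * W\<^sup>2)) / (1 - x\<^sup>2 * (Z\<^sup>2 + W\<^sup>2))) has_fps_expansion F" .
  then obtain F where "(\<lambda>x. (W + 2 * (g + x\<^sup>2 * h0r g Z W x) * Z) * (Z + 2 * (g + x\<^sup>2 * h0r g Z W x) * W)
     * (Z\<^sup>2 / (1 - x\<^sup>2 * Z\<^sup>2) + W\<^sup>2 / (1 - x\<^sup>2 * W\<^sup>2)) / (1 - x\<^sup>2 * (Z\<^sup>2 + W\<^sup>2))) has_fps_expansion F" by blast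
  then have H1: "pertr g Z W has_fps_expansion fps_X\<^sup>2 * F"
    unfolding pertr_def[abs_def] by (intro fps_expansion_intros)
  have "h0r g Z W 0 = fps_nth H0 0" using has_fps_expansion_imp_0_eq_fps_nth_0[OF H0] .
  then have "fps_nth H0 0 = Z * W + g * (Z\<^sup>2 + W\<^sup>2)" by (simp add: h0r_def)
  then show ?thesis by (intro that[OF H0 H1]) simp_all
qed

lemma h0_bound:
  assumes "norm z \<le> r" "norm w \<le> r" "r \<le> 1/4"
  shows "norm (h0 g z w) \<le> 2 * (1 + 2 * norm g) * r\<^sup>2" "z\<^sup>2 \<noteq> 1" "w\<^sup>2 \<noteq> 1" "z\<^sup>2 + w\<^sup>2 \<noteq> 1"
proof -
  have r: "r \<ge> 0" using assms(1) norm_ge_zero[of z] by linarith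
  have z: "norm (z\<^sup>2) \<le> r\<^sup>2" "norm (w\<^sup>2) \<le> r\<^sup>2" "norm (z * w) \<le> r\<^sup>2"
    unfolding norm_power norm_mult power2_eq_square using assms r by (auto intro!: mult_mono)
  have r2: "r\<^sup>2 \<le> (1/4)\<^sup>2" using assms r by (intro power_mono)
  then have r2': "r\<^sup>2 \<le> 1/16" by (simp add: power2_eq_square)
  have zw: "norm (z\<^sup>2 + w\<^sup>2) \<le> r\<^sup>2 + r\<^sup>2" using z by (intro norm_triangle_le) linarith
  show "z\<^sup>2 \<noteq> 1" "w\<^sup>2 \<noteq> 1" "z\<^sup>2 + w\<^sup>2 \<noteq> 1" using z zw r2' by auto
  have "norm (1 - (z\<^sup>2 + w\<^sup>2)) \<ge> norm (1::complex) - norm (z\<^sup>2 + w\<^sup>2)" by (rule norm_triangle_ineq2)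
  then have d: "norm (1 - (z\<^sup>2 + w\<^sup>2)) \<ge> 1/2" using zw r2' by simp
  have "norm (g * (z\<^sup>2 + w\<^sup>2)) \<le> norm g * (r\<^sup>2 + r\<^sup>2)" unfolding norm_mult by (intro mult_left_mono zw) auto
  then have "norm (z * w + g * (z\<^sup>2 + w\<^sup>2)) \<le> r\<^sup>2 + norm g * (r\<^sup>2 + r\<^sup>2)" using z(3) by (intro norm_triangle_le) linarith
  then have n: "norm (z * w + g * (z\<^sup>2 + w\<^sup>2)) \<le> (1 + 2 * norm g) * r\<^sup>2" by (simp add: algebra_simps)
  have "norm (h0 g z w) \<le> (1 + 2 * norm g) * r\<^sup>2 / (1/2)"
    unfolding h0_def norm_divide using n d by (intro frac_le) auto
  also have "\<dots> = 2 * (1 + 2 * norm g) * r\<^sup>2" by (simp add: field_simps)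
  finally show "norm (h0 g z w) \<le> 2 * (1 + 2 * norm g) * r\<^sup>2" .
qed

lemma hs_reduced_fps:
  obtains H where "(\<lambda>x. h0r g Z W x + of_real s * pertr g Z W x) has_fps_expansion H"
    "fps_nth H 0 = Z * W + g * (Z\<^sup>2 + W\<^sup>2)"
proof -
  obtain H0 H1 where H: "h0r g Z W has_fps_expansion H0" "pertr g Z W has_fps_expansion H1"
    "fps_nth H0 0 = Z * W + g * (Z\<^sup>2 + W\<^sup>2)" "fps_nth H1 0 = 0"
    by (rule reduced_fps) (rule that)
  have "(\<lambda>x. h0r g Z W x + of_real s * pertr g Z W x) has_fps_expansion H0 + fps_const (of_real s) * H1"
    by (intro fps_expansion_intros H)
  then show ?thesis by (rule that) (simp add: H)
qed

lemma hs_scale: "hs g s (x * Z) (x * W) = x\<^sup>2 * (h0r g Z W x + of_real s * pertr g Z W x)"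
  unfolding hs_def h0_scale pert_scale by (simp add: algebra_simps)

context conic
begin

lemma linearized_equation:
  assumes ex: "\<And>s. \<exists>X. is_nf g (hs g s) X"
  obtains D :: "nat \<Rightarrow> nat \<Rightarrow> nat \<Rightarrow> complex" and \<rho> where "\<rho> > 0"
    "\<And>z w. norm z < \<rho> \<Longrightarrow> norm w < \<rho> \<Longrightarrow>
      (let t = h0 g z w in pert g z w = wsum (D 2) 0 t * (z * w)
        + (wsum (D 0) z t * w + z * wsum (D 1) w t)
        + (wsum (D 3) 0 t + pert g z w) * z\<^sup>2 + 2 * (g + t) * z * wsum (D 0) z t
        + (wsum (D 4) 0 t + pert g z w) * w\<^sup>2 + 2 * (g + t) * w * wsum (D 1) w t)"
proof -
  obtain X' where X': "\<And>s. is_nf g (hs g s) (X' s)" using ex by metis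
  \<comment> \<open>The choice is arbitrary except at 0, where the derivative is to be taken around
    the explicit solution.\<close>
  define X where "X = (\<lambda>s::real. if s = 0 then base_nf g else X' s)"
  have X: "is_nf g (hs g s) (X s)" for s
  proof (cases "s = 0")
    case True
    have "hs g 0 = h0 g" by (intro ext) (simp add: hs_def)
    then show ?thesis using True base_is_nf by (simp add: X_def)
  qed (simp add: X_def X')
  have "\<forall>Z W. \<exists>H0 H1. h0r g Z W has_fps_expansion H0 \<and> pertr g Z W has_fps_expansion H1 \<and>
    fps_nth H0 0 = Z * W + g * (Z\<^sup>2 + W\<^sup>2) \<and> fps_nth H1 0 = 0"
    using reduced_fps by metis
  then obtain H0 H1 where H01: "\<And>Z W. h0r g Z W has_fps_expansion H0 Z W" "\<And>Z W. pertr g Z W has_fps_expansion H1 Z W"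
    "\<And>Z W. fps_nth (H0 Z W) 0 = Z * W + g * (Z\<^sup>2 + W\<^sup>2)" "\<And>Z W. fps_nth (H1 Z W) 0 = 0"
    by metis
  define H where "H = (\<lambda>s Z W. H0 Z W + fps_const (complex_of_real s) * H1 Z W)"
  have Hx: "(\<lambda>x. h0r g Z W x + of_real s * pertr g Z W x) has_fps_expansion H s Z W" for s Z W
    unfolding H_def by (intro fps_expansion_intros H01)
  have eq: "fps_X\<^sup>2 * H s Z W = nf_fps (X s) Z W (H s Z W)" for s Z W
    by (rule is_nf_fps[OF X _ Hx]) (simp add: hs_def h0_scale pert_scale algebra_simps)
  have norm: "normalized g (X s)" for s using X[of s] by (simp add: is_nf_def)
  have Hp: "pfam 0 (\<lambda>s. H s Z W)" for Z W
  proof -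
    have "pdeg n (\<lambda>s. fps_nth (H s Z W) n)" for n
    proof (cases n)
      case 0 then show ?thesis by (simp add: H_def H01 pdeg_const)
    next
      case (Suc m)
      have "pdeg n (\<lambda>s. fps_nth (H0 Z W) n + complex_of_real s * fps_nth (H1 Z W) n)"
        by (intro pdeg_add pdeg_const pdeg_cmult_right pdeg_of_real) (simp add: Suc)
      then show ?thesis by (simp add: H_def)
    qed
    then show ?thesis by (simp add: pfam_def)
  qed
  have H00: "fps_nth (H s Z W) 0 = Z * W + g * (Z\<^sup>2 + W\<^sup>2)" for s Z W by (simp add: H_def H01)
  note poly = normalization_polynomial[OF norm Hp H00 eq]
  have pd: "pdeg (j + 2 * k) (\<lambda>s. X s i j k)" if "i < 5" for i j k
  proof (cases "i < 2")
    case True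
    have "pdeg (j + 2 * k - 1) (\<lambda>s. X s i j k)" using poly[of "j + 2 * k"] True by blast
    then show ?thesis by (rule pdeg_mono) simp
  next
    case False
    then have "i \<in> {2,3,4}" using that by auto
    then have "pdeg (j + 2 * k + 1 - 1) (\<lambda>s. X s i j k)" using poly[of "j + 2 * k + 1"] by blast
    then show ?thesis by simp
  qed
  \<comment> \<open>One integer serves for both constants of \<open>geo_bound\<close>, so countably
    many closed sets cover the line; the exponent exceeds the weight by one to absorb the constant
    factor.\<close>
  define E where "E = (\<lambda>n. {s. \<forall>i<5. \<forall>j k. norm (X s i j k) \<le> real (Suc n) ^ (j + 2 * k + 1)})"
  have "closed (E n)" for n
  proof -
    have "E n = (\<Inter>i\<in>{..<5}. \<Inter>j. \<Inter>k. {s. norm (X s i j k) \<le> real (Suc n) ^ (j + 2 * k + 1)})" by (auto simp: E_def)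
    moreover have "closed {s. norm (X s i j k) \<le> real (Suc n) ^ (j + 2 * k + 1)}" if "i < 5" for i j k
      by (intro closed_Collect_le continuous_on_norm pdeg_continuous_on[OF pd] continuous_on_const that)
    ultimately show ?thesis by (simp only:) (intro closed_INT ballI; simp)
  qed
  moreover have "\<exists>n. s \<in> E n" for s
  proof -
    obtain M K where MK: "\<And>i. i < 5 \<Longrightarrow> geo_bound (X s i) M K" using X[of s] unfolding is_nf_def by blast
    then have pos: "M > 0" "K > 0" using MK[of 0] by (auto simp: geo_bound_def)
    obtain n where n: "max M K \<le> real n" using real_arch_simple by blast
    have "norm (X s i j k) \<le> real (Suc n) ^ (j + 2 * k + 1)" if "i < 5" for i j k
    proof -
      have "norm (X s i j k) \<le> M * K ^ (j + 2 * k)" using MK[OF that] by (simp add: geo_bound_def)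
      also have "\<dots> \<le> real (Suc n) * real (Suc n) ^ (j + 2 * k)"
        using n pos by (intro mult_mono power_mono) auto
      finally show ?thesis by simp
    qed
    then show ?thesis by (auto simp: E_def)
  qed
  \<comment> \<open>The only information on convergence that is uniform in s, and it concerns an
    interval of unknown position; the polynomial dependence transports it to the derivative at
    0.\<close>
  ultimately obtain n \<alpha> \<beta> where ab: "\<alpha> < \<beta>" "{\<alpha>..\<beta>} \<subseteq> E n" using Baire_real_interval by metis
  obtain C where C: "C > 0" "\<And>n f B. pdeg n f \<Longrightarrow> (\<And>s. \<alpha> \<le> s \<Longrightarrow> s \<le> \<beta> \<Longrightarrow> norm (f s) \<le> B) \<Longrightarrow>
     \<exists>D. (f has_vector_derivative D) (at 0) \<and> norm D \<le> B * C ^ n"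
    using pdeg_derivative_bound[OF ab(1)] by metis
  define D where "D = (\<lambda>i j k. vector_derivative (\<lambda>s. X s i j k) (at 0))"
  have D: "((\<lambda>s. X s i j k) has_vector_derivative D i j k) (at 0) \<and> norm (D i j k) \<le> real (Suc n) ^ (j + 2 * k + 1) * C ^ (j + 2 * k)"
    if "i < 5" for i j k
  proof -
    have "norm (X s i j k) \<le> real (Suc n) ^ (j + 2 * k + 1)" if "\<alpha> \<le> s" "s \<le> \<beta>" for s
      using ab(2) that \<open>i < 5\<close> by (auto simp: E_def)
    from C(2)[OF pd[OF that] this] show ?thesis unfolding D_def by (metis vector_derivative_at)
  qed
  define M K where "M = real (Suc n)" and "K = real (Suc n) * C"
  have gD: "geo_bound (D i) M K" if "i < 5" for i
    using D[OF that] C(1) by (auto simp: geo_bound_def M_def K_def power_mult_distrib mult_ac)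
  have K: "K > 0" using C(1) by (simp add: K_def)
  have lin: "fps_X\<^sup>2 * H1 Z W = wfps (D 2) 0 (H0 Z W) * (fps_const Z * fps_X * (fps_const W * fps_X))
     + (wfps (D 0) Z (H0 Z W) * (fps_const W * fps_X) + fps_const Z * fps_X * wfps (D 1) W (H0 Z W))
     + (wfps (D 3) 0 (H0 Z W) + fps_X\<^sup>2 * H1 Z W) * (fps_const Z * fps_X)\<^sup>2 + 2 * (fps_const g + fps_X\<^sup>2 * H0 Z W) * (fps_const Z * fps_X) * wfps (D 0) Z (H0 Z W)
     + (wfps (D 4) 0 (H0 Z W) + fps_X\<^sup>2 * H1 Z W) * (fps_const W * fps_X)\<^sup>2 + 2 * (fps_const g + fps_X\<^sup>2 * H0 Z W) * (fps_const W * fps_X) * wfps (D 1) W (H0 Z W)" for Z W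
  proof -
    have H0': "H 0 Z W = H0 Z W" by (simp add: H_def)
    have "fps_vderiv (\<lambda>s. H s Z W) (H1 Z W)"
      unfolding fps_vderiv_def H_def by (auto intro!: derivative_eq_intros)
    from linearized_normalization[OF this eq _ conjunct1[OF D]] show ?thesis
      by (simp add: X_def H0')
  qed
  define A where "A = 2 * (1 + 2 * norm g)"
  have A: "A > 0" by (simp add: A_def add_pos_nonneg)
  \<comment> \<open>For \<open>norm x < 2\<close> the point \<open>(x * z, x * w)\<close> has
    coordinates of norm at most \<open>r = 2 * \<rho>\<close>, and t has norm at most
    \<open>A * r^2\<close>; the choice makes the geometric ratio of all the series at most
    1/2.\<close>
  define \<rho> where "\<rho> = min (1/8) (1 / (4 * K * (A + 1)))"
  have \<rho>: "\<rho> > 0" using K A by (simp add: \<rho>_def)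
  define r where "r = 2 * \<rho>"
  have r: "r > 0" "r \<le> 1/4" using \<rho> by (auto simp: r_def \<rho>_def)
  have rKA: "r * K * (A + 1) \<le> 1/2"
  proof -
    define c where "c = K * (A + 1)"
    have c: "c > 0" using K A by (simp add: c_def)
    have "r * c \<le> 2 * (1 / (4 * c)) * c"
      unfolding r_def \<rho>_def using c by (intro mult_right_mono mult_left_mono) (auto simp: c_def mult.assoc)
    also have "\<dots> = 1/2" using c by simp
    finally have "r * (K * (A + 1)) \<le> 1/2" by (simp add: c_def)
    then show ?thesis by (simp add: mult.assoc)
  qed
  have rK: "r * K \<le> 1/2" using rKA A r K by (smt (verit) mult_pos_pos mult_le_cancel_left1 mult.commute)
  have AK: "A * r\<^sup>2 * K\<^sup>2 \<le> (1/2)\<^sup>2"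
  proof -
    have "A * r\<^sup>2 * K\<^sup>2 \<le> (A + 1)\<^sup>2 * r\<^sup>2 * K\<^sup>2"
      using A by (intro mult_right_mono) (auto simp: power2_eq_square algebra_simps)
    also have "\<dots> = (r * K * (A + 1))\<^sup>2" by (simp add: power_mult_distrib mult_ac)
    also have "\<dots> \<le> (1/2)\<^sup>2" using rKA r K A by (intro power_mono) auto
    finally show ?thesis .
  qed
  show ?thesis
  proof (rule that[OF \<rho>])
    fix z w :: complex assume zw: "norm z < \<rho>" "norm w < \<rho>"
    \<comment> \<open>The expansions at \<open>x = 0\<close> agree formally; as the disc contains 1,
      analytic continuation in x gives the identity at (z, w) itself.\<close>
    define S where "S = ball (0::complex) 2"
    have b: "norm (x * z) \<le> r" "norm (x * w) \<le> r" if "x \<in> S" for x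
      unfolding norm_mult r_def using that zw by (auto simp: S_def intro!: mult_mono)
    define t where "t = (\<lambda>x. h0 g (x * z) (x * w))"
    define P where "P = (\<lambda>x. pert g (x * z) (x * w))"
    note nz = h0_bound(2-4)[OF b r(2)]
    have nz': "1 - (x * z)\<^sup>2 \<noteq> 0" "1 - (x * w)\<^sup>2 \<noteq> 0" "1 - ((x * z)\<^sup>2 + (x * w)\<^sup>2) \<noteq> 0" if "x \<in> S" for x
      using nz[OF that that] by auto
    have th: "t holomorphic_on S" unfolding t_def h0_def using nz' by (intro holomorphic_intros) auto
    have Ph: "P holomorphic_on S"
      unfolding P_def pert_def res_def t_def[symmetric, THEN fun_cong] using nz' th
      by (intro holomorphic_intros) auto
    have tb: "norm (t x) * K\<^sup>2 \<le> (1/2)\<^sup>2" if "x \<in> S" for x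
    proof -
      have "norm (t x) * K\<^sup>2 \<le> A * r\<^sup>2 * K\<^sup>2"
        unfolding t_def A_def by (intro mult_right_mono h0_bound(1)[OF b[OF that] r(2)]) auto
      then show ?thesis using AK by linarith
    qed
    have zb: "norm (x * z) * K \<le> 1/2" "norm (x * w) * K \<le> 1/2" "norm (0::complex) * K \<le> 1/2" if "x \<in> S" for x
    proof -
      have "norm (x * z) * K \<le> r * K" "norm (x * w) * K \<le> r * K" using b[OF that] K by (auto intro!: mult_right_mono)
      then show "norm (x * z) * K \<le> 1/2" "norm (x * w) * K \<le> 1/2" using rK by linarith+
    qed simp
    have op: "open S" by (simp add: S_def)
    have wh: "(\<lambda>x. wsum (D i) (x * z) (t x)) holomorphic_on S" "(\<lambda>x. wsum (D i) (x * w) (t x)) holomorphic_on S"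
      "(\<lambda>x. wsum (D i) 0 (t x)) holomorphic_on S" if "i < 5" for i
      by (rule wsum_holomorphic[OF gD[OF that] op _ th zb(1) tb] wsum_holomorphic[OF gD[OF that] op _ th zb(2) tb]
            wsum_holomorphic[OF gD[OF that] op _ th zb(3) tb]; (intro holomorphic_intros | simp))+
    define N where "N = (\<lambda>x. wsum (D 2) 0 (t x) * (z * x * (w * x))
        + (wsum (D 0) (x * z) (t x) * (w * x) + z * x * wsum (D 1) (x * w) (t x))
        + (wsum (D 3) 0 (t x) + P x) * (z * x)\<^sup>2 + 2 * (g + t x) * (z * x) * wsum (D 0) (x * z) (t x)
        + (wsum (D 4) 0 (t x) + P x) * (w * x)\<^sup>2 + 2 * (g + t x) * (w * x) * wsum (D 1) (x * w) (t x))"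
    have tx: "t = (\<lambda>x. x\<^sup>2 * h0r g z w x)" and Px: "P = (\<lambda>x. x\<^sup>2 * pertr g z w x)"
      by (simp_all add: t_def P_def h0_scale pert_scale)
    have tf: "t has_fps_expansion fps_X\<^sup>2 * H0 z w" and Pf: "P has_fps_expansion fps_X\<^sup>2 * H1 z w"
      unfolding tx Px by (intro fps_expansion_intros H01)+
    have wf: "(\<lambda>x. wsum (D i) (x * y) (t x)) has_fps_expansion wfps (D i) y (H0 z w)" if "i < 5" for i y
      unfolding tx by (rule wsum_fps[OF gD[OF that] H01(1)])
    have wf0: "(\<lambda>x. wsum (D i) 0 (t x)) has_fps_expansion wfps (D i) 0 (H0 z w)" if "i < 5" for i
      using wf[OF that, of 0] by simp
    have "N has_fps_expansion fps_X\<^sup>2 * H1 z w"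
      unfolding N_def by (subst lin) (intro fps_expansion_intros wf wf0 tf Pf; simp)
    then have "(\<lambda>x. P x - N x) has_fps_expansion fps_X\<^sup>2 * H1 z w - fps_X\<^sup>2 * H1 z w"
      by (intro has_fps_expansion_diff Pf)
    then have 0: "(\<lambda>x. P x - N x) has_fps_expansion 0" by simp
    have "(\<lambda>x. P x - N x) holomorphic_on S"
      unfolding N_def by (intro holomorphic_intros Ph wh th) auto
    from has_fps_expansion_0_analytic_continuation[OF 0 this op, of 1] have "P 1 = N 1"
      by (simp add: S_def)
    then show "let t = h0 g z w in pert g z w = wsum (D 2) 0 t * (z * w)
        + (wsum (D 0) z t * w + z * wsum (D 1) w t)
        + (wsum (D 3) 0 t + pert g z w) * z\<^sup>2 + 2 * (g + t) * z * wsum (D 0) z t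
        + (wsum (D 4) 0 t + pert g z w) * w\<^sup>2 + 2 * (g + t) * w * wsum (D 1) w t"
      by (simp add: N_def P_def t_def Let_def)
  qed
qed

end

subsection \<open>Unsolvability of the linearized equation\<close>

text \<open>For \<open>l = cis \<theta>\<close> the root equation reads
  \<open>2 (\<gamma> + t) cos \<theta> = 1\<close>. Taking for \<open>\<theta>\<close> a rational
  multiple of pi slightly above \<open>arccos (1 / (2 \<gamma>))\<close> makes t positive and small
  and \<open>l\<close> a root of unity; c, of size \<open>sqrt t\<close>, becomes small as
  well.\<close>

lemma rational_rotation_level:
  fixes \<gamma> \<epsilon> :: real
  assumes \<gamma>: "\<gamma> > 1/2" and \<epsilon>: "\<epsilon> > 0"
  obtains t c :: real and l :: complex and M :: nat where
    "t > 0" "c > 0" "c < \<epsilon>" "M > 0" "norm l = 1" "of_real (\<gamma> + t) * (l\<^sup>2 + 1) = l" "(l\<^sup>2) ^ M = 1"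
    "c\<^sup>2 * (4 * (\<gamma> + t)\<^sup>2 - 1) = t * (\<gamma> + t)"
proof -
  have g1: "4 * \<gamma>\<^sup>2 - 1 > 0"
  proof -
    have "(1/2)\<^sup>2 < \<gamma>\<^sup>2" using \<gamma> by (intro power_strict_mono) auto
    then show ?thesis by (simp add: power2_eq_square)
  qed
  \<comment> \<open>Below it is shown that \<open>c^2 <= t \<gamma> / (4 \<gamma>^2 - 1)\<close>, so
    \<open>t < \<tau>\<close> ensures \<open>c < \<epsilon>\<close>.\<close>
  define \<tau> where "\<tau> = \<epsilon>\<^sup>2 * (4 * \<gamma>\<^sup>2 - 1) / \<gamma>"
  have \<tau>: "\<tau> > 0" using g1 \<gamma> \<epsilon> by (simp add: \<tau>_def)
  define \<theta>0 where "\<theta>0 = arccos (1 / (2 * \<gamma>))"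
  have r: "0 < 1 / (2 * \<gamma>)" "1 / (2 * \<gamma>) < 1" using \<gamma> by auto
  have cos0: "cos \<theta>0 = 1 / (2 * \<gamma>)" unfolding \<theta>0_def using r by (intro cos_arccos) linarith+
  have th0: "0 \<le> \<theta>0" "\<theta>0 < pi / 2"
  proof -
    show "0 \<le> \<theta>0" unfolding \<theta>0_def using r by (intro arccos_lbound) linarith+
    have "arccos (1 / (2 * \<gamma>)) < arccos 0" using r by (intro arccos_less_arccos) linarith+
    then show "\<theta>0 < pi / 2" by (simp add: \<theta>0_def)
  qed
  have "isCont (\<lambda>\<theta>. 1 / (2 * cos \<theta>) - \<gamma>) \<theta>0" using cos0 r by (intro continuous_intros) auto
  moreover have "1 / (2 * cos \<theta>0) - \<gamma> = 0" using cos0 by simp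
  ultimately have "(\<lambda>\<theta>. 1 / (2 * cos \<theta>) - \<gamma>) \<midarrow>\<theta>0\<rightarrow> 0" by (simp add: isCont_def)
  then obtain d where d: "d > 0" "\<And>\<theta>. \<theta> \<noteq> \<theta>0 \<Longrightarrow> \<bar>\<theta> - \<theta>0\<bar> < d \<Longrightarrow> \<bar>1 / (2 * cos \<theta>) - \<gamma>\<bar> < \<tau>"
    using \<tau> unfolding LIM_eq by (metis diff_zero real_norm_def)
  have "\<theta>0 / pi < min (1/2) ((\<theta>0 + d) / pi)" using th0 d(1) by (auto simp: field_simps)
  then obtain q where q: "q \<in> \<rat>" "\<theta>0 / pi < q" "q < min (1/2) ((\<theta>0 + d) / pi)" using Rats_dense_in_real by blast
  define \<theta> where "\<theta> = pi * q"
  have th: "\<theta>0 < \<theta>" "\<theta> < pi / 2" "\<theta> < \<theta>0 + d" using q by (auto simp: \<theta>_def field_simps)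
  have cpos: "cos \<theta> > 0" using th th0 by (intro cos_gt_zero_pi) auto
  have clt: "cos \<theta> < cos \<theta>0" using th th0 by (intro cos_monotone_0_pi) auto
  define G where "G = 1 / (2 * cos \<theta>)"
  define t where "t = G - \<gamma>"
  have t: "t > 0"
  proof -
    have "\<gamma> = 1 / (2 * cos \<theta>0)" unfolding cos0 using \<gamma> by simp
    also have "\<dots> < G" unfolding G_def using clt cpos by (intro divide_strict_left_mono) auto
    finally show ?thesis by (simp add: t_def)
  qed
  have t\<tau>: "t < \<tau>" using d(2)[of \<theta>] th t by (auto simp: t_def G_def)
  have G: "G > \<gamma>" "G = \<gamma> + t" using t by (auto simp: t_def)
  have G1: "4 * \<gamma>\<^sup>2 - 1 < 4 * G\<^sup>2 - 1" using G(1) \<gamma> by (auto intro!: power_strict_mono)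
  define c where "c = sqrt (t * G / (4 * G\<^sup>2 - 1))"
  have cp: "t * G / (4 * G\<^sup>2 - 1) > 0" using t G \<gamma> G1 g1 by (intro divide_pos_pos mult_pos_pos) auto
  have c2: "c\<^sup>2 = t * G / (4 * G\<^sup>2 - 1)" using cp by (simp add: c_def)
  have "c\<^sup>2 < \<epsilon>\<^sup>2"
  proof -
    have "G * (4 * \<gamma>\<^sup>2 - 1) \<le> \<gamma> * (4 * G\<^sup>2 - 1)"
    proof -
      have "0 \<le> (G - \<gamma>) * (4 * G * \<gamma> + 1)" using G \<gamma> by (intro mult_nonneg_nonneg) (auto intro!: add_nonneg_nonneg mult_nonneg_nonneg)
      then show ?thesis by (simp add: algebra_simps power2_eq_square)
    qed
    then have "G / (4 * G\<^sup>2 - 1) \<le> \<gamma> / (4 * \<gamma>\<^sup>2 - 1)" using g1 G1 by (simp add: divide_simps mult.commute)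
    from mult_left_mono[OF this, of t] t have "c\<^sup>2 \<le> t * (\<gamma> / (4 * \<gamma>\<^sup>2 - 1))" by (simp add: c2)
    also have "\<dots> < \<tau> * (\<gamma> / (4 * \<gamma>\<^sup>2 - 1))" using t\<tau> \<gamma> g1 by (intro mult_strict_right_mono) auto
    also have "\<dots> = \<epsilon>\<^sup>2" unfolding \<tau>_def using \<gamma> g1 by (simp add: field_simps)
    finally show ?thesis .
  qed
  then have ce: "c < \<epsilon>" using \<epsilon> by (meson less_eq_real_def power2_less_imp_less)
  obtain a b :: int where ab: "q = of_int a / of_int b" "b > 0" using q(1) by (metis Rats_cases')
  define l where "l = cis \<theta>"
  have l2: "l\<^sup>2 = cis (2 * \<theta>)" by (simp add: l_def Complex.DeMoivre)
  have "(l\<^sup>2) ^ nat b = cis (real (nat b) * (2 * \<theta>))" unfolding l2 by (simp add: Complex.DeMoivre)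
  also have "real (nat b) * (2 * \<theta>) = 2 * pi * of_int a" using ab by (simp add: \<theta>_def)
  also have "cis \<dots> = 1" by (rule cis_multiple_2pi) auto
  finally have lM: "(l\<^sup>2) ^ nat b = 1" .
  have ll: "l + cnj l = of_real (2 * cos \<theta>)" "l * cnj l = 1"
    by (simp_all add: l_def cis_cnj complex_eq_iff flip: cis_inverse)
  have "l\<^sup>2 + 1 = l * (l + cnj l)" using ll(2) by (simp add: distrib_left power2_eq_square)
  also have "of_real G * \<dots> = l * (of_real G * of_real (2 * cos \<theta>))" unfolding ll(1) by (simp only: mult_ac)
  also have "of_real G * of_real (2 * cos \<theta>) = (1::complex)" unfolding of_real_mult[symmetric] using cpos by (simp add: G_def)
  finally have lr: "of_real (\<gamma> + t) * (l\<^sup>2 + 1) = l" by (simp add: G(2))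
  show ?thesis
  proof (rule that[of t c "nat b" l])
    show "c\<^sup>2 * (4 * (\<gamma> + t)\<^sup>2 - 1) = t * (\<gamma> + t)" unfolding c2 G(2)[symmetric] using G1 g1 by simp
  qed (use t cp ce ab lM lr in \<open>auto simp: c_def l_def\<close>)
qed

text \<open>The map \<open>y -> y / (1 - y)\<close> sends the unit disc to the half plane to the
  right of -1/2. This one-sided bound keeps the pole in an orbit sum from being cancelled.\<close>

lemma Re_div_one_minus:
  fixes y :: complex
  assumes "norm y < 1"
  shows "Re (y / (1 - y)) \<ge> - 1/2"
proof -
  have ne: "1 - y \<noteq> 0" using assms by auto
  then have n: "(norm (1 - y))\<^sup>2 > 0" by simp
  have "Re (y / (1 - y)) = Re (y * cnj (1 - y)) / (norm (1 - y))\<^sup>2"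
    by (subst complex_div_cnj) (simp add: Re_divide_of_real flip: of_real_power)
  moreover have "Re (y * cnj (1 - y)) = Re y - (norm y)\<^sup>2"
    by (simp add: cmod_power2 algebra_simps) (simp add: power2_eq_square)
  moreover have "(norm (1 - y))\<^sup>2 = 1 - 2 * Re y + (norm y)\<^sup>2"
    by (simp add: cmod_power2) (simp add: power2_eq_square algebra_simps)
  moreover have "(norm y)\<^sup>2 < 1" using assms by (simp add: power_less_one_iff)
  ultimately have h: "Re (y / (1 - y)) = (Re y - (norm y)\<^sup>2) / (1 - 2 * Re y + (norm y)\<^sup>2)"
    "0 < 1 - 2 * Re y + (norm y)\<^sup>2" "(norm y)\<^sup>2 < 1" using n by simp_all
  have e: "(Re y - (norm y)\<^sup>2) - (- 1/2) * (1 - 2 * Re y + (norm y)\<^sup>2) = (1 - (norm y)\<^sup>2) / 2"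
    by (simp add: field_simps)
  have "0 \<le> (Re y - (norm y)\<^sup>2) - (- 1/2) * (1 - 2 * Re y + (norm y)\<^sup>2)" unfolding e using h(3) by simp
  then have "(- 1/2) * (1 - 2 * Re y + (norm y)\<^sup>2) \<le> Re y - (norm y)\<^sup>2" by (simp only: diff_ge_0_iff_ge)
  then show ?thesis unfolding h(1) pos_le_divide_eq[OF h(2)] .
qed

lemma plus_inverse_strict_mono: "1 \<le> a \<Longrightarrow> a < b \<Longrightarrow> a + 1 / a < b + 1 / (b::real)"
proof -
  assume a: "1 \<le> a" "a < b"
  then have "b * a > 1 * 1" by (intro mult_less_le_imp_less) auto
  then have "(b - a) * (1 - 1 / (b * a)) > 0" using a by (intro mult_pos_pos) (auto simp: divide_simps)
  moreover have "(b - a) * (1 - 1 / (b * a)) = (b + 1 / b) - (a + 1 / a)" using a by (simp add: field_simps)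
  ultimately show ?thesis by simp
qed

text \<open>On a level where the rotation \<open>x \<mapsto> l\<^sup>2 x\<close> has finite order, the terms coming from the
  linearized conjugacy cancel over a full orbit of the group generated by the two involutions
  \<open>x \<mapsto> 1 / x\<close> and \<open>x \<mapsto> 1 / (l\<^sup>2 x)\<close>.\<close>

lemma orbit_sum:
  fixes l x :: complex and R :: "complex \<Rightarrow> complex"
  assumes l: "norm l = 1" "(l\<^sup>2) ^ M = 1" "M > 0" and x: "1 < norm x" "norm x < 4"
    and R: "\<And>y. norm y \<noteq> 1 \<Longrightarrow> 1/4 < norm y \<Longrightarrow> norm y < 4 \<Longrightarrow>
       R y = n1 (y + 1 / y) / (y - 1 / y) + n2 (l * y + 1 / (l * y)) / (l * y - 1 / (l * y)) + C"
  shows "(\<Sum>j<M. R (x * (l\<^sup>2) ^ j) + R (1 / (x * (l\<^sup>2) ^ j))) = 2 * of_nat M * C"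
proof -
  define \<mu> where "\<mu> = l\<^sup>2"
  define a where "a = (\<lambda>y. n1 (y + 1 / y) / (y - 1 / y))"
  define b where "b = (\<lambda>y. n2 (l * y + 1 / (l * y)) / (l * y - 1 / (l * y)))"
  have l0: "l \<noteq> 0" using l by auto
  have \<mu>: "norm \<mu> = 1" "\<mu> ^ M = 1" "\<mu> \<noteq> 0" using l l0 by (auto simp: \<mu>_def norm_power)
  have x0: "x \<noteq> 0" using x by auto
  have n: "norm (x * \<mu> ^ j) = norm x" for j by (simp add: norm_mult norm_power \<mu>)
  have odd_a: "a (1 / y) = - a y" for y
    unfolding a_def using minus_divide_right[of "n1 (y + 1 / y)" "y - 1 / y"] by (simp add: add.commute)
  have odd_b: "b (1 / (\<mu> * y)) = - b y" if "y \<noteq> 0" for y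
  proof -
    have "l * (1 / (\<mu> * y)) = 1 / (l * y)" using l0 by (simp add: \<mu>_def power2_eq_square)
    then show ?thesis unfolding b_def
      using minus_divide_right[of "n2 (l * y + 1 / (l * y))" "l * y - 1 / (l * y)"] by (simp add: add.commute)
  qed
  have R': "R (x * \<mu> ^ j) = a (x * \<mu> ^ j) + b (x * \<mu> ^ j) + C"
    "R (1 / (x * \<mu> ^ j)) = - a (x * \<mu> ^ j) + b (1 / (x * \<mu> ^ j)) + C" for j
  proof -
    show "R (x * \<mu> ^ j) = a (x * \<mu> ^ j) + b (x * \<mu> ^ j) + C"
      unfolding a_def b_def by (rule R) (use x n in auto)
    have "R (1 / (x * \<mu> ^ j)) = a (1 / (x * \<mu> ^ j)) + b (1 / (x * \<mu> ^ j)) + C"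
      unfolding a_def b_def
    proof (rule R)
      have "norm (1 / (x * \<mu> ^ j)) = 1 / norm x" using n[of j] by (simp add: norm_divide)
      have e: "norm (1 / (x * \<mu> ^ j)) = 1 / norm x" by fact
      show "norm (1 / (x * \<mu> ^ j)) \<noteq> 1" "1/4 < norm (1 / (x * \<mu> ^ j))" "norm (1 / (x * \<mu> ^ j)) < 4"
        unfolding e using x by (auto simp: divide_simps)
    qed
    then show "R (1 / (x * \<mu> ^ j)) = - a (x * \<mu> ^ j) + b (1 / (x * \<mu> ^ j)) + C" by (simp only: odd_a)
  qed
  obtain m where m: "M = Suc m" using l(3) gr0_implies_Suc by blast
  \<comment> \<open>The second involution pairs each orbit point with the inverse of the next one,
    so the b-terms cancel after a cyclic shift; \<open>\<mu> ^ M = 1\<close> closes the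
    cycle.\<close>
  have shift: "b (1 / (x * \<mu> ^ Suc j)) = - b (x * \<mu> ^ j)" for j
    using odd_b[of "x * \<mu> ^ j"] x0 \<mu>(3) by (simp add: mult_ac)
  have wrap: "b (1 / (x * \<mu> ^ 0)) = - b (x * \<mu> ^ m)"
    using shift[of m] \<mu>(2) unfolding m by (simp only: power_0)
  have "(\<Sum>j<M. b (1 / (x * \<mu> ^ j))) = b (1 / (x * \<mu> ^ 0)) + (\<Sum>j<m. b (1 / (x * \<mu> ^ Suc j)))"
    unfolding m by (rule sum.lessThan_Suc_shift)
  also have "\<dots> = - (\<Sum>j<M. b (x * \<mu> ^ j))"
    unfolding shift wrap m by (simp add: sum_negf)
  finally have "(\<Sum>j<M. b (x * \<mu> ^ j) + b (1 / (x * \<mu> ^ j))) = 0" by (simp add: sum.distrib)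
  moreover have "(\<Sum>j<M. R (x * \<mu> ^ j) + R (1 / (x * \<mu> ^ j))) = (\<Sum>j<M. (b (x * \<mu> ^ j) + b (1 / (x * \<mu> ^ j))) + 2 * C)"
    unfolding R' by (rule sum.cong) auto
  ultimately show ?thesis by (simp add: sum.distrib \<mu>_def)
qed

text \<open>The orbit sum extends analytically to the annulus bounded by the pole of \<open>res\<close> at \<open>z = 1\<close>;
  all its terms have real part bounded below, so it cannot be constant there.\<close>

lemma orbit_sum_not_constant:
  fixes l :: complex and c :: real
  assumes l: "norm l = 1" and M: "M > 0" and c: "0 < c" "c < 1/16"
  defines "R \<equiv> \<lambda>y. res (of_real c * (y + 1 / y)) (- of_real c * (l * y + 1 / (l * y)))"
  assumes S: "\<And>x. 1 < norm x \<Longrightarrow> norm x < 4 \<Longrightarrow> (\<Sum>j<M. R (x * (l\<^sup>2) ^ j) + R (1 / (x * (l\<^sup>2) ^ j))) = K"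
  shows False
proof -
  \<comment> \<open>The larger real solution of \<open>x + 1 / x = y / c\<close>, that is, the
    parameter at which the first coordinate equals y. For \<open>y = 1\<close> it is the
    pole.\<close>
  define sol where "sol = (\<lambda>y. (y / c + sqrt ((y / c)\<^sup>2 - 4)) / 2)"
  have sol: "sol y + 1 / sol y = y / c" "sol y > 4" if y: "1/2 \<le> y" for y
  proof -
    have yc: "y / c > 8" using y c by (simp add: field_simps)
    then have "(y / c)\<^sup>2 > 8\<^sup>2" by (intro power_strict_mono) auto
    then have d: "(y / c)\<^sup>2 - 4 > 4" by simp
    define e where "e = sqrt ((y / c)\<^sup>2 - 4)"
    have e: "e * e = (y / c)\<^sup>2 - 4" "e > 0" using d by (auto simp: e_def)
    have s: "sol y = (y / c + e) / 2" by (simp add: sol_def e_def)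
    show "sol y > 4" using yc e(2) unfolding s by simp
    have "sol y * ((y / c - e) / 2) = ((y / c)\<^sup>2 - e * e) / 4"
      unfolding s by (simp add: algebra_simps power2_eq_square)
    also have "\<dots> = 1" unfolding e(1) by simp
    finally have i: "1 / sol y = (y / c - e) / 2" using \<open>sol y > 4\<close> by (simp add: divide_eq_eq mult.commute)
    have "sol y + 1 / sol y = sol y + (y / c - e) / 2" by (simp only: i)
    also have "\<dots> = y / c" unfolding s by (simp add: field_simps)
    finally show "sol y + 1 / sol y = y / c" .
  qed
  define X where "X = sol 1"
  have X: "X + 1 / X = 1 / c" "X > 4" using sol[of 1] by (auto simp: X_def)
  define T where "T = {x :: complex. 1 < norm x \<and> norm x < X}"
  define \<mu> where "\<mu> = l\<^sup>2"
  have \<mu>: "norm \<mu> = 1" using l by (simp add: \<mu>_def norm_power)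
  \<comment> \<open>The annulus ends exactly where \<open>c (norm x + 1 / norm x)\<close> reaches 1;
    all orbit points keep norm \<open>norm x\<close> or \<open>1 / norm x\<close>, so both
    coordinates stay in the unit disc.\<close>
  have nb: "norm (of_real c * (u + 1 / u)) < 1" if "x \<in> T" "norm u = norm x \<or> norm u = 1 / norm x" for u x :: complex
  proof -
    have "norm (u + 1 / u) \<le> norm u + norm (1 / u)" by (rule norm_triangle_ineq)
    also have "\<dots> = norm x + 1 / norm x" using that(2) by (auto simp: norm_divide)
    also have "\<dots> < X + 1 / X" by (rule plus_inverse_strict_mono) (use that(1) in \<open>auto simp: T_def\<close>)
    finally have "c * norm (u + 1 / u) < c * (1 / c)" unfolding X(1) using c by (intro mult_strict_left_mono) auto
    then show ?thesis using c by (simp only: norm_mult norm_of_real) simp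
  qed
  have nrm: "norm (x * \<mu> ^ j) = norm x" "norm (1 / (x * \<mu> ^ j)) = 1 / norm x"
    "norm (l * (x * \<mu> ^ j)) = norm x" "norm (l * (1 / (x * \<mu> ^ j))) = 1 / norm x" for x j
    using l \<mu> by (simp_all add: norm_mult norm_power norm_divide)
  have sq: "norm (v\<^sup>2) < 1" "norm ((- v)\<^sup>2) < 1" if "norm v < 1" for v :: complex
    using that by (simp_all add: norm_power power_less_one_iff)
  have b: "norm ((of_real c * (u + 1 / u))\<^sup>2) < 1" "norm ((- of_real c * (l * u + 1 / (l * u)))\<^sup>2) < 1"
    if "x \<in> T" "u = x * \<mu> ^ j \<or> u = 1 / (x * \<mu> ^ j)" for x u j
  proof -
    show "norm ((of_real c * (u + 1 / u))\<^sup>2) < 1"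
      by (rule sq(1)[OF nb[OF that(1)]]) (use that(2) nrm(1,2)[of x j] in \<open>elim disjE; simp only: simp_thms\<close>)
    have "norm (of_real c * (l * u + 1 / (l * u))) < 1"
      by (rule nb[OF that(1)]) (use that(2) nrm(3,4)[of x j] in \<open>elim disjE; simp only: simp_thms\<close>)
    then show "norm ((- of_real c * (l * u + 1 / (l * u)))\<^sup>2) < 1"
      using sq(2) by simp
  qed
  have bd: "1 - (of_real c * (u + 1 / u))\<^sup>2 \<noteq> 0" "1 - (- of_real c * (l * u + 1 / (l * u)))\<^sup>2 \<noteq> 0"
    if "x \<in> T" "u = x * \<mu> ^ j \<or> u = 1 / (x * \<mu> ^ j)" for x u j
    using b[OF that] by auto
  have nz: "x * \<mu> ^ j \<noteq> 0" "l * (x * \<mu> ^ j) \<noteq> 0" "l * (1 / (x * \<mu> ^ j)) \<noteq> 0" if "x \<in> T" for x j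
  proof -
    have "x \<noteq> 0" "\<mu> \<noteq> 0" "l \<noteq> 0" using that \<mu> l by (auto simp: T_def)
    then show "x * \<mu> ^ j \<noteq> 0" "l * (x * \<mu> ^ j) \<noteq> 0" "l * (1 / (x * \<mu> ^ j)) \<noteq> 0" by auto
  qed
  define F where "F = (\<lambda>x. \<Sum>j<M. R (x * \<mu> ^ j) + R (1 / (x * \<mu> ^ j)))"
  have Fh: "F holomorphic_on T"
    unfolding F_def
  proof (intro holomorphic_on_sum holomorphic_on_add)
    fix j
    note b1 = bd(1)[where u="_ * \<mu> ^ j", OF _ disjI1[OF refl]] bd(2)[where u="_ * \<mu> ^ j", OF _ disjI1[OF refl]]
    show "(\<lambda>x. R (x * \<mu> ^ j)) holomorphic_on T"
      unfolding R_def res_def by (intro holomorphic_intros; (erule b1 | erule nz))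
    note b2 = bd(1)[where u="1 / (_ * \<mu> ^ j)", OF _ disjI2[OF refl]] bd(2)[where u="1 / (_ * \<mu> ^ j)", OF _ disjI2[OF refl]]
    have nz2: "1 / (x * \<mu> ^ j) \<noteq> 0" if "x \<in> T" for x using nz(1)[OF that, of j] by simp
    show "(\<lambda>x. R (1 / (x * \<mu> ^ j))) holomorphic_on T"
      unfolding R_def res_def by (intro holomorphic_intros; (erule b2 | erule nz | erule nz2))
  qed
  have "F x = K" if "x \<in> T" for x
  proof (rule analytic_continuation_open[of "{x. 1 < norm x \<and> norm x < 4}" T F "\<lambda>_. K"])
    show "open {x :: complex. 1 < norm x \<and> norm x < 4}" "open T"
      unfolding T_def by (intro open_Collect_conj open_Collect_less continuous_intros)+
    have "(2::complex) \<in> {x. 1 < norm x \<and> norm x < 4}" by simp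
    then show "{x :: complex. 1 < norm x \<and> norm x < 4} \<noteq> {}" by blast
    show "connected T" unfolding T_def using connected_annulus(1)[of 1 "0::complex" X] by simp
    show "{x. 1 < norm x \<and> norm x < 4} \<subseteq> T" using X(2) by (auto simp: T_def)
    show "F z = K" if "z \<in> {x. 1 < norm x \<and> norm x < 4}" for z
      using S[of z] that by (simp add: F_def \<mu>_def)
    show "F holomorphic_on T" by (rule Fh)
    show "(\<lambda>_. K) holomorphic_on T" by (rule holomorphic_on_const)
    show "x \<in> T" by (rule that)
  qed
  note FK = this
  \<comment> \<open>Exceeds the supposed constant by more than the \<open>2 * M\<close> that the
    terms of the orbit sum, each of real part at least -1, could take away.\<close>
  define N where "N = norm K + 2 * real M + 1"
  have "real M \<ge> 1" using M by simp
  then have N: "N \<ge> 3" unfolding N_def using norm_ge_zero[of K] by linarith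
  \<comment> \<open>Solves \<open>y^2 / (1 - y^2) = N\<close>, so the term at the first orbit point
    alone contributes N, up to a bounded error.\<close>
  define y where "y = sqrt (N / (N + 1))"
  have y2: "y\<^sup>2 = N / (N + 1)" using N by (simp add: y_def)
  have y: "1/2 \<le> y" "y < 1"
  proof -
    have "(1/2)\<^sup>2 \<le> N / (N + 1)" using N by (simp add: field_simps power2_eq_square)
    then show "1/2 \<le> y" unfolding y_def by (rule real_le_rsqrt)
    show "y < 1" unfolding y_def using N by simp
  qed
  define x where "x = sol y"
  have x: "x + 1 / x = y / c" "x > 4" using sol[OF y(1)] by (auto simp: x_def)
  have "x < X"
  proof (rule ccontr)
    assume "\<not> x < X"
    then have "X + 1 / X \<le> x + 1 / x" using plus_inverse_strict_mono[of X x] X(2) by (cases "X = x") auto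
    then show False using X x y c by (simp add: divide_le_cancel)
  qed
  then have xT: "of_real x \<in> T" using x by (simp add: T_def)
  have low: "Re (R u) \<ge> - 1" if "u = of_real x * \<mu> ^ j \<or> u = 1 / (of_real x * \<mu> ^ j)" for u j
    using Re_div_one_minus[OF b(1)[OF xT that]] Re_div_one_minus[OF b(2)[OF xT that]]
    by (simp add: R_def res_def)
  have first: "Re (R (of_real x)) \<ge> N - 1"
  proof -
    have "complex_of_real c * (of_real x + 1 / of_real x) = of_real (c * (x + 1 / x))" by simp
    also have "c * (x + 1 / x) = y" unfolding x(1) using c by simp
    finally have Zy: "complex_of_real c * (of_real x + 1 / of_real x) = of_real y" .
    have "(of_real y)\<^sup>2 / (1 - (of_real y)\<^sup>2) = complex_of_real (y\<^sup>2 / (1 - y\<^sup>2))" by simp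
    also have "y\<^sup>2 / (1 - y\<^sup>2) = N" unfolding y2 using N by (simp add: field_simps)
    finally have "Re (R (of_real x)) = N + Re ((- of_real c * (l * of_real x + 1 / (l * of_real x)))\<^sup>2 / (1 - (- of_real c * (l * of_real x + 1 / (l * of_real x)))\<^sup>2))"
      unfolding R_def res_def Zy by simp
    moreover have "Re ((- of_real c * (l * of_real x + 1 / (l * of_real x)))\<^sup>2 / (1 - (- of_real c * (l * of_real x + 1 / (l * of_real x)))\<^sup>2)) \<ge> - 1/2"
      by (rule Re_div_one_minus, rule b(2)[OF xT, of _ 0]) simp
    ultimately show ?thesis by linarith
  qed
  have "N \<le> Re (R (of_real x * \<mu> ^ 0)) + Re (R (1 / (of_real x * \<mu> ^ 0))) + 2"
    using first low[of "1 / (of_real x * \<mu> ^ 0)" 0] by simp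
  also have "\<dots> \<le> (\<Sum>j<M. Re (R (of_real x * \<mu> ^ j)) + Re (R (1 / (of_real x * \<mu> ^ j))) + 2)"
  proof (rule member_le_sum[of 0 "{..<M}" "\<lambda>j. Re (R (of_real x * \<mu> ^ j)) + Re (R (1 / (of_real x * \<mu> ^ j))) + 2"])
    fix j
    have "Re (R (of_real x * \<mu> ^ j)) \<ge> - 1" "Re (R (1 / (of_real x * \<mu> ^ j))) \<ge> - 1"
      by (rule low[of _ j]; simp)+
    then show "0 \<le> Re (R (of_real x * \<mu> ^ j)) + Re (R (1 / (of_real x * \<mu> ^ j))) + 2" by linarith
  qed (use M in auto)
  also have "\<dots> = Re (F (of_real x)) + 2 * real M" by (simp add: F_def sum.distrib Re_sum)
  also have "Re (F (of_real x)) = Re K" using FK[OF xT] by simp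
  also have "\<dots> + 2 * real M < N" using complex_Re_le_cmod[of K] by (simp add: N_def)
  finally show False by simp
qed

lemma norm_of_square_1: "v * v = 1 \<Longrightarrow> norm v = 1" for v :: complex
  by (auto simp: square_eq_1_iff)

text \<open>On one level T the values of a, e, f are constants and u, v are functions of a single
  coordinate. Division by both partial derivatives expresses \<open>res\<close> as a function odd
  under one involution, a function odd under the other, and a constant; its orbit sum would be
  constant.\<close>

lemma linearized_equation_unsolvable:
  fixes \<gamma> \<rho> :: real and a e f :: "complex \<Rightarrow> complex" and u v :: "complex \<Rightarrow> complex \<Rightarrow> complex"
  assumes \<gamma>: "\<gamma> > 1/2" and \<rho>: "\<rho> > 0"
    and eq: "\<And>z w. norm z < \<rho> \<Longrightarrow> norm w < \<rho> \<Longrightarrow>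
      (let t = h0 (of_real \<gamma>) z w in pert (of_real \<gamma>) z w = a t * (z * w) + (u z t * w + z * v w t)
        + (e t + pert (of_real \<gamma>) z w) * z\<^sup>2 + 2 * (of_real \<gamma> + t) * z * u z t
        + (f t + pert (of_real \<gamma>) z w) * w\<^sup>2 + 2 * (of_real \<gamma> + t) * w * v w t)"
  shows False
proof -
  \<comment> \<open>For \<open>1/4 < norm y < 4\<close> both coordinates have norm at most
    \<open>8 * c\<close>, which has to stay below \<open>\<rho>\<close> and below 1/4; 1/64 also
    meets the bound on c in \<open>orbit_sum_not_constant\<close>.\<close>
  define \<epsilon> where "\<epsilon> = min (\<rho> / 8) (1 / 64)"
  have \<epsilon>: "\<epsilon> > 0" using \<rho> by (simp add: \<epsilon>_def)
  obtain t c :: real and l :: complex and M :: nat where p: "t > 0" "c > 0" "c < \<epsilon>" "M > 0" "norm l = 1" "of_real (\<gamma> + t) * (l\<^sup>2 + 1) = l" "(l\<^sup>2) ^ M = 1"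
    "c\<^sup>2 * (4 * (\<gamma> + t)\<^sup>2 - 1) = t * (\<gamma> + t)"
    by (rule rational_rotation_level[OF \<gamma> \<epsilon>]) (rule that)
  have c: "8 * c < \<rho>" "8 * c < 1/4" "c < 1/16" using p by (auto simp: \<epsilon>_def)
  define g T C :: complex where "g = of_real (\<gamma> + t)" and "T = of_real t" and "C = of_real c"
  have root: "g * (l\<^sup>2 + 1) = l" "l \<noteq> 0" using p by (auto simp: g_def)
  have cc: "C\<^sup>2 * (4 * g\<^sup>2 - 1) = T * g"
    using arg_cong[OF p(8), of complex_of_real] by (simp add: g_def T_def C_def)
  have g0: "g \<noteq> 0" and C0: "C \<noteq> 0" and T0: "T \<noteq> 0" using root p by (auto simp: T_def C_def)
  have g4: "4 * g\<^sup>2 - 1 \<noteq> 0" using cc T0 g0 by auto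
  define k where "k = (l\<^sup>2 - 1) / (l\<^sup>2 + 1)"
  have k0: "k \<noteq> 0"
  proof
    assume "k = 0"
    then have "l\<^sup>2 = 1" using root by (auto simp: k_def)
    then have "(2 * g)\<^sup>2 = 1" using root by (metis mult.commute one_add_one)
    then show False using g4 by (simp add: power_mult_distrib)
  qed
  define Z W where "Z = (\<lambda>y. C * (y + 1 / y))" and "W = (\<lambda>y. - C * (l * y + 1 / (l * y)))"
  \<comment> \<open>Determined by \<open>a z w + e z^2 + f w^2 = B d1 d2 + \<alpha> z d1 + \<beta> w
    d2\<close> with \<open>d1 = w + 2 g z\<close>, \<open>d2 = z + 2 g w\<close>: comparing
    coefficients is a linear system, solvable because \<open>4 g^2\<close> is not 1.\<close>
  define B where "B = (a T - (e T + f T) / (2 * g)) / (4 * g\<^sup>2 - 1)"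
  \<comment> \<open>At fixed level u depends only on \<open>Z y\<close>, hence on
    \<open>y + 1 / y\<close>, and v only on \<open>l y + 1 / (l y)\<close>: the numerators are
    invariant under their involutions and the denominators are odd.\<close>
  define n1 where "n1 = (\<lambda>q. - (u (C * q) T + (e T / (2 * g) - B) * (C * q)) / (C * k))"
  define n2 where "n2 = (\<lambda>q. - (v (- C * q) T + (f T / (2 * g) - B) * (- C * q)) / (C * k))"
  have R: "res (Z y) (W y) = n1 (y + 1 / y) / (y - 1 / y) + n2 (l * y + 1 / (l * y)) / (l * y - 1 / (l * y)) + B"
    if y: "norm y \<noteq> 1" "1/4 < norm y" "norm y < 4" for y
  proof -
    have y0: "y \<noteq> 0" using y by auto
    have by4: "norm y + 1 / norm y \<le> 8"
    proof -
      have "1 / norm y \<le> 4" using y by (simp add: divide_le_eq)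
      then show ?thesis using y by linarith
    qed
    have "norm (y + 1 / y) \<le> 8" using by4 norm_triangle_ineq[of y "1 / y"] by (simp add: norm_divide)
    then have nZ: "norm (Z y) \<le> 8 * c" using p(2) by (simp add: Z_def C_def norm_mult)
    have "norm (l * y + 1 / (l * y)) \<le> 8"
      using by4 norm_triangle_ineq[of "l * y" "1 / (l * y)"] p(5) by (simp add: norm_divide norm_mult)
    then have nW: "norm (W y) \<le> 8 * c" using p(2) by (simp add: W_def C_def norm_mult)
    define z w where "z = Z y" and "w = W y"
    have lev: "z * w + g * (z\<^sup>2 + w\<^sup>2) = T" using conic_point(1)[OF root y0 cc] by (simp add: z_def w_def Z_def W_def)
    have dw: "w + 2 * g * z = - C * k * (l * y - 1 / (l * y))" using conic_point(2)[OF root y0 cc] by (simp add: z_def w_def Z_def W_def k_def)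
    have dz: "z + 2 * g * w = - C * k * (y - 1 / y)" using conic_point(3)[OF root y0 cc] by (simp add: z_def w_def Z_def W_def k_def)
    have y1: "y - 1 / y \<noteq> 0"
    proof
      assume "y - 1 / y = 0"
      then have "y * y = 1" using y0 by (simp add: field_simps)
      then show False using y(1) norm_of_square_1 by blast
    qed
    have y2: "l * y - 1 / (l * y) \<noteq> 0"
    proof
      assume "l * y - 1 / (l * y) = 0"
      then have "(l * y) * (l * y) = 1" using y0 root(2) by (simp add: field_simps)
      then have "norm (l * y) = 1" by (rule norm_of_square_1)
      then show False using y(1) p(5) by (simp add: norm_mult)
    qed
    have dn: "1 - (z\<^sup>2 + w\<^sup>2) \<noteq> 0" using h0_bound(4)[of z "8 * c" w] nZ nW c by (auto simp: z_def w_def)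
    have gT: "g = of_real \<gamma> + T" by (simp add: g_def T_def)
    have "T * (1 - (z\<^sup>2 + w\<^sup>2)) = z * w + of_real \<gamma> * (z\<^sup>2 + w\<^sup>2)" using lev unfolding gT by (simp add: algebra_simps)
    then have hT: "h0 (of_real \<gamma>) z w = T" unfolding h0_def using dn by (simp add: divide_eq_eq)
    have P: "pert (of_real \<gamma>) z w * (1 - (z\<^sup>2 + w\<^sup>2)) = (w + 2 * g * z) * (z + 2 * g * w) * res z w"
      unfolding pert_def hT gT[symmetric] using dn by simp
    have "norm z < \<rho>" "norm w < \<rho>" using nZ nW c by (auto simp: z_def w_def)
    from eq[OF this, unfolded Let_def hT gT[symmetric]]
    have E: "pert (of_real \<gamma>) z w * (1 - (z\<^sup>2 + w\<^sup>2)) = a T * (z * w) + e T * z\<^sup>2 + f T * w\<^sup>2 + (w + 2 * g * z) * u z T + (z + 2 * g * w) * v w T"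
      by (simp add: algebra_simps)
    have q: "a T = B * (4 * g\<^sup>2 - 1) + (e T + f T) / (2 * g)" unfolding B_def using g4 by simp
    define \<alpha> \<beta> where "\<alpha> = e T / (2 * g) - B" and "\<beta> = f T / (2 * g) - B"
    have ef: "e T = 2 * g * (\<alpha> + B)" "f T = 2 * g * (\<beta> + B)" using g0 by (simp_all add: \<alpha>_def \<beta>_def)
    have aT: "a T = B * (1 + 4 * g\<^sup>2) + \<alpha> + \<beta>" unfolding q ef using g0 by (simp add: field_simps)
    have quad: "a T * (z * w) + e T * z\<^sup>2 + f T * w\<^sup>2 = B * ((w + 2 * g * z) * (z + 2 * g * w)) + \<alpha> * z * (w + 2 * g * z) + \<beta> * w * (z + 2 * g * w)"
      unfolding ef aT by (simp add: algebra_simps power2_eq_square)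
    define d1 d2 where "d1 = w + 2 * g * z" and "d2 = z + 2 * g * w"
    have d: "d1 \<noteq> 0" "d2 \<noteq> 0" unfolding d1_def d2_def dw dz using C0 k0 y1 y2 by auto
    have "d1 * d2 * res z w = B * (d1 * d2) + d1 * (u z T + \<alpha> * z) + d2 * (v w T + \<beta> * w)"
      using E unfolding P quad unfolding d1_def[symmetric] d2_def[symmetric] by (simp add: algebra_simps)
    then have "res z w = B + (u z T + \<alpha> * z) / d2 + (v w T + \<beta> * w) / d1" using d by (simp add: field_simps)
    moreover have neg: "A / (- C * k * q) = - A / (C * k) / q" for A q :: complex by simp
    moreover have "(u z T + \<alpha> * z) / d2 = n1 (y + 1 / y) / (y - 1 / y)"
      unfolding d2_def dz neg n1_def unfolding z_def Z_def \<alpha>_def by (rule refl)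
    moreover have "(v w T + \<beta> * w) / d1 = n2 (l * y + 1 / (l * y)) / (l * y - 1 / (l * y))"
      unfolding d1_def dw neg n2_def unfolding w_def W_def \<beta>_def by (rule refl)
    ultimately show ?thesis by (simp add: z_def w_def)
  qed
  show False
  proof (rule orbit_sum_not_constant[OF p(5,4,2) c(3)])
    fix x :: complex assume x: "1 < norm x" "norm x < 4"
    show "(\<Sum>j<M. res (of_real c * (x * (l\<^sup>2) ^ j + 1 / (x * (l\<^sup>2) ^ j))) (- of_real c * (l * (x * (l\<^sup>2) ^ j) + 1 / (l * (x * (l\<^sup>2) ^ j)))) +
        res (of_real c * (1 / (x * (l\<^sup>2) ^ j) + 1 / (1 / (x * (l\<^sup>2) ^ j)))) (- of_real c * (l * (1 / (x * (l\<^sup>2) ^ j)) + 1 / (l * (1 / (x * (l\<^sup>2) ^ j))))))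
      = 2 * of_nat M * B"
      by (rule orbit_sum[where R="\<lambda>y. res (of_real c * (y + 1 / y)) (- of_real c * (l * y + 1 / (l * y)))", OF p(5,7,4) x])
         (rule R[unfolded Z_def W_def C_def])
  qed
qed

subsection \<open>From biholomorphic maps to normalizing series\<close>

text \<open>In the coordinates \<open>(z + w) / 2\<close> and \<open>(z - w) / (2 i)\<close> the set
  \<open>w = cnj z\<close> is the real plane, and the identity theorem applies in one variable after
  the other. The change of coordinates costs half of the radius.\<close>

lemma vanish_on_antidiagonal:
  assumes \<Phi>: "hol2 \<Phi> (bidisc \<rho>)" and z0: "\<And>z. norm z < \<rho> \<Longrightarrow> \<Phi> (z, cnj z) = 0"
    and zw: "norm z < \<rho> / 2" "norm w < \<rho> / 2"
  shows "\<Phi> (z, w) = 0"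
proof -
  have \<rho>: "\<rho> > 0" using zw(1) norm_ge_zero[of z] by linarith
  define B where "B = ball (0::complex) (\<rho> / 2)"
  have B: "open B" "connected B" "0 \<in> B" using \<rho> by (auto simp: B_def)
  have dom: "(x + \<i> * y, x - \<i> * y) \<in> bidisc \<rho>" if "x \<in> B" "y \<in> B" for x y
    using that norm_triangle_ineq[of x "\<i> * y"] norm_triangle_ineq4[of x "\<i> * y"] by (auto simp: B_def norm_mult)
  define I where "I = B \<inter> range complex_of_real"
  have lim: "0 islimpt I"
    unfolding islimpt_approachable
  proof (intro allI impI)
    fix e :: real assume "e > 0"
    then have "complex_of_real (min e \<rho> / 4) \<in> B" "complex_of_real (min e \<rho> / 4) \<noteq> 0" "dist (complex_of_real (min e \<rho> / 4)) 0 < e"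
      using \<rho> by (auto simp: B_def)
    then show "\<exists>x'\<in>I. x' \<noteq> 0 \<and> dist x' 0 < e" unfolding I_def by blast
  qed
  have h1: "(\<lambda>x. \<Phi> (x + \<i> * y, x - \<i> * y)) holomorphic_on B" if "y \<in> B" for y
    by (rule hol2_curve[OF \<Phi>]) (use that B dom in \<open>auto intro!: holomorphic_intros\<close>)
  have h2: "(\<lambda>y. \<Phi> (x + \<i> * y, x - \<i> * y)) holomorphic_on B" if "x \<in> B" for x
    by (rule hol2_curve[OF \<Phi>]) (use that B dom in \<open>auto intro!: holomorphic_intros\<close>)
  have real: "\<Phi> (x + \<i> * y, x - \<i> * y) = 0" if "x \<in> I" "y \<in> I" for x y
  proof -
    have "cnj (x + \<i> * y) = x - \<i> * y" using that by (auto simp: I_def)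
    moreover have "norm (x + \<i> * y) < \<rho>" using dom[of x y] that by (auto simp: I_def)
    ultimately show ?thesis using z0[of "x + \<i> * y"] by simp
  qed
  have s1: "\<Phi> (x + \<i> * y, x - \<i> * y) = 0" if "x \<in> B" "y \<in> I" for x y
    by (rule analytic_continuation[OF h1[of y] B(1,2) _ B(3) lim, of x])
       (use that real in \<open>auto simp: I_def\<close>)
  have s2: "\<Phi> (x + \<i> * y, x - \<i> * y) = 0" if "x \<in> B" "y \<in> B" for x y
    by (rule analytic_continuation[OF h2[of x] B(1,2) _ B(3) lim, of y])
       (use that s1 in \<open>auto simp: I_def\<close>)
  have "norm ((z + w) / 2) < \<rho> / 2" "norm ((z - w) / (2 * \<i>)) < \<rho> / 2"
    using norm_triangle_ineq[of z w] norm_triangle_ineq4[of z w] zw by (auto simp: norm_divide norm_mult)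
  then have "\<Phi> ((z + w) / 2 + \<i> * ((z - w) / (2 * \<i>)), (z + w) / 2 - \<i> * ((z - w) / (2 * \<i>))) = 0"
    by (intro s2) (auto simp: B_def)
  moreover have "(z + w) / 2 + \<i> * ((z - w) / (2 * \<i>)) = z" "(z + w) / 2 - \<i> * ((z - w) / (2 * \<i>)) = w"
    by (simp_all add: field_simps)
  ultimately show ?thesis by simp
qed

lemma power_series_const:
  fixes a :: "nat \<Rightarrow> complex"
  assumes "r > 0" "\<And>t. norm t < r \<Longrightarrow> (\<lambda>k. a k * t ^ k) sums c"
  shows "a 0 = c" "k > 0 \<Longrightarrow> a k = 0"
proof -
  have "\<forall>\<^sub>F t in nhds 0. (\<lambda>n. fps_nth (Abs_fps a) n * t ^ n) sums c"
    by (rule eventually_mono[OF eventually_nhds_in_open[of "ball 0 r"]]) (use assms in auto)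
  then have "(\<lambda>_. c) has_fps_expansion Abs_fps a" by (rule has_fps_expansionI)
  then have "Abs_fps a = fps_const c" using fps_expansion_unique_complex has_fps_expansion_const by blast
  then have *: "a k = fps_nth (fps_const c) k" for k by (metis fps_nth_Abs_fps)
  show "a 0 = c" "k > 0 \<Longrightarrow> a k = 0" by (simp_all add: *)
qed

lemma hol2_wsum:
  assumes f: "hol2 f (bidisc R)" and R: "R > 0"
  obtains C B K where "geo_bound C B K"
    "\<And>j w. norm w < R / 2 \<Longrightarrow> (\<lambda>k. C j k * w ^ k) sums ((deriv ^^ j) (\<lambda>z. f (z, w)) 0 / fact j)"
    "\<And>z w. norm z < R / 2 \<Longrightarrow> norm w < R / 2 \<Longrightarrow> ((\<lambda>(j,k). C j k * z ^ j * w ^ k) has_sum f (z, w)) UNIV"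
proof -
  obtain C B where C: "B > 0" "\<And>j k. norm (C j k) \<le> B / (R / 2) ^ (j + k)"
    "\<And>j w. norm w < R / 2 \<Longrightarrow> (\<lambda>k. C j k * w ^ k) sums ((deriv ^^ j) (\<lambda>z. f (z, w)) 0 / fact j)"
    "\<And>z w. norm z < R / 2 \<Longrightarrow> norm w < R / 2 \<Longrightarrow> ((\<lambda>(j,k). C j k * z ^ j * w ^ k) has_sum f (z, w)) UNIV"
    by (rule hol2_power_series[OF f, of "R / 2"]) (use R in \<open>auto intro: that\<close>)
  \<comment> \<open>The maximum with 1 allows the exponent to be raised from \<open>j + k\<close> to
    the weight \<open>j + 2 * k\<close>.\<close>
  define K where "K = max 1 (2 / R)"
  have "norm (C j k) \<le> B * K ^ (j + 2 * k)" for j k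
  proof -
    have "norm (C j k) \<le> B * (2 / R) ^ (j + k)" using C(2)[of j k] by (simp add: power_divide)
    also have "\<dots> \<le> B * K ^ (j + k)" using C(1) R by (intro mult_left_mono power_mono) (auto simp: K_def)
    also have "\<dots> \<le> B * K ^ (j + 2 * k)" using C(1) by (intro mult_left_mono power_increasing) (auto simp: K_def)
    finally show ?thesis .
  qed
  then have "geo_bound C B K" using C(1) by (auto simp: geo_bound_def K_def)
  then show ?thesis using that C(3,4) by blast
qed

lemma geo_bound_mono: "geo_bound C B K \<Longrightarrow> B \<le> B' \<Longrightarrow> K \<le> K' \<Longrightarrow> geo_bound C B' K'"
  unfolding geo_bound_def
  by (smt (verit) mult_mono power_mono zero_le_power)

lemma wsum_no_first:
  assumes "\<And>j k. j > 0 \<Longrightarrow> C j k = 0"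
  shows "wsum C z t = wsum C 0 t"
proof -
  have "C (m - 2 * k) k * z ^ (m - 2 * k) * t ^ k = C (m - 2 * k) k * 0 ^ (m - 2 * k) * t ^ k" for m k
    using assms[of "m - 2 * k" k] by (cases "m - 2 * k = 0") auto
  then show ?thesis unfolding wsum_def wpoly_def by (simp only:)
qed

text \<open>The coefficients are real; with the symmetry in z and w this makes \<open>hs\<close>
  real on \<open>w = cnj z\<close>, which places the surface in the hyperplane
  \<open>y2 = 0\<close>.\<close>

lemma hs_cnj: "cnj (hs (of_real \<gamma>) s z w) = hs (of_real \<gamma>) s (cnj z) (cnj w)"
  by (simp add: hs_def h0_def pert_def res_def)

lemma hs_commute: "hs g s z w = hs g s w z"
proof -
  have "h0 g z w = h0 g w z" by (simp add: h0_def add.commute mult.commute)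
  then show ?thesis by (simp add: hs_def pert_def res_def add.commute mult.commute)
qed

lemma hs_hol2: "hol2 (\<lambda>p. hs g s (fst p) (snd p)) (bidisc (1/4))"
proof -
  have ne: "1 - (fst p)\<^sup>2 \<noteq> 0" "1 - (snd p)\<^sup>2 \<noteq> 0" "1 - ((fst p)\<^sup>2 + (snd p)\<^sup>2) \<noteq> 0" if "p \<in> bidisc (1/4)" for p
    using h0_bound(2-4)[of "fst p" "1/4" "snd p"] that by (auto simp: mem_Times_iff)
  have hh: "hol2 (\<lambda>p. h0 g (fst p) (snd p)) (bidisc (1/4))"
    unfolding h0_def by (intro hol2_divide hol2_add hol2_diff hol2_mult hol2_power hol2_fst hol2_snd hol2_const ne)
  show ?thesis
    unfolding hs_def pert_def res_def
    by (intro hol2_divide hol2_add hol2_diff hol2_mult hol2_power hol2_fst hol2_snd hol2_const hh ne)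
qed

lemma hs_at_0 [simp]: "hs g s 0 0 = 0"
  by (simp add: hs_def h0_def pert_def res_def)

lemma nf_fps_nth_2:
  assumes "\<And>i. i < 2 \<Longrightarrow> X i 0 0 = 0 \<and> X i 1 0 = 1"
  shows "fps_nth (nf_fps X Z W H) 2 = X 2 0 0 * (Z * W) + X 3 0 0 * Z\<^sup>2 + X 4 0 0 * W\<^sup>2"
proof -
  have v: "vanish 1 (wfps (X i) Y H)" "fps_nth (wfps (X i) Y H) 1 = Y" if "i < 2" for i Y
    using assms[OF that] by (simp_all add: vanish_def wfps_low del: One_nat_def)
  have "fps_nth (a * (b * c)) (0 + (1 + 1)) = fps_nth a 0 * (fps_nth b 1 * fps_nth c 1)" if "vanish 1 b" "vanish 1 c" for a b c
    by (subst vanish_mult_nth(1)[OF vanish_0 vanish_mult_nth(2)[OF that]]) (simp only: vanish_mult_nth(1)[OF that])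
  then have "fps_nth (a * (b * c)) 2 = fps_nth a 0 * (fps_nth b 1 * fps_nth c 1)" if "vanish 1 b" "vanish 1 c" for a b c
    using that by (simp add: numeral_2_eq_2)
  note m = this
  show ?thesis unfolding nf_fps_def fps_add_nth
    by (simp add: m v wfps_low power2_eq_square del: One_nat_def)
qed

section \<open>Components and derivative of a biholomorphic map at the origin\<close>

lemma holomorphic2_imp_hol2:
  assumes "holomorphic2_on F U"
  shows "hol2 (\<lambda>p. fst (F p)) U" "hol2 (\<lambda>p. snd (F p)) U"
proof -
  have "\<exists>L. ((\<lambda>p. fst (F p)) has_derivative L) (at p) \<and> (\<forall>c v. L (cmult2 c v) = c * L v)"
    "\<exists>L. ((\<lambda>p. snd (F p)) has_derivative L) (at p) \<and> (\<forall>c v. L (cmult2 c v) = c * L v)" if p: "p \<in> U" for p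
  proof -
    obtain L where L: "(F has_derivative L) (at p)" "\<forall>c v. L (cmult2 c v) = cmult2 c (L v)"
      using assms p unfolding holomorphic2_on_def by blast
    show "\<exists>L. ((\<lambda>p. fst (F p)) has_derivative L) (at p) \<and> (\<forall>c v. L (cmult2 c v) = c * L v)"
      using L(2) has_derivative_fst[OF L(1)] by (intro exI[of _ "\<lambda>v. fst (L v)"]) (simp add: cmult2_def)
    show "\<exists>L. ((\<lambda>p. snd (F p)) has_derivative L) (at p) \<and> (\<forall>c v. L (cmult2 c v) = c * L v)"
      using L(2) has_derivative_snd[OF L(1)] by (intro exI[of _ "\<lambda>v. snd (L v)"]) (simp add: cmult2_def)
  qed
  then show "hol2 (\<lambda>p. fst (F p)) U" "hol2 (\<lambda>p. snd (F p)) U" unfolding hol2_def by blast+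
qed

lemma biholomorphic_derivative_injective:
  assumes F: "biholomorphic2_on F U" and p: "p \<in> U"
  obtains L where "(F has_derivative L) (at p)" "\<And>c v. L (cmult2 c v) = cmult2 c (L v)" "\<And>v. L v = 0 \<Longrightarrow> v = 0"
proof -
  obtain L where L: "(F has_derivative L) (at p)" "\<forall>c v. L (cmult2 c v) = cmult2 c (L v)"
    using F p unfolding biholomorphic2_on_def holomorphic2_on_def by blast
  obtain M where M: "(inv_into U F has_derivative M) (at (F p))"
    using F p unfolding biholomorphic2_on_def holomorphic2_on_def by blast
  have "((\<lambda>x. inv_into U F (F x)) has_derivative (\<lambda>v. M (L v))) (at p)"
    by (rule has_derivative_compose[OF L(1) M])
  then have "((\<lambda>x. x) has_derivative (\<lambda>v. M (L v))) (at p)"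
    by (rule has_derivative_transform_within_open[of _ _ _ _ U])
       (use F p in \<open>auto simp: biholomorphic2_on_def\<close>)
  then have id: "(\<lambda>v. M (L v)) = (\<lambda>v. v)" using has_derivative_ident has_derivative_unique by blast
  have "v = 0" if "L v = 0" for v
  proof -
    have "M 0 = 0" using has_derivative_linear[OF M] by (rule linear_0)
    then show ?thesis using id that by metis
  qed
  then show ?thesis using that L by blast
qed

context conic
begin

text \<open>To be applied to the second component of a map into the normal form and to its
  conjugate. Weight by weight, after removal of the common lower part L, a polynomial in Z equals
  one in W on the conic, so both are constant there and only powers of t are left.\<close>

lemma first_variable_absent:
  assumes eq: "\<And>Z W. wfps C Z (H Z W) = wfps C' W (H Z W)"
    and H: "\<And>Z W. fps_nth (H Z W) 0 = Z * W + g * (Z\<^sup>2 + W\<^sup>2)"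
  shows "\<forall>j k. j + 2 * k = d \<longrightarrow> (j > 0 \<longrightarrow> C j k = 0 \<and> C' j k = 0) \<and> (j = 0 \<longrightarrow> C j k = C' j k)"
proof (induction d rule: less_induct)
  case (less d)
  define L :: "nat \<Rightarrow> nat \<Rightarrow> complex" where "L = (\<lambda>j k. if j = 0 \<and> 2 * k < d then C 0 k else 0)"
  have L: "j + 2 * k < d \<Longrightarrow> L j k = C j k" "j + 2 * k < d \<Longrightarrow> L j k = C' j k" "d \<le> j + 2 * k \<Longrightarrow> L j k = 0" for j k
    using less[of "j + 2 * k"] by (auto simp: L_def)
  have Lw: "wfps L Z H = wfps L W H" for Z W H
  proof -
    have "L (m - 2 * k) k * Z ^ (m - 2 * k) = L (m - 2 * k) k * W ^ (m - 2 * k)" for m k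
      by (cases "m - 2 * k = 0") (auto simp: L_def)
    then show ?thesis unfolding wfps_def by (simp only:)
  qed
  have pw: "wpoly C d Z (Z * W + g * (Z\<^sup>2 + W\<^sup>2)) = wpoly C' d W (Z * W + g * (Z\<^sup>2 + W\<^sup>2))" for Z W
  proof -
    have "fps_nth (wfps C Z (H Z W) - wfps L Z (H Z W)) d = fps_nth (wfps C' W (H Z W) - wfps L W (H Z W)) d"
      using eq[of Z W] Lw[of Z _ W] by simp
    then show ?thesis
      using wfps_diff_vanish(2)[of d L C Z "H Z W"] wfps_diff_vanish(2)[of d L C' W "H Z W"] L H by simp
  qed
  have pe: "poly (wpoly_poly C d) Z = poly (wpoly_poly C' d) W" if "Z * W + g * (Z\<^sup>2 + W\<^sup>2) = 1" for Z W
    using pw[of Z W] unfolding that poly_wpoly_poly .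
  then have deg: "degree (wpoly_poly C d) = 0 \<and> degree (wpoly_poly C' d) = 0" by (rule poly_eq_on_conic)
  obtain Z W where ZW: "Z * W + g * (Z\<^sup>2 + W\<^sup>2) = 1" by (rule conic_at_infinity) (rule that)
  obtain a b where ab: "wpoly_poly C d = [:a:]" "wpoly_poly C' d = [:b:]" using deg by (metis degree_eq_zeroE)
  have eq0: "wpoly_poly C d = wpoly_poly C' d" using pe[OF ZW] unfolding ab by simp
  show ?case
  proof (intro allI impI conjI)
    fix j k :: nat assume jk: "j + 2 * k = d"
    then have k: "k \<le> d div 2" "j = d - 2 * k" by auto
    have c: "coeff (wpoly_poly C d) j = C j k" "coeff (wpoly_poly C' d) j = C' j k"
      using coeff_wpoly_poly[OF k(1)] k(2) by simp_all
    show "C j k = 0" "C' j k = 0" if "j > 0" using c deg that coeff_eq_0 by metis+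
    show "C j k = C' j k" using c eq0 by simp
  qed
qed

end

lemma hs_small:
  assumes "e > 0"
  obtains d where "d > 0" "d \<le> 1/4" "\<And>z w. norm z < d \<Longrightarrow> norm w < d \<Longrightarrow> norm (hs g s z w) < e"
proof -
  have "(0, 0) \<in> bidisc (1/4)" by simp
  from hol2_imp_continuous_on[OF hs_hol2, unfolded continuous_on_iff, rule_format, OF this assms, of g s]
  obtain d where d: "d > 0"
    "\<forall>p\<in>bidisc (1/4). dist p (0, 0) < d \<longrightarrow> dist (hs g s (fst p) (snd p)) (hs g s (fst (0::complex, 0::complex)) (snd (0::complex, 0::complex))) < e"
    by (elim exE conjE) (rule that)
  have "norm (hs g s z w) < e" if "norm z < min (1/4) (d / 2)" "norm w < min (1/4) (d / 2)" for z w
  proof -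
    have "dist (z, w) (0, 0) < d"
      using that norm_Pair_le[of z w] by (simp add: dist_norm flip: zero_prod_def)
    then show ?thesis using bspec[OF d(2), of "(z, w)"] that by simp
  qed
  then show ?thesis using d(1) by (intro that[of "min (1/4) (d / 2)"]) auto
qed

lemma slice_derivatives:
  assumes L: "(F has_derivative L) (at (0, 0))" "\<And>c v. L (cmult2 c v) = cmult2 c (L v)"
  shows "((\<lambda>z. fst (F (z, 0))) has_field_derivative fst (L (1, 0))) (at 0)"
    "((\<lambda>z. snd (F (z, 0))) has_field_derivative snd (L (1, 0))) (at 0)"
    "((\<lambda>t. snd (F (0, t))) has_field_derivative snd (L (0, 1))) (at 0)"
proof -
  have c: "L (v, 0) = cmult2 v (L (1, 0))" "L (0, v) = cmult2 v (L (0, 1))" for v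
  proof -
    have "L (v, 0) = L (cmult2 v (1, 0))" "L (0, v) = L (cmult2 v (0, 1))" by (simp_all add: cmult2_def)
    then show "L (v, 0) = cmult2 v (L (1, 0))" "L (0, v) = cmult2 v (L (0, 1))" unfolding L(2) .
  qed
  have c': "(\<lambda>v. L (v, 0)) = (\<lambda>v. cmult2 v (L (1, 0)))" "(\<lambda>v. L (0, v)) = (\<lambda>v. cmult2 v (L (0, 1)))"
    by (rule ext, rule c)+
  have m: "(\<lambda>v. fst (cmult2 v p)) = times (fst p)" "(\<lambda>v. snd (cmult2 v p)) = times (snd p)" for p
    by (rule ext, simp add: cmult2_def)+
  have "((\<lambda>z. F (z, 0)) has_derivative (\<lambda>v. L (v, 0))) (at 0)"
    by (rule has_derivative_compose[OF has_derivative_Pair[OF has_derivative_ident has_derivative_const] L(1)])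
  then have 1: "((\<lambda>z. F (z, 0)) has_derivative (\<lambda>v. cmult2 v (L (1, 0)))) (at 0)" unfolding c'(1) .
  have "((\<lambda>z. F (0, z)) has_derivative (\<lambda>v. L (0, v))) (at 0)"
    by (rule has_derivative_compose[OF has_derivative_Pair[OF has_derivative_const has_derivative_ident] L(1)])
  then have 2: "((\<lambda>z. F (0, z)) has_derivative (\<lambda>v. cmult2 v (L (0, 1)))) (at 0)" unfolding c'(2) .
  show "((\<lambda>z. fst (F (z, 0))) has_field_derivative fst (L (1, 0))) (at 0)"
    unfolding has_field_derivative_def using has_derivative_fst[OF 1] unfolding m .
  show "((\<lambda>z. snd (F (z, 0))) has_field_derivative snd (L (1, 0))) (at 0)"
    unfolding has_field_derivative_def using has_derivative_snd[OF 1] unfolding m .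
  show "((\<lambda>t. snd (F (0, t))) has_field_derivative snd (L (0, 1))) (at 0)"
    unfolding has_field_derivative_def using has_derivative_snd[OF 2] unfolding m .
qed

text \<open>The derivative is triangular and injective, so both diagonal entries are
  nonzero.\<close>

lemma derivative_components_nonzero:
  assumes L: "\<And>c v. L (cmult2 c v) = cmult2 c (L v)" "\<And>v. L v = 0 \<Longrightarrow> v = 0" "linear L"
    and z: "snd (L (1, 0)) = 0"
  shows "fst (L (1, 0)) \<noteq> 0" "snd (L (0, 1)) \<noteq> 0"
proof -
  show 1: "fst (L (1, 0)) \<noteq> 0"
  proof
    assume "fst (L (1, 0)) = 0"
    then have "L (1, 0) = 0" using z by (simp add: prod_eq_iff)
    then have "(1, 0) = (0 :: complex \<times> complex)" by (rule L(2))
    then show False by (simp add: zero_prod_def)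
  qed
  show "snd (L (0, 1)) \<noteq> 0"
  proof
    assume b: "snd (L (0, 1)) = 0"
    define v where "v = cmult2 (- fst (L (0, 1))) (1, 0) + cmult2 (fst (L (1, 0))) (0, 1)"
    have "L v = cmult2 (- fst (L (0, 1))) (L (1, 0)) + cmult2 (fst (L (1, 0))) (L (0, 1))"
      unfolding v_def using linear_add[OF L(3)] L(1) by simp
    also have "\<dots> = 0" using z b by (simp add: cmult2_def zero_prod_def)
    finally have "v = 0" by (rule L(2))
    then show False using 1 by (simp add: v_def cmult2_def zero_prod_def)
  qed
qed

context conic
begin

text \<open>The equations of the target surface, polarized, say that k depends on t alone and that f
  and its conjugate satisfy the normal form over k. Two units in t then restore t on the left side
  and the coefficient 1 of z in the map, at the price of general a2, a3, a4.\<close>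

lemma biholomorphic_imp_nf:
  fixes \<gamma> \<epsilon> s r :: real
  assumes g: "g = of_real \<gamma>" and F: "biholomorphic2_on F U" "0 \<in> U" "F 0 = 0" and \<sigma>: "\<epsilon> = 0 \<or> \<sigma> > 0"
    and r: "r > 0" and surf: "\<And>z. norm z < r \<Longrightarrow> (z, hs g s z (cnj z)) \<in> U \<Longrightarrow> F (z, hs g s z (cnj z)) \<in> normal_surf \<gamma> \<epsilon> \<sigma>"
  shows "\<exists>X. is_nf g (hs g s) X"
proof -
  define h where "h = hs g s"
  define f k where "f = (\<lambda>p. fst (F p))" and "k = (\<lambda>p. snd (F p))"
  define fh kh where "fh = (\<lambda>p. cnj (f (cnj (fst p), cnj (snd p))))" and "kh = (\<lambda>p. cnj (k (cnj (fst p), cnj (snd p))))"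
  have hU: "holomorphic2_on F U" "open U" using F(1) by (auto simp: biholomorphic2_on_def)
  obtain e where e: "e > 0" "ball 0 e \<subseteq> U" using hU(2) F(2) open_contains_ball by blast
  define \<rho>1 where "\<rho>1 = e / 2"
  have \<rho>1: "\<rho>1 > 0" using e by (simp add: \<rho>1_def)
  have sub: "bidisc \<rho>1 \<subseteq> U"
  proof
    fix p assume "p \<in> bidisc \<rho>1"
    then have "norm p < e" using norm_Pair_le[of "fst p" "snd p"] by (auto simp: \<rho>1_def mem_Times_iff)
    then show "p \<in> U" using e by auto
  qed
  have fk: "hol2 f (bidisc \<rho>1)" "hol2 k (bidisc \<rho>1)"
    unfolding f_def k_def using hol2_subset[OF _ sub] holomorphic2_imp_hol2[OF hU(1)] by blast+
  have fkh: "hol2 fh (bidisc \<rho>1)" "hol2 kh (bidisc \<rho>1)"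
    unfolding fh_def kh_def by (rule hol2_cnj[OF fk(1)] hol2_cnj[OF fk(2)]; auto simp: mem_Times_iff)+
  obtain d where d: "d > 0" "d \<le> 1/4" "\<And>z w. norm z < d \<Longrightarrow> norm w < d \<Longrightarrow> norm (h z w) < \<rho>1 / 2"
    by (rule hs_small[OF half_gt_zero[OF \<rho>1], of g s, folded h_def]) (rule that)
  define \<rho>2 where "\<rho>2 = min d (min r (\<rho>1 / 2))"
  have \<rho>2: "\<rho>2 > 0" "\<rho>2 \<le> d" "\<rho>2 \<le> r" "\<rho>2 \<le> \<rho>1 / 2" using d r \<rho>1 by (auto simp: \<rho>2_def)
  have hb: "norm (h z w) < \<rho>1 / 2" if "norm z < \<rho>2" "norm w < \<rho>2" for z w using d(3) that \<rho>2 by force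
  have hh: "hol2 (\<lambda>p. h (fst p) (snd p)) (bidisc \<rho>2)"
    unfolding h_def by (rule hol2_subset[OF hs_hol2]) (use \<rho>2 d in \<open>auto simp: mem_Times_iff\<close>)
  have comp: "hol2 (\<lambda>p. G (fst p, h (fst p) (snd p))) (bidisc \<rho>2)" "hol2 (\<lambda>p. G (snd p, h (fst p) (snd p))) (bidisc \<rho>2)"
    if "hol2 G (bidisc \<rho>1)" for G
  proof -
    have dom: "fst p \<in> ball 0 \<rho>1" "snd p \<in> ball 0 \<rho>1" "h (fst p) (snd p) \<in> ball 0 \<rho>1" if "p \<in> bidisc \<rho>2" for p
      using that hb[of "fst p" "snd p"] \<rho>2 \<rho>1 by (auto simp: mem_Times_iff)
    show "hol2 (\<lambda>p. G (fst p, h (fst p) (snd p))) (bidisc \<rho>2)" "hol2 (\<lambda>p. G (snd p, h (fst p) (snd p))) (bidisc \<rho>2)"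
      by (rule hol2_compose2[OF that _ hh]; use dom in \<open>auto intro: hol2_fst hol2_snd\<close>)+
  qed
  \<comment> \<open>Polarization: w replaces \<open>cnj z\<close>, so reality of k and the equation
    of the target become holomorphic equations in (z, w).\<close>
  define \<Phi>1 where "\<Phi>1 = (\<lambda>p. k (fst p, h (fst p) (snd p)) - kh (snd p, h (fst p) (snd p)))"
  define \<Phi>2 where "\<Phi>2 = (\<lambda>p. k (fst p, h (fst p) (snd p)) -
     (f (fst p, h (fst p) (snd p)) * fh (snd p, h (fst p) (snd p)) + (g + of_real \<epsilon> * k (fst p, h (fst p) (snd p)) ^ \<sigma>) *
       (f (fst p, h (fst p) (snd p)) ^ 2 + fh (snd p, h (fst p) (snd p)) ^ 2)))"
  have \<Phi>h: "hol2 \<Phi>1 (bidisc \<rho>2)" "hol2 \<Phi>2 (bidisc \<rho>2)"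
    unfolding \<Phi>1_def \<Phi>2_def
    by (intro hol2_diff hol2_add hol2_mult hol2_power hol2_const comp(1)[OF fk(1)] comp(1)[OF fk(2)] comp(2)[OF fkh(1)] comp(2)[OF fkh(2)])+
  have \<Phi>0: "\<Phi>1 (z, cnj z) = 0 \<and> \<Phi>2 (z, cnj z) = 0" if z: "norm z < \<rho>2" for z
  proof -
    define t where "t = h z (cnj z)"
    have ct: "cnj t = t" unfolding t_def h_def g by (subst hs_cnj) (simp add: hs_commute)
    have "(z, t) \<in> U" using sub hb[of z "cnj z"] z \<rho>2 \<rho>1 by (auto simp: t_def)
    then have "F (z, t) \<in> normal_surf \<gamma> \<epsilon> \<sigma>" using surf[of z] z \<rho>2 by (simp add: t_def h_def)
    then have im: "Im (k (z, t)) = 0" and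
      eq: "complex_of_real (Re (k (z, t))) = f (z, t) * cnj (f (z, t)) + of_real (\<gamma> + \<epsilon> * (Re (k (z, t))) ^ \<sigma>) * (f (z, t) ^ 2 + cnj (f (z, t)) ^ 2)"
      by (auto simp: normal_surf_def f_def k_def)
    have kr: "complex_of_real (Re (k (z, t))) = k (z, t)" using im by (simp add: complex_eq_iff)
    have "kh (cnj z, t) = k (z, t)" using im by (simp add: kh_def ct complex_eq_iff)
    moreover have "fh (cnj z, t) = cnj (f (z, t))" by (simp add: fh_def ct)
    moreover have "of_real (\<gamma> + \<epsilon> * (Re (k (z, t))) ^ \<sigma>) = g + of_real \<epsilon> * k (z, t) ^ \<sigma>"
      by (simp only: g of_real_add of_real_mult of_real_power kr)
    ultimately show ?thesis
      using eq unfolding \<Phi>1_def \<Phi>2_def fst_conv snd_conv t_def[symmetric] kr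
      by (simp only: diff_self simp_thms)
  qed
  have I: "k (z, h z w) = kh (w, h z w)"
    "k (z, h z w) = f (z, h z w) * fh (w, h z w) + (g + of_real \<epsilon> * k (z, h z w) ^ \<sigma>) * (f (z, h z w) ^ 2 + fh (w, h z w) ^ 2)"
    if "norm z < \<rho>2 / 2" "norm w < \<rho>2 / 2" for z w
  proof -
    have "\<Phi>1 (z, w) = 0" "\<Phi>2 (z, w) = 0"
      using vanish_on_antidiagonal[OF \<Phi>h(1) conjunct1[OF \<Phi>0] that] vanish_on_antidiagonal[OF \<Phi>h(2) conjunct2[OF \<Phi>0] that] by blast+
    then show "k (z, h z w) = kh (w, h z w)"
      "k (z, h z w) = f (z, h z w) * fh (w, h z w) + (g + of_real \<epsilon> * k (z, h z w) ^ \<sigma>) * (f (z, h z w) ^ 2 + fh (w, h z w) ^ 2)"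
      unfolding \<Phi>1_def \<Phi>2_def fst_conv snd_conv right_minus_eq by blast+
  qed
  obtain Ck B1 K1 where Ck: "geo_bound Ck B1 K1"
    "\<And>z w. norm z < \<rho>1 / 2 \<Longrightarrow> norm w < \<rho>1 / 2 \<Longrightarrow> ((\<lambda>(i,j). Ck i j * z ^ i * w ^ j) has_sum k (z, w)) UNIV"
    by (rule hol2_wsum[OF fk(2) \<rho>1]) (rule that)
  obtain Dk B2 K2 where Dk: "geo_bound Dk B2 K2"
    "\<And>z w. norm z < \<rho>1 / 2 \<Longrightarrow> norm w < \<rho>1 / 2 \<Longrightarrow> ((\<lambda>(i,j). Dk i j * z ^ i * w ^ j) has_sum kh (z, w)) UNIV"
    by (rule hol2_wsum[OF fkh(2) \<rho>1]) (rule that)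
  note Ckw = has_sum_imp_wsum[OF Ck(2)] and Dkw = has_sum_imp_wsum[OF Dk(2)]
  have "\<exists>H. (\<lambda>x. h0r g Z W x + of_real s * pertr g Z W x) has_fps_expansion H \<and> fps_nth H 0 = Z * W + g * (Z\<^sup>2 + W\<^sup>2)" for Z W
    by (rule hs_reduced_fps[of g Z W s]) blast
  then obtain H where H: "\<And>Z W. (\<lambda>x. h0r g Z W x + of_real s * pertr g Z W x) has_fps_expansion H Z W"
    "\<And>Z W. fps_nth (H Z W) 0 = Z * W + g * (Z\<^sup>2 + W\<^sup>2)" by metis
  have "wfps Ck Z (H Z W) = wfps Dk W (H Z W)" for Z W
  proof -
    define q where "q = (\<lambda>x. h0r g Z W x + of_real s * pertr g Z W x)"
    have q: "h (x * Z) (x * W) = x\<^sup>2 * q x" for x by (simp only: h_def q_def hs_scale)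
    have 1: "(\<lambda>x. wsum Ck (x * Z) (x\<^sup>2 * q x)) has_fps_expansion wfps Ck Z (H Z W)"
      unfolding q_def by (rule wsum_fps[OF Ck(1) H(1)])
    have 2: "(\<lambda>x. wsum Dk (x * W) (x\<^sup>2 * q x)) has_fps_expansion wfps Dk W (H Z W)"
      unfolding q_def by (rule wsum_fps[OF Dk(1) H(1)])
    have "\<forall>\<^sub>F x in nhds 0. norm (x * Z) < \<rho>2 / 2" "\<forall>\<^sub>F x in nhds 0. norm (x * W) < \<rho>2 / 2"
      using \<rho>2(1) by (intro eventually_norm_scaled_less; simp)+
    then have ev: "\<forall>\<^sub>F x in nhds 0. wsum Ck (x * Z) (x\<^sup>2 * q x) = wsum Dk (x * W) (x\<^sup>2 * q x)"
    proof eventually_elim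
      case (elim x)
      then have b: "norm (x * Z) < \<rho>1 / 2" "norm (x * W) < \<rho>1 / 2" "norm (h (x * Z) (x * W)) < \<rho>1 / 2"
        using hb[of "x * Z" "x * W"] \<rho>2 by auto
      show ?case using I(1)[OF elim] Ckw[OF b(1,3)] Dkw[OF b(2,3)] by (simp only: q)
    qed
    have "(\<lambda>x. wsum Ck (x * Z) (x\<^sup>2 * q x)) has_fps_expansion wfps Dk W (H Z W)"
      by (subst has_fps_expansion_cong[OF ev refl]) (rule 2)
    then show ?thesis using 1 fps_expansion_unique_complex by blast
  qed
  from first_variable_absent[OF this H(2)] have Ck0: "Ck i j = 0" if "i > 0" for i j using that by blast
  \<comment> \<open>The first polarized equation equates a series in z and t with one in w and t;
    therefore z is absent from k.\<close>
  define \<kappa> where "\<kappa> = (\<lambda>t. k (0, t))"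
  have k\<kappa>: "k (z, t) = \<kappa> t" if "norm z < \<rho>1 / 2" "norm t < \<rho>1 / 2" for z t
  proof -
    have "k (z, t) = wsum Ck z t" using Ckw[OF that] by simp
    also have "\<dots> = wsum Ck 0 t" by (rule wsum_no_first[OF Ck0])
    also have "\<dots> = \<kappa> t" using Ckw[of 0 t] that \<rho>1 by (simp add: \<kappa>_def)
    finally show ?thesis .
  qed
  define r0 where "r0 = (\<lambda>t. deriv (\<lambda>z. f (z, t)) 0)"
  have r0h: "r0 holomorphic_on ball 0 \<rho>1" using Taylor_coeff_holomorphic[OF fk(1), of 1] by (simp add: r0_def)
  have \<kappa>h: "\<kappa> holomorphic_on ball 0 \<rho>1" unfolding \<kappa>_def by (rule hol2_slices(2)[OF fk(2)]) (use \<rho>1 in simp)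
  obtain L where L: "(F has_derivative L) (at 0)" "\<And>c v. L (cmult2 c v) = cmult2 c (L v)" "\<And>v. L v = 0 \<Longrightarrow> v = 0"
    by (rule biholomorphic_derivative_injective[OF F(1,2)]) (rule that)
  note sd = slice_derivatives[OF L(1)[unfolded zero_prod_def] L(2)]
  have "((\<lambda>z. k (z, 0)) has_field_derivative 0) (at 0)"
  proof (rule has_field_derivative_transform_within_open[of "\<lambda>_. \<kappa> 0" 0 0 "ball 0 (\<rho>1 / 2)"])
    show "\<kappa> 0 = k (z, 0)" if "z \<in> ball 0 (\<rho>1 / 2)" for z using k\<kappa>[of z 0] that \<rho>1 by simp
  qed (use \<rho>1 in auto)
  then have Lz: "snd (L (1, 0)) = 0" using sd(2) DERIV_unique unfolding k_def by blast
  note nz = derivative_components_nonzero[OF L(2,3) has_derivative_linear[OF L(1)] Lz]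
  have r00: "r0 0 \<noteq> 0" using nz(1) DERIV_imp_deriv[OF sd(1)] by (simp add: r0_def f_def)
  have d\<kappa>: "deriv \<kappa> 0 \<noteq> 0" using nz(2) DERIV_imp_deriv[OF sd(3)] by (simp add: \<kappa>_def k_def)
  have \<kappa>0: "\<kappa> 0 = 0" using F(3) by (simp add: \<kappa>_def k_def zero_prod_def)
  \<comment> \<open>The quotient of \<open>\<kappa>\<close> by t with its removable singularity
    filled in; like \<open>r0\<close> it is nonzero near 0 because the derivative of F is invertible
    and triangular.\<close>
  define b where "b = (\<lambda>t. if t = 0 then deriv \<kappa> 0 else (\<kappa> t - \<kappa> 0) / (t - 0))"
  have bh: "b holomorphic_on ball 0 \<rho>1" unfolding b_def by (rule pole_lemma_open[OF \<kappa>h open_ball])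
  have tb: "t * b t = \<kappa> t" for t by (simp add: b_def \<kappa>0)
  have "continuous_on (ball 0 \<rho>1) (\<lambda>t. b t * r0 t)"
    by (intro continuous_on_mult holomorphic_on_imp_continuous_on bh r0h)
  moreover have m0: "b 0 * r0 0 \<noteq> 0" using r00 d\<kappa> by (simp add: b_def)
  moreover have "0 \<in> ball (0::complex) \<rho>1" using \<rho>1 by simp
  ultimately obtain \<delta> where \<delta>: "\<delta> > 0" "\<And>t. t \<in> ball 0 \<rho>1 \<Longrightarrow> dist t 0 < \<delta> \<Longrightarrow> dist (b t * r0 t) (b 0 * r0 0) < norm (b 0 * r0 0)"
    unfolding continuous_on_iff by (meson zero_less_norm_iff)
  define \<rho>3 where "\<rho>3 = min \<delta> (\<rho>1 / 2)"
  have \<rho>3: "\<rho>3 > 0" "\<rho>3 \<le> \<rho>1 / 2" using \<delta> \<rho>1 by (auto simp: \<rho>3_def)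
  have ne: "b t \<noteq> 0" "r0 t \<noteq> 0" if "t \<in> ball 0 \<rho>3" for t
  proof -
    have "b t * r0 t \<noteq> 0"
    proof
      assume "b t * r0 t = 0"
      then show False using \<delta>(2)[of t] that \<rho>1 by (auto simp: \<rho>3_def dist_norm)
    qed
    then show "b t \<noteq> 0" "r0 t \<noteq> 0" by auto
  qed
  have s3: "ball 0 \<rho>3 \<subseteq> ball 0 \<rho>1" using \<rho>3 \<rho>1 by auto
  define rh where "rh = (\<lambda>t. cnj (r0 (cnj t)))"
  have r0h3: "r0 holomorphic_on ball 0 \<rho>3" and bh3: "b holomorphic_on ball 0 \<rho>3" and \<kappa>h3: "\<kappa> holomorphic_on ball 0 \<rho>3"
    by (rule holomorphic_on_subset[OF _ s3], fact)+
  have rhh: "rh holomorphic_on ball 0 \<rho>3"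
  proof -
    have "cnj ` ball 0 \<rho>3 = ball 0 \<rho>3"
    proof (intro equalityI subsetI)
      fix x assume "x \<in> ball (0::complex) \<rho>3"
      then show "x \<in> cnj ` ball 0 \<rho>3" by (intro image_eqI[of _ _ "cnj x"]) simp_all
    qed auto
    then show ?thesis
      unfolding rh_def using holomorphic_on_compose_cnj_cnj[of r0 "ball 0 \<rho>3"] r0h3 by (simp add: o_def)
  qed
  define u where "u = (\<lambda>p. f p / r0 (snd p))"
  have uh: "hol2 u (bidisc \<rho>3)"
    unfolding u_def
    by (intro hol2_divide hol2_subset[OF fk(1)] hol2_compose1[OF hol2_snd r0h3]) (use s3 ne in auto)
  \<comment> \<open>Result of substituting \<open>f = u * r0\<close> and \<open>k = t * b\<close> in
    the polarized equation and dividing by b.\<close>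
  define a2 a3 a4 where "a2 = (\<lambda>t. r0 t * rh t / b t)" and "a3 = (\<lambda>t. (g + of_real \<epsilon> * \<kappa> t ^ \<sigma>) * r0 t ^ 2 / b t)"
    and "a4 = (\<lambda>t. (g + of_real \<epsilon> * \<kappa> t ^ \<sigma>) * rh t ^ 2 / b t)"
  have ah: "a2 holomorphic_on ball 0 \<rho>3" "a3 holomorphic_on ball 0 \<rho>3" "a4 holomorphic_on ball 0 \<rho>3"
    unfolding a2_def a3_def a4_def using ne by (auto intro!: holomorphic_intros r0h3 rhh bh3 \<kappa>h3)
  have one: "\<exists>C B K. geo_bound C B K \<and> (\<forall>j>0. \<forall>i. C j i = 0) \<and> (\<forall>t. norm t < \<rho>3 / 2 \<longrightarrow> wsum C 0 t = a t)"
    if a: "a holomorphic_on ball 0 \<rho>3" for a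
  proof -
    have "hol2 (\<lambda>p. a (snd p)) (bidisc \<rho>3)" by (rule hol2_compose1[OF hol2_snd a]) auto
    then obtain C B K where C: "geo_bound C B K"
      "\<And>j w. norm w < \<rho>3 / 2 \<Longrightarrow> (\<lambda>k. C j k * w ^ k) sums ((deriv ^^ j) (\<lambda>z. a (snd (z, w))) 0 / fact j)"
      "\<And>z w. norm z < \<rho>3 / 2 \<Longrightarrow> norm w < \<rho>3 / 2 \<Longrightarrow> ((\<lambda>(j,k). C j k * z ^ j * w ^ k) has_sum a (snd (z, w))) UNIV"
      by (rule hol2_wsum[OF _ \<rho>3(1)]) (rule that)
    have "C j i = 0" if "j > 0" for j i
    proof -
      have "(\<lambda>k. C j k * w ^ k) sums 0" if "norm w < \<rho>3 / 2" for w
        using C(2)[OF that, of j] \<open>j > 0\<close> by (simp add: higher_deriv_const)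
      from power_series_const[OF half_gt_zero[OF \<rho>3(1)] this] show ?thesis by (cases "i = 0") simp_all
    qed
    moreover have "wsum C 0 t = a t" if "norm t < \<rho>3 / 2" for t
      using has_sum_imp_wsum[OF C(3)[of 0 t]] that \<rho>3 by simp
    ultimately show ?thesis using C(1) by blast
  qed
  obtain C2 M2 N2 where C2: "geo_bound C2 M2 N2" "\<And>j i. j > 0 \<Longrightarrow> C2 j i = 0" "\<And>t. norm t < \<rho>3 / 2 \<Longrightarrow> wsum C2 0 t = a2 t" using one[OF ah(1)] by blast
  obtain C3 M3 N3 where C3: "geo_bound C3 M3 N3" "\<And>j i. j > 0 \<Longrightarrow> C3 j i = 0" "\<And>t. norm t < \<rho>3 / 2 \<Longrightarrow> wsum C3 0 t = a3 t" using one[OF ah(2)] by blast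
  obtain C4 M4 N4 where C4: "geo_bound C4 M4 N4" "\<And>j i. j > 0 \<Longrightarrow> C4 j i = 0" "\<And>t. norm t < \<rho>3 / 2 \<Longrightarrow> wsum C4 0 t = a4 t" using one[OF ah(3)] by blast
  obtain A M0 N0 where A: "geo_bound A M0 N0"
    "\<And>j w. norm w < \<rho>3 / 2 \<Longrightarrow> (\<lambda>k. A j k * w ^ k) sums ((deriv ^^ j) (\<lambda>z. u (z, w)) 0 / fact j)"
    "\<And>z w. norm z < \<rho>3 / 2 \<Longrightarrow> norm w < \<rho>3 / 2 \<Longrightarrow> ((\<lambda>(j,k). A j k * z ^ j * w ^ k) has_sum u (z, w)) UNIV"
    by (rule hol2_wsum[OF uh \<rho>3(1)]) (rule that)
  have A00: "A 0 0 = 0"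
  proof -
    have "(\<lambda>k. A 0 k * 0 ^ k) sums u (0, 0)" using A(2)[of 0 0] \<rho>3 by simp
    moreover have "u (0, 0) = 0" using F(3) by (simp add: u_def f_def zero_prod_def)
    ultimately show ?thesis using powser_sums_zero sums_unique2 by metis
  qed
  have "(\<lambda>k. A 1 k * t ^ k) sums 1" if t: "norm t < \<rho>3 / 2" for t
  proof -
    have "norm t < \<rho>3" using t norm_ge_zero[of t] \<rho>3(1) by linarith
    then have t3: "t \<in> ball 0 \<rho>3" by simp
    have "(\<lambda>z. f (z, t)) holomorphic_on ball 0 \<rho>1" using hol2_slices(1)[OF fk(1)] t3 s3 by blast
    then have "((\<lambda>z. f (z, t)) has_field_derivative r0 t) (at 0)"
      unfolding r0_def by (rule holomorphic_derivI[OF _ open_ball]) (use \<rho>1 in simp)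
    then have "((\<lambda>z. u (z, t)) has_field_derivative r0 t / r0 t) (at 0)"
      unfolding u_def snd_conv by (rule DERIV_cdivide)
    then have "deriv (\<lambda>z. u (z, t)) 0 = 1" using ne(2)[OF t3] by (simp add: DERIV_imp_deriv)
    then show ?thesis using A(2)[OF t, of 1] by simp
  qed
  note A1 = power_series_const[OF half_gt_zero[OF \<rho>3(1)] this]
  define X where "X = (\<lambda>(i::nat) j k. if i = 0 then A j k else if i = 1 then cnj (A j k) else if i = 2 then C2 j k
     else if i = 3 then C3 j k else C4 j k)"
  have Xi: "X 0 = A" "X 1 = (\<lambda>j k. cnj (A j k))" "X 2 = C2" "X 3 = C3" "X 4 = C4" by (auto simp: X_def fun_eq_iff)
  define MM KK where "MM = M0 + M2 + M3 + M4" and "KK = N0 + N2 + N3 + N4"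
  have pos: "M0 > 0" "N0 > 0" "M2 > 0" "N2 > 0" "M3 > 0" "N3 > 0" "M4 > 0" "N4 > 0"
    using A(1) C2(1) C3(1) C4(1) by (auto simp: geo_bound_def)
  have A': "geo_bound (\<lambda>j k. cnj (A j k)) M0 N0" using A(1) by (simp add: geo_bound_def)
  have gb: "geo_bound (X i) MM KK" if "i < 5" for i
  proof -
    have "i = 0 \<or> i = 1 \<or> i = 2 \<or> i = 3 \<or> i = 4" using that by auto
    then show ?thesis
    proof (elim disjE)
      assume "i = 0" then show ?thesis unfolding \<open>i = 0\<close> Xi by (rule_tac geo_bound_mono[OF A(1)]) (use pos in \<open>auto simp: MM_def KK_def\<close>)
    next
      assume "i = 1" then show ?thesis unfolding \<open>i = 1\<close> Xi by (rule_tac geo_bound_mono[OF A']) (use pos in \<open>auto simp: MM_def KK_def\<close>)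
    next
      assume "i = 2" then show ?thesis unfolding \<open>i = 2\<close> Xi by (rule_tac geo_bound_mono[OF C2(1)]) (use pos in \<open>auto simp: MM_def KK_def\<close>)
    next
      assume "i = 3" then show ?thesis unfolding \<open>i = 3\<close> Xi by (rule_tac geo_bound_mono[OF C3(1)]) (use pos in \<open>auto simp: MM_def KK_def\<close>)
    next
      assume "i = 4" then show ?thesis unfolding \<open>i = 4\<close> Xi by (rule_tac geo_bound_mono[OF C4(1)]) (use pos in \<open>auto simp: MM_def KK_def\<close>)
    qed
  qed
  obtain d4 where d4: "d4 > 0" "\<And>z w. norm z < d4 \<Longrightarrow> norm w < d4 \<Longrightarrow> norm (h z w) < \<rho>3 / 2"
    by (rule hs_small[OF half_gt_zero[OF \<rho>3(1)], of g s, folded h_def]) (rule that)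
  define \<rho>4 where "\<rho>4 = min d4 (min (\<rho>3 / 2) (\<rho>2 / 2))"
  have \<rho>4: "\<rho>4 > 0" using d4 \<rho>3 \<rho>2 by (simp add: \<rho>4_def)
  have val: "h z w = nf_val X z w (h z w)" if zw: "norm z < \<rho>4" "norm w < \<rho>4" for z w
  proof -
    define t where "t = h z w"
    have t: "norm t < \<rho>3 / 2" using d4(2)[of z w] zw by (simp add: t_def \<rho>4_def)
    have zw3: "norm z < \<rho>3 / 2" "norm w < \<rho>3 / 2" and zw2: "norm z < \<rho>2 / 2" "norm w < \<rho>2 / 2" using zw by (auto simp: \<rho>4_def)
    have "norm t < \<rho>3" using t norm_ge_zero[of t] \<rho>3(1) by linarith
    then have t3: "t \<in> ball 0 \<rho>3" "cnj t \<in> ball 0 \<rho>3" by simp_all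
    have wA: "wsum (X 0) z t = u (z, t)" unfolding Xi by (rule has_sum_imp_wsum[OF A(3)[OF zw3(1) t]])
    have wB: "wsum (X 1) w t = cnj (u (cnj w, cnj t))"
    proof -
      have "((\<lambda>p. cnj (case p of (j,k) \<Rightarrow> A j k * cnj w ^ j * cnj t ^ k)) has_sum cnj (u (cnj w, cnj t))) UNIV"
        using A(3)[of "cnj w" "cnj t"] zw3 t by simp
      then show ?thesis unfolding Xi by (intro has_sum_imp_wsum) (simp add: case_prod_unfold)
    qed
    have w2: "wsum (X 2) 0 t = a2 t" "wsum (X 3) 0 t = a3 t" "wsum (X 4) 0 t = a4 t"
      unfolding Xi using C2(3) C3(3) C4(3) t by blast+
    have fu: "f (z, t) = u (z, t) * r0 t" using ne(2)[OF t3(1)] by (simp add: u_def)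
    have fhu: "fh (w, t) = cnj (u (cnj w, cnj t)) * rh t" using ne(2)[OF t3(2)] by (simp add: u_def fh_def rh_def)
    have kt: "k (z, t) = t * b t" unfolding tb using k\<kappa>[of z t] zw3 t \<rho>3 by simp
    have "t * b t = f (z, t) * fh (w, t) + (g + of_real \<epsilon> * \<kappa> t ^ \<sigma>) * (f (z, t) ^ 2 + fh (w, t) ^ 2)"
      using I(2)[OF zw2] unfolding t_def[symmetric] kt by (simp only: tb)
    then have "t = (f (z, t) * fh (w, t) + (g + of_real \<epsilon> * \<kappa> t ^ \<sigma>) * (f (z, t) ^ 2 + fh (w, t) ^ 2)) / b t"
      using ne(1)[OF t3(1)] by (simp add: eq_divide_eq)
    also have "\<dots> = nf_val X z w t"
      unfolding nf_val_def wA wB w2 fu fhu a2_def a3_def a4_def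
      by (simp add: add_divide_distrib algebra_simps power2_eq_square)
    finally show ?thesis by (simp add: t_def)
  qed
  have nm: "X i 0 0 = 0 \<and> X i 1 0 = 1" if "i < 2" for i
    using that A00 A1 by (auto simp: X_def)
  have fps: "fps_X\<^sup>2 * H Z W = nf_fps X Z W (H Z W)" for Z W
    by (rule nf_val_imp_fps[where h=h, OF gb \<rho>4 val _ H(1)]) (auto simp: h_def hs_scale)
  \<comment> \<open>The lowest order of the equation fixes the quadratic form at
    \<open>t = 0\<close>, so the values of b and \<open>r0\<close> at 0 leave no freedom
    there.\<close>
  have q: "Z * W + g * (Z\<^sup>2 + W\<^sup>2) = X 2 0 0 * (Z * W) + X 3 0 0 * Z\<^sup>2 + X 4 0 0 * W\<^sup>2" for Z W
  proof -
    have "fps_nth (fps_X\<^sup>2 * H Z W) 2 = Z * W + g * (Z\<^sup>2 + W\<^sup>2)" by (simp add: fps_X_power_mult_nth H(2))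
    moreover have "fps_nth (nf_fps X Z W (H Z W)) 2 = X 2 0 0 * (Z * W) + X 3 0 0 * Z\<^sup>2 + X 4 0 0 * W\<^sup>2"
      by (rule nf_fps_nth_2) (rule nm)
    ultimately show ?thesis unfolding fps by (simp only:)
  qed
  have "X 3 0 0 = g" "X 4 0 0 = g" using q[of 1 0] q[of 0 1] by simp_all
  moreover from this have "X 2 0 0 = 1" using q[of 1 1] by simp
  ultimately have "normalized g X"
    unfolding normalized_def using nm A1(2) C2(2) C3(2) C4(2) by (auto simp: X_def)
  then have "is_nf g h X" unfolding is_nf_def using gb \<rho>4 val by blast
  then show ?thesis unfolding h_def by blast
qed

end

subsection \<open>Non-normalizable surfaces\<close>

lemma has_sum_imp_diagonal_sums:
  assumes "((\<lambda>(j,k). c j k * z ^ j * w ^ k) has_sum S) UNIV"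
  shows "(\<lambda>m. \<Sum>k\<le>m. c (m - k) k * z ^ (m - k) * w ^ k) sums (S :: complex)"
proof -
  define f where "f = (\<lambda>(m::nat,k::nat). (m - k, k))"
  have bij: "bij_betw f (Sigma UNIV (\<lambda>m. {..m})) UNIV"
    by (rule bij_betwI[where g="\<lambda>(j,k). (j + k, k)"]) (auto simp: f_def)
  have "((\<lambda>p. (\<lambda>(j,k). c j k * z ^ j * w ^ k) (f p)) has_sum S) (Sigma UNIV (\<lambda>m. {..m}))"
    using has_sum_reindex_bij_betw[OF bij] assms by blast
  then have "((\<lambda>(m,k). c (m - k) k * z ^ (m - k) * w ^ k) has_sum S) (Sigma UNIV (\<lambda>m. {..m}))"
    by (simp add: f_def case_prod_unfold)
  then have "((\<lambda>m. \<Sum>k\<le>m. c (m - k) k * z ^ (m - k) * w ^ k) has_sum S) UNIV"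
    by (rule has_sum_SigmaD) (auto simp: has_sum_finite_iff)
  then show ?thesis by (rule has_sum_imp_sums)
qed

text \<open>On every line through the origin the reduced function has constant term
  \<open>Z W + g (Z^2 + W^2)\<close>, so the remainder starts with \<open>x^3\<close>; its
  homogeneous parts of degree below 3 vanish at all (Z, W).\<close>

lemma hs_remainder_coeffs:
  assumes r: "r > 0" and c: "\<And>z w. norm z < r \<Longrightarrow> norm w < r \<Longrightarrow>
     ((\<lambda>(j,k). c j k * z ^ j * w ^ k) has_sum (hs g s z w - (z * w + g * (z\<^sup>2 + w\<^sup>2)))) UNIV"
    and jk: "j + k < 3"
  shows "c j k = 0"
proof -
  have part: "(\<Sum>k\<le>m. c (m - k) k * Z ^ (m - k) * W ^ k) = 0" if m: "m < 3" for m Z W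
  proof -
    obtain H where H: "(\<lambda>x. h0r g Z W x + of_real s * pertr g Z W x) has_fps_expansion H" "fps_nth H 0 = Z * W + g * (Z\<^sup>2 + W\<^sup>2)"
      by (rule hs_reduced_fps) (rule that)
    define q where "q = (\<lambda>x. hs g s (x * Z) (x * W) - ((x * Z) * (x * W) + g * ((x * Z)\<^sup>2 + (x * W)\<^sup>2)))"
    have "q = (\<lambda>x. x\<^sup>2 * (h0r g Z W x + of_real s * pertr g Z W x) - x\<^sup>2 * (Z * W + g * (Z\<^sup>2 + W\<^sup>2)))"
      unfolding q_def hs_scale by (rule ext) (simp add: algebra_simps power2_eq_square)
    then have 1: "q has_fps_expansion fps_X\<^sup>2 * H - fps_X\<^sup>2 * fps_const (Z * W + g * (Z\<^sup>2 + W\<^sup>2))"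
      by (simp only:) (intro fps_expansion_intros H)
    have "\<forall>\<^sub>F x in nhds 0. norm (x * Z) < r" "\<forall>\<^sub>F x in nhds 0. norm (x * W) < r"
      by (rule eventually_norm_scaled_less[OF r])+
    then have "\<forall>\<^sub>F x in nhds 0. (\<lambda>n. fps_nth (Abs_fps (\<lambda>m. \<Sum>k\<le>m. c (m - k) k * Z ^ (m - k) * W ^ k)) n * x ^ n) sums q x"
    proof eventually_elim
      case (elim x)
      have "(\<Sum>k\<le>m. c (m - k) k * (x * Z) ^ (m - k) * (x * W) ^ k) = (\<Sum>k\<le>m. c (m - k) k * Z ^ (m - k) * W ^ k) * x ^ m" for m
        unfolding sum_distrib_right
      proof (rule sum.cong[OF refl])
        fix k assume "k \<in> {..m}"
        then have "x ^ m = x ^ (m - k) * x ^ k" by (simp flip: power_add)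
        then show "c (m - k) k * (x * Z) ^ (m - k) * (x * W) ^ k = c (m - k) k * Z ^ (m - k) * W ^ k * x ^ m"
          by (simp add: power_mult_distrib)
      qed
      then show ?case using has_sum_imp_diagonal_sums[OF c[OF elim]] by (simp add: q_def)
    qed
    then have "q has_fps_expansion Abs_fps (\<lambda>m. \<Sum>k\<le>m. c (m - k) k * Z ^ (m - k) * W ^ k)" by (rule has_fps_expansionI)
    then have e: "Abs_fps (\<lambda>m. \<Sum>k\<le>m. c (m - k) k * Z ^ (m - k) * W ^ k) = fps_X\<^sup>2 * H - fps_X\<^sup>2 * fps_const (Z * W + g * (Z\<^sup>2 + W\<^sup>2))"
      using 1 fps_expansion_unique_complex by blast
    have "(\<Sum>k\<le>m. c (m - k) k * Z ^ (m - k) * W ^ k) = fps_nth (fps_X\<^sup>2 * H - fps_X\<^sup>2 * fps_const (Z * W + g * (Z\<^sup>2 + W\<^sup>2))) m"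
      unfolding e[symmetric] by simp
    also have "\<dots> = 0" using m H(2) by (cases "m = 2") (simp_all add: fps_X_power_mult_nth)
    finally show ?thesis .
  qed
  have "{..2::nat} = {0, 1, 2}" "{..1::nat} = {0, 1}" by auto
  then have c0: "c 0 0 = 0" and c1: "c 1 0 * Z + c 0 1 * W = 0" and c2: "c 2 0 * Z\<^sup>2 + c 1 1 * Z * W + c 0 2 * W\<^sup>2 = 0" for Z W
    using part[of 0 Z W] part[of 1 Z W] part[of 2 Z W] by (simp_all add: algebra_simps)
  have "c 1 0 = 0" "c 0 1 = 0" "c 2 0 = 0" "c 0 2 = 0" using c1[of 1 0] c1[of 0 1] c2[of 1 0] c2[of 0 1] by simp_all
  moreover from this have "c 1 1 = 0" using c2[of 1 1] by simp
  moreover have "(j, k) \<in> {(0,0), (1,0), (0,1), (2,0), (1,1), (0,2)}" using jk by auto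
  ultimately show ?thesis using c0 by auto
qed

lemma exists_non_normalizable:
  assumes "\<gamma> > 1/2" "conic (of_real \<gamma>) l"
  shows "\<exists>s. \<not> (\<exists>X. is_nf (of_real \<gamma>) (hs (of_real \<gamma>) s) X)"
proof (rule ccontr)
  assume "\<not> ?thesis"
  then have ex: "\<exists>X. is_nf (of_real \<gamma>) (hs (of_real \<gamma>) s) X" for s by blast
  interpret conic "of_real \<gamma>" l by fact
  show False
  proof (rule linearized_equation[OF ex])
    fix D :: "nat \<Rightarrow> nat \<Rightarrow> nat \<Rightarrow> complex" and \<rho> :: real
    assume "\<rho> > 0" and "\<And>z w. norm z < \<rho> \<Longrightarrow> norm w < \<rho> \<Longrightarrow>
      (let t = h0 (of_real \<gamma>) z w in pert (of_real \<gamma>) z w = wsum (D 2) 0 t * (z * w)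
        + (wsum (D 0) z t * w + z * wsum (D 1) w t)
        + (wsum (D 3) 0 t + pert (of_real \<gamma>) z w) * z\<^sup>2 + 2 * (of_real \<gamma> + t) * z * wsum (D 0) z t
        + (wsum (D 4) 0 t + pert (of_real \<gamma>) z w) * w\<^sup>2 + 2 * (of_real \<gamma> + t) * w * wsum (D 1) w t)"
    then show False by (rule linearized_equation_unsolvable[OF assms(1)])
  qed
qed

lemma non_exceptional_conic:
  assumes "\<gamma> > 1/2" "\<not> exceptional \<gamma>"
  obtains l where "conic (of_real \<gamma>) l"
proof -
  define d where "d = csqrt (1 - 4 * (of_real \<gamma>)\<^sup>2)"
  define l where "l = (1 + d) / (2 * of_real \<gamma>)"
  have g: "complex_of_real \<gamma> \<noteq> 0" using assms(1) by auto
  have d: "d * d = 1 - 4 * (of_real \<gamma>)\<^sup>2" unfolding d_def by (simp flip: power2_eq_square)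
  have gl: "2 * of_real \<gamma> * l = 1 + d" using g by (simp add: l_def)
  have "4 * of_real \<gamma> * (of_real \<gamma> * l\<^sup>2 - l + of_real \<gamma>) = (2 * of_real \<gamma> * l)\<^sup>2 - 2 * (2 * of_real \<gamma> * l) + 4 * (of_real \<gamma>)\<^sup>2"
    by (simp add: algebra_simps power2_eq_square)
  also have "\<dots> = 0" unfolding gl using d by (simp add: algebra_simps power2_eq_square)
  finally have root: "of_real \<gamma> * l\<^sup>2 - l + of_real \<gamma> = 0" using g by simp
  have "conic (of_real \<gamma>) l"
  proof
    show "of_real \<gamma> * (l\<^sup>2 + 1) = l" using root by (simp add: algebra_simps)
    show "l \<noteq> 0" using root g by auto
    show "l ^ n \<noteq> 1" if "n > 0" for n using assms(2) root that unfolding exceptional_def by blast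
  qed
  then show ?thesis by (rule that)
qed

lemma biholomorphic2_on_id: "biholomorphic2_on (\<lambda>p. p) UNIV"
proof -
  have "holomorphic2_on (\<lambda>p. p) UNIV"
    unfolding holomorphic2_on_def by (auto intro!: exI[of _ "\<lambda>v. v"])
  moreover have "inv_into UNIV (\<lambda>p :: complex \<times> complex. p) = (\<lambda>p. p)" using inv_id by (simp add: id_def)
  ultimately show ?thesis unfolding biholomorphic2_on_def by simp
qed

theorem theorem1p3:
  fixes \<gamma> :: real
  assumes "\<gamma> > 1/2" and "\<not> exceptional \<gamma>"
  shows "\<exists>c r. conv_pseries2 c r \<and> (\<forall>j k. j + k < 3 \<longrightarrow> c j k = 0) \<and>
     (\<exists>F U H. 0 \<in> U \<and> biholomorphic2_on F U \<and> real_hyperplane H \<and>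
        F ` (surfM \<gamma> c r \<inter> U) \<subseteq> H) \<and>
     \<not> (\<exists>\<epsilon> s F U. (\<epsilon> = 0 \<or> ((\<epsilon> = 1 \<or> \<epsilon> = -1) \<and> s > 0)) \<and>
        0 \<in> U \<and> biholomorphic2_on F U \<and> F 0 = 0 \<and>
        F ` (surfM \<gamma> c r \<inter> U) \<subseteq> normal_surf \<gamma> \<epsilon> s)"
proof -
  define g where "g = complex_of_real \<gamma>"
  obtain l where l: "conic g l" using non_exceptional_conic[OF assms] unfolding g_def by blast
  obtain \<tau> where \<tau>: "\<not> (\<exists>X. is_nf g (hs g \<tau>) X)"
    using exists_non_normalizable[OF assms(1) l[unfolded g_def]] unfolding g_def by blast
  define q where "q = (\<lambda>p. hs g \<tau> (fst p) (snd p) - (fst p * snd p + g * ((fst p)\<^sup>2 + (snd p)\<^sup>2)))"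
  have q: "hol2 q (bidisc (1/4))"
    unfolding q_def by (intro hol2_diff hs_hol2 hol2_add hol2_mult hol2_power hol2_const hol2_fst hol2_snd)
  \<comment> \<open>Radii 1/4, 1/8 and 1/16: holomorphy, the Cauchy bound for the double series, and
    absolute convergence with ratio 1/2 in each index.\<close>
  obtain c B where c: "B > 0" "\<And>j k. norm (c j k) \<le> B / (1/8) ^ (j + k)"
    "\<And>z w. norm z < 1/8 \<Longrightarrow> norm w < 1/8 \<Longrightarrow> ((\<lambda>(j,k). c j k * z ^ j * w ^ k) has_sum q (z, w)) UNIV"
    by (rule hol2_power_series[OF q, of "1/8"]) (simp, simp, rule that)
  have surf: "surfM \<gamma> c (1/16) = {(z, hs g \<tau> z (cnj z)) | z. norm z < 1/16}"
  proof -
    have "z * cnj z + of_real \<gamma> * z\<^sup>2 + of_real \<gamma> * (cnj z)\<^sup>2 + pseries2 c z = hs g \<tau> z (cnj z)" if "norm z < 1/16" for z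
    proof -
      have "pseries2 c z = q (z, cnj z)"
        unfolding pseries2_def by (rule infsumI) (rule c(3); use that in simp)
      then show ?thesis by (simp add: q_def g_def algebra_simps)
    qed
    then show ?thesis unfolding surfM_def by (intro Collect_cong) metis
  qed
  have "conv_pseries2 c (1/16)"
    unfolding conv_pseries2_def
  proof
    have "(\<lambda>p. B * (case p of (j::nat, k::nat) \<Rightarrow> (1/2::real) ^ j * (1/2) ^ k)) summable_on UNIV"
      by (intro summable_on_cmult_right summable_geometric2) auto
    moreover have "norm (case p of (j, k) \<Rightarrow> norm (c j k) * (1/16) ^ (j + k)) \<le> B * (case p of (j, k) \<Rightarrow> (1/2) ^ j * (1/2) ^ k)" for p :: "nat \<times> nat"
    proof -
      obtain j k where p: "p = (j, k)" by force
      have "norm (c j k) * (1/16) ^ (j + k) \<le> B / (1/8) ^ (j + k) * (1/16) ^ (j + k)" by (intro mult_right_mono c(2)) auto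
      also have "\<dots> = B * (1/2) ^ (j + k)"
        using power_mult_distrib[of "1/2::real" "1/8" "j + k"] by simp
      finally show ?thesis by (simp add: p power_add)
    qed
    ultimately have "(\<lambda>p. norm (case p of (j, k) \<Rightarrow> norm (c j k) * (1/16) ^ (j + k))) summable_on UNIV"
      by (rule Infinite_Sum.abs_summable_on_comparison_test')
    then show "(\<lambda>(j, k). norm (c j k) * (1/16) ^ (j + k)) summable_on UNIV" by (rule abs_summable_summable)
  qed simp
  moreover have "\<forall>j k. j + k < 3 \<longrightarrow> c j k = 0"
    using hs_remainder_coeffs[of "1/8" c g \<tau>] c(3) by (simp add: q_def)
  moreover have "\<exists>F U H. 0 \<in> U \<and> biholomorphic2_on F U \<and> real_hyperplane H \<and> F ` (surfM \<gamma> c (1/16) \<inter> U) \<subseteq> H"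
  proof (intro exI conjI)
    show "biholomorphic2_on (\<lambda>p. p) UNIV" by (rule biholomorphic2_on_id)
    \<comment> \<open>The hyperplane \<open>Im z2 = 0\<close>, as the real inner product with
      \<open>(0, \<i>)\<close> is the imaginary part of the second coordinate.\<close>
    show "real_hyperplane {p. inner (0, \<i>) p = 0}"
      unfolding real_hyperplane_def by (intro exI[of _ "(0, \<i>)"] exI[of _ 0]) (simp add: zero_prod_def)
    have "Im (hs g \<tau> z (cnj z)) = 0" for z
    proof -
      have "cnj (hs g \<tau> z (cnj z)) = hs g \<tau> z (cnj z)" unfolding g_def by (subst hs_cnj) (simp add: hs_commute)
      then show ?thesis by (simp add: complex_eq_iff)
    qed
    then show "(\<lambda>p. p) ` (surfM \<gamma> c (1/16) \<inter> UNIV) \<subseteq> {p. inner (0, \<i>) p = 0}"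
      unfolding surf by (auto simp: inner_prod_def inner_complex_def)
  qed simp
  moreover have "\<not> (\<exists>\<epsilon> s F U. (\<epsilon> = 0 \<or> ((\<epsilon> = 1 \<or> \<epsilon> = -1) \<and> s > 0)) \<and>
        0 \<in> U \<and> biholomorphic2_on F U \<and> F 0 = 0 \<and> F ` (surfM \<gamma> c (1/16) \<inter> U) \<subseteq> normal_surf \<gamma> \<epsilon> s)"
  proof
    assume "\<exists>\<epsilon> s F U. (\<epsilon> = 0 \<or> ((\<epsilon> = 1 \<or> \<epsilon> = -1) \<and> s > 0)) \<and>
        0 \<in> U \<and> biholomorphic2_on F U \<and> F 0 = 0 \<and> F ` (surfM \<gamma> c (1/16) \<inter> U) \<subseteq> normal_surf \<gamma> \<epsilon> s"
    then obtain \<epsilon> s F U where *: "\<epsilon> = 0 \<or> s > 0" "0 \<in> U" "biholomorphic2_on F U" "F 0 = 0"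
      "F ` (surfM \<gamma> c (1/16) \<inter> U) \<subseteq> normal_surf \<gamma> \<epsilon> s" by blast
    have "F (z, hs g \<tau> z (cnj z)) \<in> normal_surf \<gamma> \<epsilon> s" if "norm z < 1/16" "(z, hs g \<tau> z (cnj z)) \<in> U" for z
      using *(5) that unfolding surf by blast
    from conic.biholomorphic_imp_nf[OF l g_def *(3,2,4,1) _ this, of "1/16"] \<tau> show False by simp
  qed
  ultimately show ?thesis by (intro exI[of _ c] exI[of _ "1/16"] conjI)
qed

end
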